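(* The complete list of minor-minimal graphs with spectator floor $2$ is $C_2\sqcup C_2$, $C_2\sqcup K_{1,3}$, $K_{1,3}\sqcup K_{1,3}$, $C_4$, $H_1$, $H_2$, $H_3$, $H_4$, $H_5$, $K_{1,4}$, and the long $Y$.
   Context: All graphs are finite, have at least one vertex, have no loops, and may have multiple (parallel) edges. $C_2$ is two vertices joined by two parallel edges. The long $Y$ is the tree on 7 vertices consisting of a central vertex with three disjoint paths of length 2 attached to it. The $3$-sun is a triangle with one pendant vertex attached to each triangle vertex. $H_1$ is $K_3$ with every edge doubled. $H_2$ is $K_{1,3}$ with two of its edges doubled. $H_3$ is obtained from a $K_3$ and a $C_2$ by identifying one vertex of each. $H_4$ is obtained from the $3$-sun by contracting one edge of its triangle (keeping the resulting parallel edges), i.e. vertices $x,e$ joined by two parallel edges, two pendant vertices attached to $x$ and one pendant vertex attached to $e$. $H_5$ has vertices $a,b,c,d,e$ with edges $ac$, $bc$, $cd$ and two parallel edges between $d$ and $e$. A minor of $H$ is any graph obtained from $H$ by a sequence of: deleting an isolated vertex, deleting an edge, contracting an edge that has no edge parallel to it. A graph is minor-minimal with spectator floor $k$ if it has spectator floor $k$ and no proper minor has spectator floor $k$. A unique shortest path is a shortest $u$–$v$ path $P$ such that every $u$–$v$ path with the same number of vertices is identical to $P$, where two paths with different edge sequences are different even if their vertex sequences agree; a single vertex is a unique shortest path. The parade number $\mathrm{usp}(G)$ is the largest number of vertices of a unique shortest path in $G$. The spectator number is $\mathrm{sp}(G)=|V(G)|-\mathrm{usp}(G)$. The spectator floor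 $\lfloor \mathrm{sp}\rfloor(G)$ is the minimum of $\mathrm{sp}(H)$ over all graphs $H$ of which $G$ is a minor. *)

theory Defs
  imports Main
begin

text \<open>Finite multigraphs (loopless, parallel edges allowed) with explicit edge
identities. Vertices and edge names are natural numbers; every finite multigraph
is isomorphic to such a graph, and all notions below are invariant under isomorphism.\<close>

record mgraph =
  verts :: "nat set"
  edges :: "nat set"
  ends  :: "nat \<Rightarrow> nat set"

definition wf_graph :: "mgraph \<Rightarrow> bool" where
  "wf_graph G \<longleftrightarrow> finite (verts G) \<and> verts G \<noteq> {} \<and> finite (edges G) \<and>
     (\<forall>e\<in>edges G. ends G e \<subseteq> verts G \<and> card (ends G e) = 2)"

definition graph_iso :: "mgraph \<Rightarrow> mgraph \<Rightarrow> bool" where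
  "graph_iso G H \<longleftrightarrow> (\<exists>f g. bij_betw f (verts G) (verts H) \<and> bij_betw g (edges G) (edges H) \<and>
     (\<forall>e\<in>edges G. ends H (g e) = f ` ends G e))"

definition del_vertex :: "mgraph \<Rightarrow> nat \<Rightarrow> mgraph" where
  "del_vertex G v = G\<lparr>verts := verts G - {v}\<rparr>"

definition del_edge :: "mgraph \<Rightarrow> nat \<Rightarrow> mgraph" where
  "del_edge G e = G\<lparr>edges := edges G - {e}\<rparr>"

definition contract :: "mgraph \<Rightarrow> nat \<Rightarrow> nat \<Rightarrow> nat \<Rightarrow> mgraph" where
  "contract G e x y = \<lparr>verts = verts G - {y}, edges = edges G - {e},
     ends = (\<lambda>f. if y \<in> ends G f then insert x (ends G f - {y}) else ends G f)\<rparr>"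

definition minor_step :: "mgraph \<Rightarrow> mgraph \<Rightarrow> bool" where
  "minor_step G G' \<longleftrightarrow>
     (\<exists>v\<in>verts G. (\<forall>e\<in>edges G. v \<notin> ends G e) \<and> card (verts G) \<ge> 2 \<and> G' = del_vertex G v)
   \<or> (\<exists>e\<in>edges G. G' = del_edge G e)
   \<or> (\<exists>e\<in>edges G. \<exists>x y. ends G e = {x, y} \<and> x \<noteq> y \<and>
        (\<forall>f\<in>edges G. f \<noteq> e \<longrightarrow> ends G f \<noteq> ends G e) \<and> G' = contract G e x y)"

definition is_minor :: "mgraph \<Rightarrow> mgraph \<Rightarrow> bool" where
  "is_minor H G \<longleftrightarrow> (\<exists>G'. minor_step\<^sup>*\<^sup>* G G' \<and> graph_iso G' H)"

definition is_proper_minor :: "mgraph \<Rightarrow> mgraph \<Rightarrow> bool" where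
  "is_proper_minor H G \<longleftrightarrow> (\<exists>G'. minor_step\<^sup>+\<^sup>+ G G' \<and> graph_iso G' H)"

definition is_path :: "mgraph \<Rightarrow> nat \<Rightarrow> nat \<Rightarrow> nat list \<Rightarrow> nat list \<Rightarrow> bool" where
  "is_path G u v vs es \<longleftrightarrow> vs \<noteq> [] \<and> hd vs = u \<and> last vs = v \<and> distinct vs \<and>
     set vs \<subseteq> verts G \<and> length vs = length es + 1 \<and>
     (\<forall>i<length es. es ! i \<in> edges G \<and> ends G (es ! i) = {vs ! i, vs ! Suc i})"

definition is_usp :: "mgraph \<Rightarrow> nat \<Rightarrow> nat \<Rightarrow> nat list \<Rightarrow> nat list \<Rightarrow> bool" where
  "is_usp G u v vs es \<longleftrightarrow> is_path G u v vs es \<and>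
     (\<forall>vs' es'. is_path G u v vs' es' \<longrightarrow> length vs \<le> length vs') \<and>
     (\<forall>vs' es'. is_path G u v vs' es' \<and> length vs' = length vs \<longrightarrow> vs' = vs \<and> es' = es)"

definition usp :: "mgraph \<Rightarrow> nat" where
  "usp G = Max {length vs | u v vs es. is_usp G u v vs es}"

definition sp :: "mgraph \<Rightarrow> nat" where
  "sp G = card (verts G) - usp G"

definition spectator_floor :: "mgraph \<Rightarrow> nat" where
  "spectator_floor G = (LEAST k. \<exists>H. wf_graph H \<and> is_minor G H \<and> sp H = k)"

definition minor_minimal_floor :: "nat \<Rightarrow> mgraph \<Rightarrow> bool" where
  "minor_minimal_floor k G \<longleftrightarrow> spectator_floor G = k \<and>
     (\<forall>H. wf_graph H \<and> is_proper_minor H G \<longrightarrow> spectator_floor H \<noteq> k)"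

definition mk_graph :: "nat \<Rightarrow> (nat \<times> nat) list \<Rightarrow> mgraph" where
  "mk_graph n l = \<lparr>verts = {0..<n}, edges = {0..<length l},
     ends = (\<lambda>i. {fst (l ! i), snd (l ! i)})\<rparr>"

definition C2_C2 where "C2_C2 = mk_graph 4 [(0,1),(0,1),(2,3),(2,3)]"
definition C2_K13 where "C2_K13 = mk_graph 6 [(0,1),(0,1),(2,3),(2,4),(2,5)]"
definition K13_K13 where "K13_K13 = mk_graph 8 [(0,1),(0,2),(0,3),(4,5),(4,6),(4,7)]"
definition C4 where "C4 = mk_graph 4 [(0,1),(1,2),(2,3),(3,0)]"
definition H1 where "H1 = mk_graph 3 [(0,1),(0,1),(1,2),(1,2),(0,2),(0,2)]"
definition H2 where "H2 = mk_graph 4 [(0,1),(0,1),(0,2),(0,2),(0,3)]"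
definition H3 where "H3 = mk_graph 4 [(0,1),(1,2),(0,2),(0,3),(0,3)]"
definition H4 where "H4 = mk_graph 5 [(0,1),(0,1),(0,2),(0,3),(1,4)]"
definition H5 where "H5 = mk_graph 5 [(0,2),(1,2),(2,3),(3,4),(3,4)]"
definition K14 where "K14 = mk_graph 5 [(0,1),(0,2),(0,3),(0,4)]"
definition long_Y where "long_Y = mk_graph 7 [(0,1),(1,2),(0,3),(3,4),(0,5),(5,6)]"

end

theory Submission
  imports Defs
begin

text \<open>A graph has spectator floor at most 1 iff it embeds into a path with one extra vertex whose
  neighbours lie in two consecutive positions of the path, that is, iff for some \<open>w\<close> the graph
  \<open>G - w\<close> is a linear forest that can be laid out so that the neighbours of \<open>w\<close> become consecutive.
  This class is minor closed, and it contains every proper minor of a listed graph but none of the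
  listed graphs. Conversely, if \<open>G\<close> has no listed minor, then its double edges, triangles and claws
  pairwise intersect, which forces a common vertex \<open>w\<close>. Cycles of length at least 4 are excluded
  through \<open>C4\<close>, so \<open>G - w\<close> is a linear forest; a case distinction on the at most three neighbours
  of \<open>w\<close> shows that \<open>w\<close>, or else one of its neighbours or a leaf at distance two, admits a layout.\<close>

text \<open>The floor is a minimum over hosts of unbounded size. \<open>layout\<close> records what
  a host leaves behind on \<open>G\<close> itself: positions along its unique shortest path, and
  heights for the vertices off it. Gaps between positions are allowed, which makes deletions
  trivial; filling the gaps recovers a host. An edge between path vertices must join consecutive
  positions and have no parallel edge, since otherwise the path would not be shortest or not unique.
  Path neighbours of one spectator cannot be further apart than one position, because a detour
  through it would then be at most as long as the path.

  Meeting all double edges, triangles and claws is necessary for the extra vertex \<open>w\<close>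
  but not sufficient, as the neighbours of \<open>w\<close> must also fit into two consecutive
  positions. This is why the vertex found first may have to be replaced. \<open>C4\<close> is an
  obstruction because, on a 4-cycle through \<open>w\<close>, both neighbours of \<open>w\<close>
  lie next to a common path vertex, hence two positions apart. Excluding it leaves the triangle as
  the only cycle on more than two vertices.\<close>

lemma wf_endsE:
  assumes "wf_graph G" "e \<in> edges G"
  obtains u v where "ends G e = {u, v}" "u \<noteq> v" "u \<in> verts G" "v \<in> verts G"
  using assms unfolding wf_graph_def by (metis card_2_iff insert_subset)

lemma wf_endsD:
  assumes "wf_graph G" "e \<in> edges G" "ends G e = {u, v}"
  shows "u \<noteq> v" "u \<in> verts G" "v \<in> verts G"
  using assms unfolding wf_graph_def by fastforce+

subsection \<open>Isomorphisms and minor steps\<close>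

lemma graph_iso_refl: "graph_iso G G"
  unfolding graph_iso_def by (rule exI[of _ id], rule exI[of _ id]) auto

lemma graph_iso_sym:
  assumes "wf_graph G" "graph_iso G H"
  shows "graph_iso H G"
proof -
  obtain f g where f: "bij_betw f (verts G) (verts H)" and g: "bij_betw g (edges G) (edges H)"
    and e: "\<And>e. e \<in> edges G \<Longrightarrow> ends H (g e) = f ` ends G e"
    using assms(2) unfolding graph_iso_def by blast
  let ?f = "inv_into (verts G) f" and ?g = "inv_into (edges G) g"
  have "ends G (?g d) = ?f ` ends H d" if "d \<in> edges H" for d
  proof -
    have d: "?g d \<in> edges G" "g (?g d) = d"
      using g that by (auto simp: bij_betw_def inv_into_into f_inv_into_f)
    have "ends G (?g d) \<subseteq> verts G" using assms(1) d(1) by (auto simp: wf_graph_def)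
    then have "?f ` f ` ends G (?g d) = ends G (?g d)"
      using f by (simp add: bij_betw_def)
    then show ?thesis using e[OF d(1)] d(2) by simp
  qed
  then show ?thesis unfolding graph_iso_def
    using bij_betw_inv_into[OF f] bij_betw_inv_into[OF g] by blast
qed

lemma graph_iso_trans:
  assumes "wf_graph G" "graph_iso G H" "graph_iso H K"
  shows "graph_iso G K"
proof -
  obtain f g where f: "bij_betw f (verts G) (verts H)" and g: "bij_betw g (edges G) (edges H)"
    and e: "\<And>e. e \<in> edges G \<Longrightarrow> ends H (g e) = f ` ends G e"
    using assms(2) unfolding graph_iso_def by blast
  obtain f' g' where f': "bij_betw f' (verts H) (verts K)" and g': "bij_betw g' (edges H) (edges K)"
    and e': "\<And>e. e \<in> edges H \<Longrightarrow> ends K (g' e) = f' ` ends H e"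
    using assms(3) unfolding graph_iso_def by blast
  have "ends K ((g' \<circ> g) d) = (f' \<circ> f) ` ends G d" if "d \<in> edges G" for d
    using e[OF that] e'[of "g d"] bij_betw_apply[OF g that] by (simp add: image_image)
  then show ?thesis unfolding graph_iso_def
    using bij_betw_trans[OF f f'] bij_betw_trans[OF g g'] by blast
qed

text \<open>Written as the image under the map sending \<open>y\<close> to \<open>x\<close>, the new
  ends compose with isomorphisms through \<open>image_image\<close>.\<close>

lemma contract_simps [simp]:
  "verts (contract G e x y) = verts G - {y}"
  "edges (contract G e x y) = edges G - {e}"
  "ends (contract G e x y) f = (\<lambda>z. if z = y then x else z) ` ends G f"
  by (auto simp: contract_def)

lemma del_simps [simp]:
  "verts (del_edge G e) = verts G" "edges (del_edge G e) = edges G - {e}"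
  "ends (del_edge G e) = ends G" "verts (del_vertex G v) = verts G - {v}"
  "edges (del_vertex G v) = edges G" "ends (del_vertex G v) = ends G"
  by (auto simp: del_edge_def del_vertex_def)

lemma minor_step_cases [consumes 1, case_names del_vertex del_edge contract]:
  assumes "minor_step G G'"
  obtains v where "v \<in> verts G" "\<And>e. e \<in> edges G \<Longrightarrow> v \<notin> ends G e" "card (verts G) \<ge> 2"
      "G' = del_vertex G v"
  | e where "e \<in> edges G" "G' = del_edge G e"
  | e x y where "e \<in> edges G" "ends G e = {x, y}" "x \<noteq> y"
      "\<And>f. f \<in> edges G \<Longrightarrow> f \<noteq> e \<Longrightarrow> ends G f \<noteq> {x, y}" "G' = contract G e x y"
  using assms unfolding minor_step_def by metis

lemma wf_minor_step:
  assumes "wf_graph G" "minor_step G G'"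
  shows "wf_graph G'"
  using assms(2)
proof (cases rule: minor_step_cases)
  case (del_vertex v)
  have "verts G - {v} \<noteq> {}"
  proof
    assume "verts G - {v} = {}"
    then have "card (verts G) \<le> card {v}" by (intro card_mono) auto
    then show False using del_vertex(3) by simp
  qed
  then show ?thesis using assms(1) del_vertex by (auto simp: wf_graph_def)
next
  case (del_edge e)
  then show ?thesis using assms(1) by (auto simp: wf_graph_def)
next
  case (contract e x y)
  have xy: "x \<in> verts G" using wf_endsD[OF assms(1) contract(1,2)] by blast
  have "ends G' f \<subseteq> verts G' \<and> card (ends G' f) = 2" if "f \<in> edges G'" for f
  proof -
    have f: "f \<in> edges G" "f \<noteq> e" using that contract by auto
    obtain u v where uv: "ends G f = {u, v}" "u \<noteq> v" "u \<in> verts G" "v \<in> verts G"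
      using wf_endsE[OF assms(1) f(1)] .
    \<comment> \<open>An edge with both ends in \<open>{x, y}\<close> would turn into a loop; this
      is where the ban on contracting an edge with a parallel edge enters.\<close>
    have "{u, v} \<noteq> {x, y}" using contract(4)[OF f] uv(1) by simp
    then have "(if u = y then x else u) \<noteq> (if v = y then x else v)" using uv(2) by auto
    moreover have "ends G' f = {if u = y then x else u, if v = y then x else v}"
      unfolding contract(5) contract_simps uv(1) by simp
    ultimately show ?thesis using uv(3,4) xy contract(3) unfolding contract(5) by simp
  qed
  then show ?thesis using assms(1) xy contract by (auto simp: wf_graph_def)
qed

lemma wf_minor_steps: "minor_step\<^sup>*\<^sup>* G G' \<Longrightarrow> wf_graph G \<Longrightarrow> wf_graph G'"
  by (induction rule: rtranclp_induct) (auto intro: wf_minor_step)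

lemma wf_graph_iso:
  assumes "wf_graph G" "graph_iso G H"
  shows "wf_graph H"
proof -
  obtain f g where f: "bij_betw f (verts G) (verts H)" and g: "bij_betw g (edges G) (edges H)"
    and e: "\<And>e. e \<in> edges G \<Longrightarrow> ends H (g e) = f ` ends G e"
    using assms(2) unfolding graph_iso_def by blast
  have "ends H d \<subseteq> verts H \<and> card (ends H d) = 2" if "d \<in> edges H" for d
  proof -
    obtain d' where d': "d' \<in> edges G" "d = g d'" using g \<open>d \<in> edges H\<close> by (auto simp: bij_betw_def)
    have s: "ends G d' \<subseteq> verts G" "card (ends G d') = 2" using assms(1) d' by (auto simp: wf_graph_def)
    have "card (f ` ends G d') = card (ends G d')"
      using s f by (intro card_image) (auto simp: bij_betw_def inj_on_subset)
    then show ?thesis using s e[OF d'(1)] d' f by (auto simp: bij_betw_def)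
  qed
  moreover have "verts H \<noteq> {}" using f assms(1) by (auto simp: bij_betw_def wf_graph_def)
  ultimately show ?thesis
    using assms(1) bij_betw_finite[OF f] bij_betw_finite[OF g] by (auto simp: wf_graph_def)
qed

text \<open>Carries a minor step of an arbitrary copy over to the explicit listed graph, where all
  steps are checked by evaluation.\<close>

lemma minor_step_iso:
  assumes "wf_graph G" "graph_iso G H" "minor_step G G'"
  shows "\<exists>H'. minor_step H H' \<and> graph_iso G' H'"
proof -
  obtain f g where f: "bij_betw f (verts G) (verts H)" and g: "bij_betw g (edges G) (edges H)"
    and e: "\<And>e. e \<in> edges G \<Longrightarrow> ends H (g e) = f ` ends G e"
    using assms(2) unfolding graph_iso_def by blast
  have sub: "ends G d \<subseteq> verts G" if "d \<in> edges G" for d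
    using assms(1) that by (auto simp: wf_graph_def)
  have inj: "f a = f b \<longleftrightarrow> a = b" if "a \<in> verts G" "b \<in> verts G" for a b
    using f that by (auto simp: bij_betw_def inj_on_def)
  have ginj: "g a = g b \<longleftrightarrow> a = b" if "a \<in> edges G" "b \<in> edges G" for a b
    using g that by (auto simp: bij_betw_def inj_on_def)
  have edgeH: "\<exists>d\<in>edges G. d' = g d" if "d' \<in> edges H" for d'
    using g that by (auto simp: bij_betw_def)
  have fV: "f a \<in> verts H" if "a \<in> verts G" for a using f that by (auto simp: bij_betw_def)
  have gE: "g a \<in> edges H" if "a \<in> edges G" for a using g that by (auto simp: bij_betw_def)
  have bij1: "bij_betw f (verts G - {v}) (verts H - {f v})" if "v \<in> verts G" for v
    using bij_betw_DiffI[OF f, of "{v}" "{f v}"] that fV by (simp add: bij_betw_def)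
  have bij2: "bij_betw g (edges G - {d}) (edges H - {g d})" if "d \<in> edges G" for d
    using bij_betw_DiffI[OF g, of "{d}" "{g d}"] that gE by (simp add: bij_betw_def)
  show ?thesis
    using assms(3)
  proof (cases rule: minor_step_cases)
    case (del_vertex v)
    have "f v \<notin> ends H d'" if d': "d' \<in> edges H" for d'
    proof
      assume a: "f v \<in> ends H d'"
      obtain d where d: "d \<in> edges G" "d' = g d" using edgeH[OF d'] by blast
      then obtain u where u: "u \<in> ends G d" "f v = f u" using a e by auto
      then have "u \<in> verts G" using sub[OF d(1)] by blast
      then have "v = u" using inj del_vertex(1) u(2) by simp
      then show False using del_vertex(2)[OF d(1)] u(1) by simp
    qed
    moreover have "card (verts H) \<ge> 2" using bij_betw_same_card[OF f] del_vertex(3) by simp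
    ultimately have "minor_step H (del_vertex H (f v))"
      unfolding minor_step_def using fV[OF del_vertex(1)] by blast
    moreover have "graph_iso G' (del_vertex H (f v))"
      unfolding graph_iso_def del_vertex(4)
      by (rule exI[of _ f], rule exI[of _ g]) (simp add: bij1[OF del_vertex(1)] g e)
    ultimately show ?thesis by blast
  next
    case (del_edge d)
    have "minor_step H (del_edge H (g d))"
      unfolding minor_step_def using gE[OF del_edge(1)] by blast
    moreover have "graph_iso G' (del_edge H (g d))"
      unfolding graph_iso_def del_edge(2)
      by (rule exI[of _ f], rule exI[of _ g]) (simp add: bij2[OF del_edge(1)] f e)
    ultimately show ?thesis by blast
  next
    case (contract d x y)
    have V: "x \<in> verts G" "y \<in> verts G" using wf_endsD[OF assms(1) contract(1,2)] by auto
    have ed: "ends H (g d) = {f x, f y}" using e[OF contract(1)] contract(2) by simp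
    have "ends H c' \<noteq> ends H (g d)" if c': "c' \<in> edges H" "c' \<noteq> g d" for c'
    proof
      assume a: "ends H c' = ends H (g d)"
      obtain c where c: "c \<in> edges G" "c' = g c" using edgeH[OF c'(1)] by blast
      have "f ` ends G c = f ` {x, y}" using a e[OF c(1)] ed c by simp
      then have "ends G c = {x, y}"
        using inj_on_image_eq_iff[of f "verts G" "ends G c" "{x, y}"] bij_betw_imp_inj_on[OF f]
          sub[OF c(1)] V by simp
      then show False using contract(4)[OF c(1)] c' c by auto
    qed
    moreover have "f x \<noteq> f y" using inj V contract(3) by simp
    ultimately have "minor_step H (contract H (g d) (f x) (f y))"
      unfolding minor_step_def using gE[OF contract(1)] ed by blast
    moreover have "graph_iso G' (contract H (g d) (f x) (f y))"
    proof -
      have "(\<lambda>z. if z = f y then f x else z) ` f ` ends G c = f ` (\<lambda>z. if z = y then x else z) ` ends G c"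
        if "c \<in> edges G" for c
        unfolding image_image
        by (rule image_cong[OF refl]) (use inj V sub[OF that] in auto)
      then show ?thesis
        unfolding graph_iso_def contract(5)
        by (intro exI[of _ f] exI[of _ g]) (simp add: bij1[OF V(2)] bij2[OF contract(1)] e)
    qed
    ultimately show ?thesis by blast
  qed
qed

subsection \<open>Subgraphs as minors\<close>

lemma del_edges_minor:
  assumes "finite F" "F \<subseteq> edges G"
  shows "minor_step\<^sup>*\<^sup>* G (G\<lparr>edges := edges G - F\<rparr>)"
  using assms
proof (induction F rule: finite_induct)
  case empty
  then show ?case by simp
next
  case (insert e F)
  let ?G = "G\<lparr>edges := edges G - F\<rparr>"
  have "minor_step ?G (del_edge ?G e)"
    unfolding minor_step_def using insert by auto
  moreover have "del_edge ?G e = G\<lparr>edges := edges G - insert e F\<rparr>"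
    unfolding del_edge_def by (simp add: set_diff_eq conj_ac)
  moreover have "minor_step\<^sup>*\<^sup>* G ?G" using insert.IH insert.prems by blast
  ultimately show ?case by (metis rtranclp.rtrancl_into_rtrancl)
qed

lemma del_verts_minor:
  assumes "finite (verts G)" "S \<subseteq> verts G" "verts G - S \<noteq> {}" "\<And>e. e \<in> edges G \<Longrightarrow> ends G e \<inter> S = {}"
  shows "minor_step\<^sup>*\<^sup>* G (G\<lparr>verts := verts G - S\<rparr>)"
proof -
  have "finite S" using assms finite_subset by blast
  then show ?thesis using assms(2-)
  proof (induction S rule: finite_induct)
    case empty
    then show ?case by simp
  next
    case (insert v S)
    let ?G = "G\<lparr>verts := verts G - S\<rparr>"
    obtain u where u: "u \<in> verts G - insert v S" using insert by blast
    then have "{u, v} \<subseteq> verts ?G" "u \<noteq> v" using insert by auto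
    then have "card (verts ?G) \<ge> 2"
      using card_mono[of "verts ?G" "{u, v}"] assms(1) by simp
    moreover have "v \<in> verts ?G" using insert by simp
    ultimately have "minor_step ?G (del_vertex ?G v)"
      unfolding minor_step_def by (intro disjI1 bexI[of _ v]) (use insert.prems(3) in auto)
    moreover have "del_vertex ?G v = G\<lparr>verts := verts G - insert v S\<rparr>"
      unfolding del_vertex_def by (simp add: set_diff_eq conj_ac)
    moreover have "minor_step\<^sup>*\<^sup>* G ?G"
      by (rule insert.IH) (use insert.prems in auto)
    ultimately show ?case by (metis rtranclp.rtrancl_into_rtrancl)
  qed
qed

text \<open>Deleting the edges outside the image first isolates the vertices outside it, so that
  these may be deleted next.\<close>

lemma subgraph_minor:
  assumes "wf_graph G" "wf_graph H"
    and f: "inj_on f (verts G)" "f ` verts G \<subseteq> verts H"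
    and g: "inj_on g (edges G)" "g ` edges G \<subseteq> edges H"
    and e: "\<And>e. e \<in> edges G \<Longrightarrow> ends H (g e) = f ` ends G e"
  shows "is_minor G H"
proof -
  let ?H1 = "H\<lparr>edges := edges H - (edges H - g ` edges G)\<rparr>"
  let ?H2 = "?H1\<lparr>verts := verts ?H1 - (verts H - f ` verts G)\<rparr>"
  have "minor_step\<^sup>*\<^sup>* H ?H1"
    using assms(2) by (intro del_edges_minor) (auto simp: wf_graph_def)
  moreover have "minor_step\<^sup>*\<^sup>* ?H1 ?H2"
  proof (rule del_verts_minor)
    show "finite (verts ?H1)" using assms(2) by (simp add: wf_graph_def)
    show "verts ?H1 - (verts H - f ` verts G) \<noteq> {}"
      using assms(1) f(2) by (fastforce simp: wf_graph_def)
    show "ends ?H1 d \<inter> (verts H - f ` verts G) = {}" if d: "d \<in> edges ?H1" for d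
    proof -
      obtain c where "c \<in> edges G" "d = g c" using d by auto
      moreover from this have "ends G c \<subseteq> verts G" using assms(1) by (simp add: wf_graph_def)
      ultimately show ?thesis using e by auto
    qed
  qed auto
  moreover have "graph_iso G ?H2"
    unfolding graph_iso_def using f g e
    by (intro exI[of _ f] exI[of _ g]) (auto simp: bij_betw_def)
  ultimately show ?thesis unfolding is_minor_def
    using graph_iso_sym[OF assms(1)] rtranclp_trans[of minor_step] by blast
qed

lemma is_minor_step_trans:
  assumes "minor_step\<^sup>*\<^sup>* G G'" "is_minor M G'"
  shows "is_minor M G"
  using assms rtranclp_trans[of minor_step] unfolding is_minor_def by blast

subsection \<open>Layouts\<close>

text \<open>\<open>W\<close> is the set of vertices off the path. Vertices outside \<open>W\<close> have distinct positions on the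
  path, and the height of \<open>w \<in> W\<close> is the lower of the two consecutive positions in which
  neighbours of \<open>w\<close> may lie. No edge leads up from the path into \<open>W\<close>, so that no path through \<open>W\<close>
  competes with the main path.\<close>

definition layout :: "nat set \<Rightarrow> (nat \<Rightarrow> nat) \<Rightarrow> mgraph \<Rightarrow> bool" where
  "layout W p G \<longleftrightarrow> inj_on p (verts G - W) \<and>
     (\<forall>e\<in>edges G. \<forall>u v. ends G e = {u, v} \<longrightarrow>
        (u \<notin> W \<and> v \<notin> W \<longrightarrow> (p v = Suc (p u) \<or> p u = Suc (p v)) \<and>
           (\<forall>d\<in>edges G. ends G d = {u, v} \<longrightarrow> d = e)) \<and>
        (u \<notin> W \<and> v \<in> W \<longrightarrow> p u = p v \<or> p u = Suc (p v)) \<and>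
        (u \<in> W \<and> v \<in> W \<longrightarrow> p u \<le> Suc (p v)))"

text \<open>Only vertices of \<open>G\<close> are counted: the preimage of \<open>W\<close> under an
  embedding is a set of names that need not be vertices and may be infinite.\<close>

definition laid :: "nat \<Rightarrow> mgraph \<Rightarrow> bool" where
  "laid k G \<longleftrightarrow> (\<exists>W p. layout W p G \<and> card (W \<inter> verts G) \<le> k)"

lemma layoutD:
  assumes "layout W p G" "e \<in> edges G" "ends G e = {u, v}"
  shows "u \<notin> W \<Longrightarrow> v \<notin> W \<Longrightarrow> p v = Suc (p u) \<or> p u = Suc (p v)"
    and "u \<notin> W \<Longrightarrow> v \<notin> W \<Longrightarrow> d \<in> edges G \<Longrightarrow> ends G d = {u, v} \<Longrightarrow> d = e"
    and "u \<notin> W \<Longrightarrow> v \<in> W \<Longrightarrow> p u = p v \<or> p u = Suc (p v)"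
    and "u \<in> W \<Longrightarrow> v \<in> W \<Longrightarrow> p u \<le> Suc (p v)"
  using assms unfolding layout_def by blast+

lemma layout_inj: "layout W p G \<Longrightarrow> inj_on p (verts G - W)"
  by (simp add: layout_def)

text \<open>Positions can be pulled back along any injective map because the image may have gaps.
  One statement thus covers isomorphisms and both kinds of deletion.\<close>

lemma laid_embed:
  assumes "wf_graph G" "wf_graph H" "laid k H"
    and f: "inj_on f (verts G)" "f ` verts G \<subseteq> verts H"
    and g: "inj_on g (edges G)" "g ` edges G \<subseteq> edges H"
    and e: "\<And>e. e \<in> edges G \<Longrightarrow> ends H (g e) = f ` ends G e"
  shows "laid k G"
proof -
  obtain W p where L: "layout W p H" and c: "card (W \<inter> verts H) \<le> k"
    using assms(3) unfolding laid_def by blast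
  let ?W = "{v. f v \<in> W}" and ?p = "p \<circ> f"
  have "inj_on f (verts G - ?W)" using f(1) by (rule inj_on_subset) auto
  moreover have "inj_on p (f ` (verts G - ?W))"
    using layout_inj[OF L] by (rule inj_on_subset) (use f(2) in auto)
  ultimately have "inj_on ?p (verts G - ?W)" by (rule comp_inj_on)
  moreover have "(u \<notin> ?W \<and> v \<notin> ?W \<longrightarrow> (?p v = Suc (?p u) \<or> ?p u = Suc (?p v)) \<and>
           (\<forall>d\<in>edges G. ends G d = {u, v} \<longrightarrow> d = b)) \<and>
        (u \<notin> ?W \<and> v \<in> ?W \<longrightarrow> ?p u = ?p v \<or> ?p u = Suc (?p v)) \<and>
        (u \<in> ?W \<and> v \<in> ?W \<longrightarrow> ?p u \<le> Suc (?p v))" if b: "b \<in> edges G" "ends G b = {u, v}" for b u v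
  proof -
    have gb: "g b \<in> edges H" "ends H (g b) = {f u, f v}" using b g e by auto
    have "d = b" if d: "f u \<notin> W" "f v \<notin> W" "d \<in> edges G" "ends G d = {u, v}" for d
    proof -
      have "g d \<in> edges H" "ends H (g d) = {f u, f v}" using d g e by auto
      then have "g d = g b" using layoutD(2)[OF L gb] d by blast
      then show ?thesis using g b d by (auto simp: inj_on_def)
    qed
    then show ?thesis using layoutD(1,3,4)[OF L gb] by auto
  qed
  ultimately have "layout ?W ?p G" unfolding layout_def by blast
  moreover have "card (?W \<inter> verts G) \<le> card (W \<inter> verts H)"
    by (rule card_inj_on_le[of f]) (use f assms(2) in \<open>auto simp: inj_on_def wf_graph_def\<close>)
  ultimately show ?thesis unfolding laid_def using c by (meson order_trans)
qed

lemma laid_iso: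
  assumes "wf_graph G" "graph_iso G H" "laid k H"
  shows "laid k G"
proof -
  obtain f g where "bij_betw f (verts G) (verts H)" "bij_betw g (edges G) (edges H)"
    "\<And>e. e \<in> edges G \<Longrightarrow> ends H (g e) = f ` ends G e"
    using assms(2) unfolding graph_iso_def by blast
  then show ?thesis
    using laid_embed[OF assms(1) wf_graph_iso[OF assms(1,2)] assms(3), of f g]
    by (simp add: bij_betw_def)
qed

text \<open>If neither end of the contracted edge lies in \<open>W\<close>, the gap between them is closed;
  otherwise the merged vertex becomes the new exceptional vertex, and the position of the end
  that used to lie on the path is closed up.\<close>

lemma layout_contract_path:
  assumes wf: "wf_graph G" and L: "layout W p G" and e: "e \<in> edges G" "ends G e = {x, y}"
    and par: "\<And>f. f \<in> edges G \<Longrightarrow> f \<noteq> e \<Longrightarrow> ends G f \<noteq> {x, y}"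
    and xy: "x \<notin> W" "y \<notin> W"
  shows "layout W (\<lambda>z. if p z > min (p x) (p y) then p z - 1 else p z) (contract G e x y)"
    (is "layout W ?p ?G")
proof -
  let ?r = "\<lambda>z. if z = y then x else z"
  define j where "j = min (p x) (p y)"
  have V: "x \<in> verts G" "y \<in> verts G" using wf_endsD[OF wf e] by auto
  have pxy: "p x = j \<and> p y = Suc j \<or> p y = j \<and> p x = Suc j"
    using layoutD(1)[OF L e xy] unfolding j_def by auto
  have inj: "a = b" if "p a = p b" "a \<in> verts G - W" "b \<in> verts G - W" for a b
    using layout_inj[OF L] that by (auto simp: inj_on_def)
  have two: "{a, b} = {x, y}" if "p a = j" "p b = Suc j" "a \<in> verts G - W" "b \<in> verts G - W" for a b
  proof -
    have "x \<in> verts G - W" "y \<in> verts G - W" using V xy by auto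
    then have "a = x \<and> b = y \<or> a = y \<and> b = x" using pxy inj that by metis
    then show ?thesis by blast
  qed
  have p: "?p z = (if p z > j then p z - 1 else p z)" for z unfolding j_def ..
  \<comment> \<open>Both ends of the contracted edge land on position \<open>j\<close>, so the new
    positions do not depend on which of them survives.\<close>
  have pr: "?p (?r z) = ?p z" for z using pxy unfolding p by auto
  have rW: "?r z \<in> W \<longleftrightarrow> z \<in> W" for z using xy by auto
  have "inj_on ?p (verts ?G - W)"
  proof (rule inj_onI)
    fix a b assume ab: "a \<in> verts ?G - W" "b \<in> verts ?G - W" "?p a = ?p b"
    \<comment> \<open>Only the positions \<open>j\<close> and \<open>Suc j\<close> are identified.
      They belong to \<open>x\<close> and \<open>y\<close>, and \<open>y\<close> is gone.\<close>
    have "p a = p b \<or> p a = j \<and> p b = Suc j \<or> p b = j \<and> p a = Suc j"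
      using ab(3) unfolding p by (auto split: if_splits)
    then show "a = b"
      using two[of a b] two[of b a] inj[of a b] ab(1,2) by (auto simp: doubleton_eq_iff)
  qed
  moreover have "(u \<notin> W \<and> v \<notin> W \<longrightarrow> (?p v = Suc (?p u) \<or> ?p u = Suc (?p v)) \<and>
           (\<forall>d\<in>edges ?G. ends ?G d = {u, v} \<longrightarrow> d = b)) \<and>
        (u \<notin> W \<and> v \<in> W \<longrightarrow> ?p u = ?p v \<or> ?p u = Suc (?p v)) \<and>
        (u \<in> W \<and> v \<in> W \<longrightarrow> ?p u \<le> Suc (?p v))"
    if b: "b \<in> edges ?G" "ends ?G b = {u, v}" for b u v
  proof -
    have lift: "\<exists>s t. ends G d = {s, t} \<and> ?r s = u \<and> ?r t = v" if d: "d \<in> edges ?G" "ends ?G d = {u, v}" for d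
    proof -
      have "d \<in> edges G" using d(1) by simp
      then obtain s t where st: "ends G d = {s, t}" by (rule wf_endsE[OF wf])
      have "?r ` ends G d = {u, v}" using d(2) by simp
      then have "{?r s, ?r t} = {u, v}" unfolding st by (simp only: image_insert image_empty)
      then have "?r s = u \<and> ?r t = v \<or> ?r s = v \<and> ?r t = u" by (simp only: doubleton_eq_iff)
      moreover have "ends G d = {t, s}" using st by (simp add: insert_commute)
      ultimately show ?thesis using st by blast
    qed
    obtain s t where st: "ends G b = {s, t}" "?r s = u" "?r t = v" using lift[OF b] by blast
    have bG: "b \<in> edges G" "b \<noteq> e" using b by auto
    note D = layoutD[OF L bG(1) st(1)]
    have Vst: "s \<in> verts G" "t \<in> verts G" "s \<noteq> t" using wf_endsD[OF wf bG(1) st(1)] by auto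
    have W: "u \<in> W \<longleftrightarrow> s \<in> W" "v \<in> W \<longleftrightarrow> t \<in> W" using rW st by blast+
    have P: "?p u = ?p s" "?p v = ?p t" using pr st by blast+
    have nxy: "{s, t} \<noteq> {x, y}" using par[OF bG] st(1) by simp
    have A: "?p v = Suc (?p u) \<or> ?p u = Suc (?p v)" if "u \<notin> W" "v \<notin> W"
    proof -
      have "p t = Suc (p s) \<or> p s = Suc (p t)" using D(1) that W by simp
      moreover have "\<not> (p s = j \<and> p t = Suc j)" "\<not> (p t = j \<and> p s = Suc j)"
        using two[of s t] two[of t s] nxy Vst that W by (auto simp: insert_commute)
      ultimately show ?thesis unfolding P unfolding p by auto
    qed
    have B: "d = b" if uv: "u \<notin> W" "v \<notin> W" and d: "d \<in> edges ?G" "ends ?G d = {u, v}" for d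
    proof -
      obtain s' t' where st': "ends G d = {s', t'}" "?r s' = u" "?r t' = v" using lift[OF d] by blast
      have dG: "d \<in> edges G" "d \<noteq> e" using d by auto
      have nxy': "{s', t'} \<noteq> {x, y}" using par[OF dG] st'(1) by simp
      have W': "s' \<notin> W" "t' \<notin> W" using rW[of s'] rW[of t'] st'(2,3) uv by simp_all
      have Vst': "s' \<in> verts G" "t' \<in> verts G" "s' \<noteq> t'" using wf_endsD[OF wf dG(1) st'(1)] by auto
      have c1: "p t = Suc (p s) \<or> p s = Suc (p t)" using D(1) uv W by simp
      have c2: "p t' = Suc (p s') \<or> p s' = Suc (p t')" using layoutD(1)[OF L dG(1) st'(1) W'] .
      have "s' = s \<or> {s', s} = {x, y}" "t' = t \<or> {t', t} = {x, y}"
        using st(2,3) st'(2,3) by (auto split: if_splits)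
      \<comment> \<open>Otherwise \<open>t\<close> would be one position away from both
        \<open>j\<close> and \<open>Suc j\<close>, which parity forbids: contraction on the path
        creates no parallel edges.\<close>
      moreover have "\<not> {s', s} = {x, y}"
      proof
        assume s: "{s', s} = {x, y}"
        have "t' = t" using \<open>t' = t \<or> {t', t} = {x, y}\<close> s Vst(3) Vst'(3) nxy nxy'
          by (auto simp: doubleton_eq_iff)
        then show False using c1 c2 pxy s by (auto simp: doubleton_eq_iff)
      qed
      moreover have "\<not> {t', t} = {x, y}"
      proof
        assume t: "{t', t} = {x, y}"
        have "s' = s" using \<open>s' = s \<or> {s', s} = {x, y}\<close> t Vst(3) Vst'(3) nxy nxy'
          by (auto simp: doubleton_eq_iff)
        then show False using c1 c2 pxy t by (auto simp: doubleton_eq_iff)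
      qed
      ultimately have "ends G d = {s, t}" using st'(1) by simp
      then show ?thesis using D(2)[OF _ _ dG(1)] W uv by simp
    qed
    have C: "?p u = ?p v \<or> ?p u = Suc (?p v)" if "u \<notin> W" "v \<in> W"
      using D(3) W that unfolding P unfolding p by auto
    have E: "?p u \<le> Suc (?p v)" if "u \<in> W" "v \<in> W"
      using D(4) W that unfolding P unfolding p by auto
    show ?thesis using A B C E by blast
  qed
  ultimately show ?thesis unfolding layout_def by blast
qed

lemma layout_contract_exceptional:
  assumes wf: "wf_graph G" and L: "layout W p G" and W: "W \<inter> verts G = {w}"
    and e: "e \<in> edges G" "ends G e = {x, y}"
    and par: "\<And>f. f \<in> edges G \<Longrightarrow> f \<noteq> e \<Longrightarrow> ends G f \<noteq> {x, y}"
    and xy: "{x, y} = {w, u}"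
  shows "layout {x} (\<lambda>z. if z = x \<or> p z > p u then (if z = x then p u - 1 else p z - 1) else p z)
    (contract G e x y)"
    (is "layout {x} ?p ?G")
proof -
  let ?r = "\<lambda>z. if z = y then x else z"
  have wfe: "x \<noteq> y" "x \<in> verts G" "y \<in> verts G" using wf_endsD[OF wf e] by auto
  have wu: "w \<noteq> u" "u \<in> verts G" "u \<notin> W" "w \<in> verts G" "w \<in> W"
    using wfe xy W by (auto simp: doubleton_eq_iff)
  have notW: "z \<notin> W \<longleftrightarrow> z \<noteq> w" if "z \<in> verts G" for z using W that by auto
  have inj: "a = b" if "p a = p b" "a \<in> verts G - {w}" "b \<in> verts G - {w}" for a b
    using layout_inj[OF L] that notW by (auto simp: inj_on_def)
  have pu: "p u = p w \<or> p u = Suc (p w)"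
    using layoutD(3)[OF L e(1), of u w] wu e(2) xy by (simp add: insert_commute)
  have nz: "p z \<noteq> p u" if "z \<in> verts G" "z \<noteq> x" "z \<noteq> y" for z
    using inj[of z u] that wu xy by (auto simp: doubleton_eq_iff)
  have "inj_on ?p (verts ?G - {x})"
  proof (rule inj_onI)
    fix a b assume ab: "a \<in> verts ?G - {x}" "b \<in> verts ?G - {x}" "?p a = ?p b"
    have "p a \<noteq> p u" "p b \<noteq> p u" using nz ab by auto
    then have "p a = p b" using ab by (auto split: if_splits)
    then show "a = b" using inj ab(1,2) xy by (auto simp: doubleton_eq_iff)
  qed
  moreover have "(s \<notin> {x} \<and> t \<notin> {x} \<longrightarrow> (?p t = Suc (?p s) \<or> ?p s = Suc (?p t)) \<and>
           (\<forall>d\<in>edges ?G. ends ?G d = {s, t} \<longrightarrow> d = b)) \<and>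
        (s \<notin> {x} \<and> t \<in> {x} \<longrightarrow> ?p s = ?p t \<or> ?p s = Suc (?p t)) \<and>
        (s \<in> {x} \<and> t \<in> {x} \<longrightarrow> ?p s \<le> Suc (?p t))"
    if b: "b \<in> edges ?G" "ends ?G b = {s, t}" for b s t
  proof -
    have bG: "b \<in> edges G" "b \<noteq> e" using b by auto
    have A: "ends G d = {s, t} \<and> s \<noteq> y \<and> t \<noteq> y" if "s \<noteq> x" "t \<noteq> x" "ends ?G d = {s, t}" for d
    proof -
      have "?r ` ends G d = {s, t}" using that by simp
      moreover have "y \<notin> ends G d"
      proof
        assume "y \<in> ends G d"
        then have "?r y \<in> ?r ` ends G d" by (rule imageI)
        then show False using that calculation by auto
      qed
      moreover from this have "?r ` ends G d = id ` ends G d" by (intro image_cong) auto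
      ultimately show ?thesis by auto
    qed
    have st: "(?p t = Suc (?p s) \<or> ?p s = Suc (?p t)) \<and>
           (\<forall>d\<in>edges ?G. ends ?G d = {s, t} \<longrightarrow> d = b)" if n: "s \<noteq> x" "t \<noteq> x"
    proof -
      have 1: "ends G b = {s, t}" "s \<noteq> y" "t \<noteq> y" using A[OF n b(2)] by auto
      have 2: "s \<in> verts G" "t \<in> verts G" using wf_endsD[OF wf bG(1) 1(1)] by auto
      have 3: "s \<notin> W" "t \<notin> W" using notW 2 1 n xy by (auto simp: doubleton_eq_iff)
      have 4: "p t = Suc (p s) \<or> p s = Suc (p t)" using layoutD(1)[OF L bG(1) 1(1) 3] .
      have 5: "p s \<noteq> p u" "p t \<noteq> p u" using nz 1 2 n by auto
      have "d = b" if "d \<in> edges ?G" "ends ?G d = {s, t}" for d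
        using layoutD(2)[OF L bG(1) 1(1) 3, of d] A[OF n that(2)] that by simp
      then show ?thesis using 4 5 n by auto
    qed
    have sx: "?p s = ?p t \<or> ?p s = Suc (?p t)" if n: "s \<noteq> x" "t = x"
    proof -
      obtain a c where ac: "ends G b = {a, c}" "a \<noteq> c" "a \<in> verts G" "c \<in> verts G"
        using wf_endsE[OF wf bG(1)] .
      have "?r ` ends G b = {s, x}" using b(2) n by simp
      then have "{?r a, ?r c} = {s, x}" unfolding ac(1) by (simp only: image_insert image_empty)
      then have "\<exists>c. ends G b = {s, c} \<and> s \<noteq> y \<and> (c = x \<or> c = y)"
        using ac n by (auto simp: doubleton_eq_iff insert_commute split: if_splits)
      then obtain c where c: "ends G b = {s, c}" "s \<noteq> y" "c \<in> {w, u}" using xy by auto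
      have s: "s \<in> verts G" using wf_endsD[OF wf bG(1) c(1)] by auto
      have sW: "s \<notin> W" using notW[OF s] c(2) n xy by (auto simp: doubleton_eq_iff)
      have ps: "p s \<noteq> p u" using nz s n c by auto
      \<comment> \<open>The position of \<open>u\<close> is vacated, so all neighbours of the merged
        vertex sit directly below or above it, and closing up makes these two positions consecutive.
        If \<open>p u = 0\<close>, only the upper one exists; it moves down to 0, which is also the
        height given by truncated subtraction.\<close>
      have "p s = Suc (p u) \<or> p u = Suc (p s)"
      proof (cases "c = u")
        case True
        then show ?thesis using layoutD(1)[OF L bG(1) c(1) sW] wu by auto
      next
        case False
        then show ?thesis using layoutD(3)[OF L bG(1) c(1) sW] wu c(3) pu ps by auto
      qed
      then show ?thesis using n by auto
    qed
    show ?thesis using st sx by auto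
  qed
  ultimately show ?thesis unfolding layout_def by blast
qed

lemma laid_minor_step:
  assumes wf: "wf_graph G" and "laid 1 G" "minor_step G G'"
  shows "laid 1 G'"
  using assms(3)
proof (cases rule: minor_step_cases)
  case (del_vertex v)
  show ?thesis
    by (rule laid_embed[OF wf_minor_step[OF wf assms(3)] wf assms(2), of id id])
      (auto simp: del_vertex)
next
  case (del_edge e)
  show ?thesis
    by (rule laid_embed[OF wf_minor_step[OF wf assms(3)] wf assms(2), of id id])
      (auto simp: del_edge)
next
  case (contract e x y)
  obtain W p where L: "layout W p G" and c: "card (W \<inter> verts G) \<le> 1"
    using assms(2) unfolding laid_def by blast
  have fin: "finite (W \<inter> verts G)" using wf by (auto simp: wf_graph_def)
  have V: "x \<in> verts G" "y \<in> verts G" using wf_endsD[OF wf contract(1,2)] by auto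
  show ?thesis
  proof (cases "x \<in> W \<or> y \<in> W")
    case False
    then have "layout W (\<lambda>z. if p z > min (p x) (p y) then p z - 1 else p z) G'"
      using layout_contract_path[OF wf L contract(1,2,4)] contract(5) by simp
    moreover have "card (W \<inter> verts G') \<le> card (W \<inter> verts G)"
      using fin contract(5) by (intro card_mono) auto
    ultimately show ?thesis unfolding laid_def using c by (meson order_trans)
  next
    case True
    then obtain w where w: "w \<in> W \<inter> verts G" "w = x \<or> w = y" using V by auto
    have W: "W \<inter> verts G = {w}"
      using w c fin card_le_Suc0_iff_eq[OF fin] by (auto simp: One_nat_def)
    obtain u where "{x, y} = {w, u}" using w(2) by auto
    then have "\<exists>q. layout {x} q G'"
      using layout_contract_exceptional[OF wf L W contract(1,2,4)] contract(5) by blast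
    moreover have "card ({x} \<inter> verts G') \<le> 1"
      using card_mono[of "{x}" "{x} \<inter> verts G'"] by simp
    ultimately show ?thesis unfolding laid_def by blast
  qed
qed

lemma laid_minor_steps:
  assumes "minor_step\<^sup>*\<^sup>* G G'" "wf_graph G" "laid 1 G"
  shows "laid 1 G'"
  using assms by (induction rule: rtranclp_induct) (blast intro: laid_minor_step wf_minor_steps)+

lemma laid_minor:
  assumes "is_minor M G" "wf_graph M" "wf_graph G" "laid 1 G"
  shows "laid 1 M"
proof -
  obtain G' where G': "minor_step\<^sup>*\<^sup>* G G'" "graph_iso G' M"
    using assms(1) unfolding is_minor_def by blast
  have "wf_graph G'" using wf_minor_steps[OF G'(1) assms(3)] .
  then show ?thesis
    using laid_iso[OF assms(2) graph_iso_sym[OF _ G'(2)]] laid_minor_steps[OF G'(1) assms(3,4)] by blast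
qed

subsection \<open>Unique shortest paths and layouts\<close>

text \<open>A recursive form of the edge condition in \<open>is_path\<close>, so that cutting a path
  at a vertex is a list induction instead of index arithmetic.\<close>

fun trail :: "mgraph \<Rightarrow> nat list \<Rightarrow> nat list \<Rightarrow> bool" where
  "trail G [v] [] \<longleftrightarrow> True"
| "trail G (u # v # vs) (e # es) \<longleftrightarrow> e \<in> edges G \<and> ends G e = {u, v} \<and> trail G (v # vs) es"
| "trail G _ _ \<longleftrightarrow> False"

lemma trail_iff_nth:
  "trail G vs es \<longleftrightarrow> length vs = length es + 1 \<and>
     (\<forall>i<length es. es ! i \<in> edges G \<and> ends G (es ! i) = {vs ! i, vs ! Suc i})"
proof (induction G vs es rule: trail.induct)
  case (2 G u v vs e es)
  show ?case unfolding trail.simps(2) 2 by (auto simp: All_less_Suc2)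
qed simp_all

lemma is_path_trail:
  "is_path G u v vs es \<longleftrightarrow> vs \<noteq> [] \<and> hd vs = u \<and> last vs = v \<and> distinct vs \<and> set vs \<subseteq> verts G \<and>
     trail G vs es"
  unfolding is_path_def trail_iff_nth by blast

lemma trail_split:
  "trail G (xs @ x # ys) es \<longleftrightarrow> (\<exists>es1 es2. es = es1 @ es2 \<and> trail G (xs @ [x]) es1 \<and> trail G (x # ys) es2)"
proof (induction xs arbitrary: es)
  case Nil
  have "trail G [x] l \<longleftrightarrow> l = []" for l by (cases l) auto
  then show ?case by auto
next
  case (Cons a xs)
  obtain b cs where b: "xs @ x # ys = b # cs" by (cases "xs @ x # ys") auto
  obtain ds where d: "xs @ [x] = b # ds" using b by (cases xs) auto
  show ?case
  proof (cases es)
    case Nil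
    then show ?thesis using b d by auto
  next
    case (Cons e es')
    have "(\<exists>es1 es2. e # es' = es1 @ es2 \<and> trail G (a # b # ds) es1 \<and> trail G (x # ys) es2) \<longleftrightarrow>
      e \<in> edges G \<and> ends G e = {a, b} \<and>
      (\<exists>es1 es2. es' = es1 @ es2 \<and> trail G (b # ds) es1 \<and> trail G (x # ys) es2)"
      (is "?L \<longleftrightarrow> ?R")
    proof
      assume ?L
      then obtain es1 es2 where 1: "e # es' = es1 @ es2" "trail G (a # b # ds) es1" "trail G (x # ys) es2"
        by blast
      then show ?R by (cases es1) auto
    next
      assume ?R
      then obtain es1 es2 where "e \<in> edges G" "ends G e = {a, b}" "es' = es1 @ es2"
        "trail G (b # ds) es1" "trail G (x # ys) es2" by blast
      then have "e # es' = (e # es1) @ es2 \<and> trail G (a # b # ds) (e # es1) \<and> trail G (x # ys) es2" by simp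
      then show ?L by blast
    qed
    then show ?thesis using Cons.IH[of es'] unfolding Cons append_Cons b d by simp
  qed
qed

lemma usp_set_finite:
  assumes "wf_graph G"
  shows "finite {length vs | u v vs es. is_usp G u v vs es}"
proof (rule finite_subset)
  show "{length vs | u v vs es. is_usp G u v vs es} \<subseteq> {..card (verts G)}"
  proof safe
    fix u v vs es assume "is_usp G u v vs es"
    then have "distinct vs" "set vs \<subseteq> verts G" by (auto simp: is_usp_def is_path_def)
    then show "length vs \<le> card (verts G)"
      using assms card_mono[of "verts G" "set vs"] by (simp add: distinct_card wf_graph_def)
  qed
qed simp

lemma is_usp_le_usp:
  assumes "wf_graph G" "is_usp G u v vs es"
  shows "length vs \<le> usp G"
  unfolding usp_def using assms(2) by (intro Max_ge usp_set_finite[OF assms(1)]) blast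

lemma usp_attained:
  assumes "wf_graph G"
  obtains u v vs es where "is_usp G u v vs es" "length vs = usp G"
proof -
  obtain u where u: "u \<in> verts G" using assms by (auto simp: wf_graph_def)
  have "is_usp G u u [u] []"
    unfolding is_usp_def is_path_def using u
    by (auto simp: length_Suc_conv Suc_le_eq)
  then have "{length vs | u v vs es. is_usp G u v vs es} \<noteq> {}" by blast
  from Max_in[OF usp_set_finite[OF assms] this] show thesis
    using that unfolding usp_def by force
qed

text \<open>The height \<open>h\<close> grows by at most one along every edge, and a step up never leaves the
  path \<open>0, \<dots>, N\<close>; so the path is the only way to climb from \<open>0\<close> to \<open>N\<close> in \<open>N\<close> steps.\<close>

lemma usp_ge_height:
  assumes wf: "wf_graph H" and V: "{..N} \<subseteq> verts H"
    and h: "\<And>x. x \<le> N \<Longrightarrow> h x = x"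
    and up: "\<And>d x y. d \<in> edges H \<Longrightarrow> ends H d = {x, y} \<Longrightarrow> h y \<le> Suc (h x)"
    and out: "\<And>d x y. d \<in> edges H \<Longrightarrow> ends H d = {x, y} \<Longrightarrow> x \<le> N \<Longrightarrow> \<not> y \<le> N \<Longrightarrow> h y \<noteq> Suc (h x)"
    and path: "\<And>j. j < N \<Longrightarrow> \<exists>!d. d \<in> edges H \<and> ends H d = {j, Suc j}"
  shows "Suc N \<le> usp H"
proof -
  obtain D where D: "\<And>j. j < N \<Longrightarrow> D j \<in> edges H \<and> ends H (D j) = {j, Suc j}"
    using path by metis
  have Du: "d = D j" if "j < N" "d \<in> edges H" "ends H d = {j, Suc j}" for j d
    using path[OF that(1)] D[OF that(1)] that by blast
  let ?vs = "[0..<Suc N]" and ?es = "map D [0..<N]"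
  have P: "is_path H 0 N ?vs ?es"
    unfolding is_path_def using V D by (auto simp: nth_append simp del: upt_Suc)
  have climb: "h (vs ! (i + m)) \<le> h (vs ! i) + m"
    if "is_path H 0 N vs es" "i + m < length vs" for vs es i m
    using that(2)
  proof (induction m)
    case (Suc m)
    have "h (vs ! (i + Suc m)) \<le> Suc (h (vs ! (i + m)))"
      using that(1) Suc.prems by (intro up[of "es ! (i + m)"]) (auto simp: is_path_def)
    then show ?case using Suc by simp
  qed simp
  have ends: "vs ! 0 = 0" "vs ! (length vs - 1) = N" if "is_path H 0 N vs es" for vs es
    using that unfolding is_path_def by (auto simp: hd_conv_nth last_conv_nth)
  have len: "Suc N \<le> length vs" if p: "is_path H 0 N vs es" for vs es
  proof -
    have "0 < length vs" using p by (auto simp: is_path_def)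
    then have "N \<le> length vs - 1"
      using climb[OF p, of 0 "length vs - 1"] ends[OF p] h[of 0] h[of N] by simp
    then show ?thesis using \<open>0 < length vs\<close> by linarith
  qed
  have "vs = ?vs \<and> es = ?es" if p: "is_path H 0 N vs es" and l: "length vs = Suc N" for vs es
  proof -
    \<comment> \<open>At most \<open>i\<close> is gained before index \<open>i\<close> and at most
      \<open>N - i\<close> after it, yet the total gain is \<open>N\<close>.\<close>
    have hi: "h (vs ! i) = i" if "i \<le> N" for i
      using climb[OF p, of 0 i] climb[OF p, of i "N - i"] ends[OF p] h[of 0] h[of N] l that by simp
    have le: "vs ! i \<le> N" if "i \<le> N" for i
      using that
    proof (induction i)
      case 0
      then show ?case using ends[OF p] by simp
    next
      case (Suc i)
      have "es ! i \<in> edges H" "ends H (es ! i) = {vs ! i, vs ! Suc i}"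
        using p l Suc.prems by (auto simp: is_path_def)
      then show ?case using out[of "es ! i" "vs ! i" "vs ! Suc i"] Suc hi[of i] hi[of "Suc i"] by auto
    qed
    have i: "vs ! i = i" if "i \<le> N" for i using hi[OF that] le[OF that] h by simp
    have "vs = ?vs" using l i by (intro nth_equalityI) (auto simp del: upt_Suc)
    moreover have "es = ?es"
    proof (rule nth_equalityI)
      show "length es = length ?es" using p l by (simp add: is_path_def)
      show "es ! j = ?es ! j" if "j < length es" for j
      proof -
        have "j < N" using that p l by (simp add: is_path_def)
        then show ?thesis using p that i[of j] i[of "Suc j"] Du[of j "es ! j"] by (simp add: is_path_def)
      qed
    qed
    ultimately show ?thesis ..
  qed
  then have "is_usp H 0 N ?vs ?es"
    unfolding is_usp_def using P len length_upt[of 0 "Suc N"] by (metis diff_zero)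
  from is_usp_le_usp[OF wf this] show ?thesis by simp
qed

text \<open>The host fills the gaps: every position up to the maximum becomes a vertex, and
  consecutive positions not yet joined get a new edge. Heights then certify the completed path as a
  unique shortest path, which only vertices of \<open>W\<close> miss.\<close>

lemma laid_host:
  assumes wf: "wf_graph G" and L: "layout W p G"
  shows "\<exists>H. wf_graph H \<and> is_minor G H \<and> sp H \<le> card (W \<inter> verts G)"
proof -
  define N where "N = Max (p ` verts G)"
  have N: "p v \<le> N" if "v \<in> verts G" for v
    unfolding N_def using wf that by (auto simp: wf_graph_def)
  \<comment> \<open>Vertices off the path get names above \<open>N\<close>, from which
    \<open>h\<close> recovers the original vertex and its height.\<close>
  define f where "f v = (if v \<in> W then Suc N + v else p v)" for v
  define h where "h x = (if x \<le> N then x else p (x - Suc N))" for x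
  define free where "free = {j. j < N \<and> (\<forall>e\<in>edges G. f ` ends G e \<noteq> {j, Suc j})}"
  \<comment> \<open>Edges of \<open>G\<close> receive even names and added path edges odd ones, so
    the two kinds never clash.\<close>
  define H where "H = \<lparr>verts = {..N} \<union> f ` (W \<inter> verts G),
    edges = (\<lambda>e. 2 * e) ` edges G \<union> (\<lambda>j. 2 * j + 1) ` free,
    ends = (\<lambda>d. if even d then f ` ends G (d div 2) else {d div 2, Suc (d div 2)})\<rparr>"
  have sub: "ends G e \<subseteq> verts G" "card (ends G e) = 2" if "e \<in> edges G" for e
    using wf that by (auto simp: wf_graph_def)
  have fN: "f v \<le> N \<longleftrightarrow> v \<notin> W" if "v \<in> verts G" for v using N[OF that] by (auto simp: f_def)
  have hf: "h (f v) = p v" if "v \<in> verts G" for v using N[OF that] by (auto simp: f_def h_def)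
  have inj: "inj_on f (verts G)"
  proof (rule inj_onI)
    fix a b assume ab: "a \<in> verts G" "b \<in> verts G" "f a = f b"
    then have "a \<in> W \<longleftrightarrow> b \<in> W" using fN by metis
    then show "a = b" using ab layout_inj[OF L] by (auto simp: f_def inj_on_def split: if_splits)
  qed
  have fV: "f ` verts G \<subseteq> verts H" using N by (auto simp: H_def f_def)
  have wfH: "wf_graph H"
  proof -
    have "finite free" unfolding free_def by simp
    moreover have "card (f ` ends G e) = 2" if "e \<in> edges G" for e
      using sub[OF that] card_image[of f "ends G e"] inj_on_subset[OF inj] by simp
    moreover have "f ` ends G e \<subseteq> verts H" if "e \<in> edges G" for e
      using sub[OF that] fV by blast
    moreover have "finite (verts G)" "finite (edges G)" using wf by (auto simp: wf_graph_def)
    moreover have "j \<in> verts H" "Suc j \<in> verts H" if "j \<in> free" for j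
      using that by (auto simp: H_def free_def)
    moreover have "finite (verts H)" "verts H \<noteq> {}" "finite (edges H)"
      using calculation by (auto simp: H_def)
    moreover have "ends H d \<subseteq> verts H \<and> card (ends H d) = 2" if d: "d \<in> edges H" for d
    proof (cases "even d")
      case True
      then obtain e where "e \<in> edges G" "d = 2 * e" using d by (auto simp: H_def)
      moreover from this have "ends H d = f ` ends G e" by (simp add: H_def)
      ultimately show ?thesis
        using \<open>\<And>e. e \<in> edges G \<Longrightarrow> card (f ` ends G e) = 2\<close>
          \<open>\<And>e. e \<in> edges G \<Longrightarrow> f ` ends G e \<subseteq> verts H\<close> by simp
    next
      case False
      then obtain j where j: "j \<in> free" "d = 2 * j + 1" using d by (auto simp: H_def)
      moreover have "ends H d = {j, Suc j}" using j by (simp add: H_def)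
      ultimately show ?thesis
        using \<open>\<And>j. j \<in> free \<Longrightarrow> j \<in> verts H\<close> \<open>\<And>j. j \<in> free \<Longrightarrow> Suc j \<in> verts H\<close> by simp
    qed
    ultimately show ?thesis unfolding wf_graph_def by blast
  qed
  have minor: "is_minor G H"
    by (rule subgraph_minor[OF wf wfH inj fV, of "\<lambda>e. 2 * e"]) (auto simp: inj_on_def H_def)
  have edgeH: "(\<exists>e u v. e \<in> edges G \<and> d = 2 * e \<and> ends G e = {u, v} \<and> u \<in> verts G \<and> v \<in> verts G \<and> x = f u \<and> y = f v)
      \<or> (\<exists>j\<in>free. d = 2 * j + 1 \<and> {x, y} = {j, Suc j})"
    if d: "d \<in> edges H" "ends H d = {x, y}" for d x y
  proof (cases "even d")
    case True
    then obtain e where e: "e \<in> edges G" "d = 2 * e" using d(1) by (auto simp: H_def)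
    obtain u v where uv: "ends G e = {u, v}" "u \<in> verts G" "v \<in> verts G" using wf_endsE[OF wf e(1)] .
    have "{f u, f v} = {x, y}" using d(2) e uv by (simp add: H_def)
    then have "x = f u \<and> y = f v \<or> x = f v \<and> y = f u" by (auto simp: doubleton_eq_iff)
    moreover have "ends G e = {v, u}" using uv(1) by (simp add: insert_commute)
    ultimately show ?thesis using e uv by blast
  next
    case False
    then show ?thesis using d by (auto simp: H_def)
  qed
  have "Suc N \<le> usp H"
  proof (rule usp_ge_height[OF wfH, of N h])
    show "{..N} \<subseteq> verts H" by (simp add: H_def)
    show "h x = x" if "x \<le> N" for x using that by (simp add: h_def)
    show "h y \<le> Suc (h x)" if d: "d \<in> edges H" "ends H d = {x, y}" for d x y
      using edgeH[OF d]
    proof (elim disjE exE conjE bexE)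
      fix e u v assume e: "e \<in> edges G" "ends G e = {u, v}" "u \<in> verts G" "v \<in> verts G" "x = f u" "y = f v"
      note l = layoutD[OF L e(1,2)]
      have e': "ends G e = {v, u}" using e(2) by (simp add: insert_commute)
      have "p v \<le> Suc (p u)"
        using l(1,3) layoutD(3,4)[OF L e(1) e'] by (cases "u \<in> W"; cases "v \<in> W") auto
      then show ?thesis using hf e by simp
    next
      fix j assume "j \<in> free" "{x, y} = {j, Suc j}"
      then show ?thesis by (auto simp: free_def h_def doubleton_eq_iff)
    qed
    show "h y \<noteq> Suc (h x)" if d: "d \<in> edges H" "ends H d = {x, y}" "x \<le> N" "\<not> y \<le> N" for d x y
      using edgeH[OF d(1,2)]
    proof (elim disjE exE conjE bexE)
      fix e u v assume e: "e \<in> edges G" "ends G e = {u, v}" "u \<in> verts G" "v \<in> verts G" "x = f u" "y = f v"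
      then have "u \<notin> W" "v \<in> W" using d fN by auto
      then have "p u = p v \<or> p u = Suc (p v)" using layoutD(3)[OF L e(1,2)] by simp
      then show ?thesis using hf e by auto
    next
      fix j assume "j \<in> free" "{x, y} = {j, Suc j}"
      then show ?thesis using d by (auto simp: free_def h_def doubleton_eq_iff)
    qed
    show "\<exists>!d. d \<in> edges H \<and> ends H d = {j, Suc j}" if j: "j < N" for j
    proof (cases "j \<in> free")
      case True
      then have "2 * j + 1 \<in> edges H" "ends H (2 * j + 1) = {j, Suc j}" by (auto simp: H_def)
      moreover have "d = 2 * j + 1" if d: "d \<in> edges H" "ends H d = {j, Suc j}" for d
        using edgeH[OF d] True by (auto simp: free_def doubleton_eq_iff)
      ultimately show ?thesis by (metis (no_types))
    next
      case False
      then obtain e where e: "e \<in> edges G" "f ` ends G e = {j, Suc j}" using j by (auto simp: free_def)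
      then have "2 * e \<in> edges H" "ends H (2 * e) = {j, Suc j}" by (auto simp: H_def)
      moreover have "d = 2 * e" if d: "d \<in> edges H" "ends H d = {j, Suc j}" for d
        using edgeH[OF d]
      proof (elim disjE exE conjE bexE)
        fix c u v assume c: "c \<in> edges G" "d = 2 * c" "ends G c = {u, v}" "u \<in> verts G" "v \<in> verts G"
          "j = f u" "Suc j = f v"
        then have W: "u \<notin> W" "v \<notin> W" using j fN[of u] fN[of v] by auto
        have "f ` ends G c = f ` ends G e" using c e by simp
        then have "ends G e = {u, v}"
          using inj_on_image_eq_iff[OF inj sub(1)[OF c(1)] sub(1)[OF e(1)]] c by simp
        then show ?thesis using layoutD(2)[OF L c(1,3) W e(1)] c(2) by simp
      next
        fix i assume "i \<in> free" "{j, Suc j} = {i, Suc i}"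
        then show ?thesis using False by (auto simp: doubleton_eq_iff)
      qed
      ultimately show ?thesis by (metis (no_types))
    qed
  qed
  moreover have "card (verts H) \<le> Suc N + card (W \<inter> verts G)"
  proof -
    have "finite (W \<inter> verts G)" using wf by (auto simp: wf_graph_def)
    then show ?thesis
      unfolding H_def using card_Un_le[of "{..N}" "f ` (W \<inter> verts G)"] card_image_le[of "W \<inter> verts G" f]
      by simp
  qed
  ultimately have "sp H \<le> card (W \<inter> verts G)" unfolding sp_def by simp
  then show ?thesis using wfH minor by blast
qed

lemma laid_imp_floor_le:
  assumes "wf_graph G" "laid k G"
  shows "spectator_floor G \<le> k"
proof -
  obtain W p where L: "layout W p G" "card (W \<inter> verts G) \<le> k" using assms(2) unfolding laid_def by blast
  obtain H where H: "wf_graph H" "is_minor G H" "sp H \<le> card (W \<inter> verts G)"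
    using laid_host[OF assms(1) L(1)] by blast
  have "spectator_floor G \<le> sp H" unfolding spectator_floor_def using H by (intro Least_le) blast
  then show ?thesis using H(3) L(2) by simp
qed

text \<open>Replacing the segment between \<open>x\<close> and \<open>y\<close> by an edge gives a
  shorter path unless \<open>zs\<close> is empty; if it is empty, a parallel edge gives a second
  path of the same length.\<close>

lemma usp_chord:
  assumes "is_usp G u v (xs @ x # zs @ y # ys) es" "d \<in> edges G" "ends G d = {x, y}"
  shows "zs = [] \<and> (\<forall>d'\<in>edges G. ends G d' = {x, y} \<longrightarrow> d' = d)"
proof -
  let ?vs = "xs @ x # zs @ y # ys"
  have P: "is_path G u v ?vs es" using assms(1) by (simp add: is_usp_def)
  then have "trail G ?vs es" by (simp add: is_path_trail)
  then obtain es1 es2 es3 where es: "es = es1 @ es2 @ es3" "trail G (xs @ [x]) es1"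
    "trail G (x # zs @ [y]) es2" "trail G (y # ys) es3"
    unfolding trail_split[of G xs x "zs @ y # ys"] trail_split[of G "x # zs" y ys, simplified] by blast
  have Q: "is_path G u v (xs @ x # y # ys) (es1 @ d' # es3)" if "d' \<in> edges G" "ends G d' = {x, y}" for d'
  proof -
    have "trail G (x # y # ys) (d' # es3)" using that es(4) by simp
    then have "trail G (xs @ x # y # ys) (es1 @ d' # es3)"
      unfolding trail_split[of G xs x "y # ys"] using es(2) by blast
    moreover have "hd (xs @ x # y # ys) = u" using P by (cases xs) (auto simp: is_path_trail)
    ultimately show ?thesis using P by (auto simp: is_path_trail)
  qed
  have "length ?vs \<le> length (xs @ x # y # ys)"
    using assms(1) Q[OF assms(2,3)] unfolding is_usp_def by blast
  then have z: "zs = []" by simp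
  have "es1 @ d' # es3 = es" if "d' \<in> edges G" "ends G d' = {x, y}" for d'
    using assms(1) Q[OF that] unfolding is_usp_def z by (metis append_Nil)
  then have "es1 @ d' # es3 = es1 @ d # es3" if "d' \<in> edges G" "ends G d' = {x, y}" for d'
    using that assms(2,3) by metis
  then show ?thesis using z by auto
qed

text \<open>The detour puts the single vertex \<open>w\<close> in place of \<open>zs\<close>. It is
  shorter if \<open>zs\<close> has two or more entries, and a second path of the same length if it
  has one.\<close>

lemma usp_detour:
  assumes "is_usp G u v (xs @ x # zs @ y # ys) es" "d \<in> edges G" "ends G d = {x, w}"
    "d' \<in> edges G" "ends G d' = {w, y}" "w \<in> verts G" "w \<notin> set (xs @ x # zs @ y # ys)"
  shows "zs = []"
proof -
  let ?vs = "xs @ x # zs @ y # ys"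
  have P: "is_path G u v ?vs es" using assms(1) by (simp add: is_usp_def)
  then have "trail G ?vs es" by (simp add: is_path_trail)
  then obtain es1 es2 es3 where es: "es = es1 @ es2 @ es3" "trail G (xs @ [x]) es1"
    "trail G (x # zs @ [y]) es2" "trail G (y # ys) es3"
    unfolding trail_split[of G xs x "zs @ y # ys"] trail_split[of G "x # zs" y ys, simplified] by blast
  have "trail G (x # w # y # ys) (d # d' # es3)" using assms es(4) by simp
  then have "trail G (xs @ x # w # y # ys) (es1 @ d # d' # es3)"
    unfolding trail_split[of G xs x "w # y # ys"] using es(2) by blast
  moreover have "hd (xs @ x # w # y # ys) = u" using P by (cases xs) (auto simp: is_path_trail)
  ultimately have Q: "is_path G u v (xs @ x # w # y # ys) (es1 @ d # d' # es3)"
    using P assms(6,7) by (auto simp: is_path_trail)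
  then have "length ?vs \<le> length (xs @ x # w # y # ys)" using assms(1) unfolding is_usp_def by blast
  then have l: "length zs \<le> 1" by simp
  show ?thesis
  proof (rule ccontr)
    assume "zs \<noteq> []"
    then have "length zs = 1" using l by (cases zs) auto
    then have "length (xs @ x # w # y # ys) = length ?vs" by simp
    then have "xs @ x # w # y # ys = ?vs" using assms(1) Q unfolding is_usp_def by blast
    moreover have "w \<in> set (xs @ x # w # y # ys)" by simp
    ultimately have "w \<in> set ?vs" by (simp only:)
    then show False using assms(7) by simp
  qed
qed

lemma split_two:
  assumes "x \<in> set vs" "y \<in> set vs" "x \<noteq> y"
  shows "(\<exists>xs zs ys. vs = xs @ x # zs @ y # ys) \<or> (\<exists>xs zs ys. vs = xs @ y # zs @ x # ys)"
proof -
  obtain as bs where ab: "vs = as @ x # bs" using assms(1) split_list by metis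
  then have "y \<in> set as \<or> y \<in> set bs" using assms by auto
  then show ?thesis
  proof
    assume "y \<in> set as"
    then obtain cs ds where "as = cs @ y # ds" using split_list by metis
    then have "vs = cs @ y # ds @ x # bs" using ab by simp
    then show ?thesis by blast
  next
    assume "y \<in> set bs"
    then obtain cs ds where "bs = cs @ y # ds" using split_list by metis
    then have "vs = as @ x # cs @ y # ds" using ab by simp
    then show ?thesis by blast
  qed
qed

text \<open>Positions are the indices along a longest unique shortest path. The spectator gets the
  lowest index of a neighbour as height, and \<open>usp_detour\<close> puts every other neighbour
  directly after that one.\<close>

lemma sp_le_1_imp_laid:
  assumes wf: "wf_graph H" and sp: "sp H \<le> 1"
  shows "laid 1 H"
proof -
  obtain u v vs es where U: "is_usp H u v vs es" "length vs = usp H" using usp_attained[OF wf] .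
  have dist: "distinct vs" and sub: "set vs \<subseteq> verts H" using U(1) by (auto simp: is_usp_def is_path_def)
  have fin: "finite (verts H)" using wf by (simp add: wf_graph_def)
  let ?W = "verts H - set vs"
  have cW: "card ?W \<le> 1"
    using sp U(2) distinct_card[OF dist] card_Diff_subset[OF _ sub] unfolding sp_def by simp
  define pos where "pos x = length (takeWhile (\<lambda>z. z \<noteq> x) vs)" for x
  have pos: "pos x = length xs" if "vs = xs @ x # ys" for x xs ys
    unfolding pos_def that using dist that by (subst takeWhile_append2) auto
  have posinj: "x = y" if xy: "x \<in> set vs" "y \<in> set vs" "pos x = pos y" for x y
  proof -
    obtain xs ys where "vs = xs @ x # ys" using xy(1) split_list by metis
    moreover obtain xs' ys' where "vs = xs' @ y # ys'" using xy(2) split_list by metis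
    ultimately show ?thesis using xy(3) pos by (metis nth_append_length)
  qed
  have dir: "(pos b = Suc (pos a) \<or> pos a = Suc (pos b)) \<and>
      (\<forall>d'\<in>edges H. ends H d' = {a, b} \<longrightarrow> d' = d)"
    if d: "d \<in> edges H" "ends H d = {a, b}" and ab: "a \<in> set vs" "b \<in> set vs" for d a b
  proof -
    have ne: "a \<noteq> b" using wf_endsD[OF wf d] by simp
    consider xs zs ys where "vs = xs @ a # zs @ b # ys" | xs zs ys where "vs = xs @ b # zs @ a # ys"
      using split_two[OF ab ne] by blast
    then show ?thesis
    proof cases
      case 1
      have *: "zs = [] \<and> (\<forall>d'\<in>edges H. ends H d' = {a, b} \<longrightarrow> d' = d)"
        using usp_chord[of H u v xs a zs b ys es d] U(1) d 1 by simp
      then have "pos b = Suc (pos a)"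
        using pos[of xs a "b # ys"] pos[of "xs @ [a]" b ys] 1 by simp
      then show ?thesis using * by blast
    next
      case 2
      have *: "zs = [] \<and> (\<forall>d'\<in>edges H. ends H d' = {b, a} \<longrightarrow> d' = d)"
        using usp_chord[of H u v xs b zs a ys es d] U(1) d 2 by (simp add: insert_commute)
      then have "pos a = Suc (pos b)"
        using pos[of xs b "a # ys"] pos[of "xs @ [b]" a ys] 2 by simp
      then show ?thesis using * by (simp add: insert_commute)
    qed
  qed
  define nb where "nb w i \<longleftrightarrow> (\<exists>x d. x \<in> set vs \<and> d \<in> edges H \<and> ends H d = {x, w} \<and> pos x = i)" for w i
  \<comment> \<open>For a spectator without neighbours on the path, \<open>LEAST\<close> is some
    unspecified number, and no edge puts a condition on it.\<close>
  define p where "p z = (if z \<in> set vs then pos z else (LEAST i. nb z i))" for z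
  have near: "pos a = p w \<or> pos a = Suc (p w)"
    if a: "a \<in> set vs" "w \<in> ?W" "d \<in> edges H" "ends H d = {a, w}" for a w d
  proof -
    have nba: "nb w (pos a)" using a unfolding nb_def by blast
    then have le: "(LEAST i. nb w i) \<le> pos a" by (rule Least_le)
    have "nb w (LEAST i. nb w i)" using nba by (rule LeastI)
    then obtain x d' where x: "x \<in> set vs" "d' \<in> edges H" "ends H d' = {x, w}" "pos x = (LEAST i. nb w i)"
      unfolding nb_def by blast
    have pw: "p w = pos x" using a(2) x(4) unfolding p_def by simp
    show ?thesis
    proof (cases "x = a")
      case False
      have "pos x \<le> pos a" using le x(4) by simp
      consider xs zs ys where "vs = xs @ x # zs @ a # ys" | xs zs ys where "vs = xs @ a # zs @ x # ys"
        using split_two[OF x(1) a(1) False] by blast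
      then show ?thesis
      proof cases
        case 1
        have "zs = []"
          using usp_detour[of H u v xs x zs a ys es d' w d] U(1) 1 x a by (simp add: insert_commute)
        then have "pos a = Suc (pos x)"
          using pos[of xs x "a # ys"] pos[of "xs @ [x]" a ys] 1 by simp
        then show ?thesis using pw by simp
      next
        case 2
        then have "pos a < pos x"
          using pos[of xs a "zs @ x # ys"] pos[of "xs @ a # zs" x ys] by simp
        then show ?thesis using \<open>pos x \<le> pos a\<close> by simp
      qed
    qed (use pw in simp)
  qed
  have "inj_on p (verts H - ?W)"
    using posinj by (auto simp: inj_on_def p_def)
  moreover have "(a \<notin> ?W \<and> b \<notin> ?W \<longrightarrow> (p b = Suc (p a) \<or> p a = Suc (p b)) \<and>
           (\<forall>d\<in>edges H. ends H d = {a, b} \<longrightarrow> d = e)) \<and>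
        (a \<notin> ?W \<and> b \<in> ?W \<longrightarrow> p a = p b \<or> p a = Suc (p b)) \<and>
        (a \<in> ?W \<and> b \<in> ?W \<longrightarrow> p a \<le> Suc (p b))" if e: "e \<in> edges H" "ends H e = {a, b}" for e a b
  proof -
    have ab: "a \<noteq> b" "a \<in> verts H" "b \<in> verts H" using wf_endsD[OF wf e] by auto
    \<comment> \<open>There is at most one spectator and there are no loops, so no edge lies inside
      \<open>?W\<close>.\<close>
    have "\<not> (a \<in> ?W \<and> b \<in> ?W)"
      using cW ab(1) fin card_le_Suc0_iff_eq[of ?W] by (auto simp: One_nat_def)
    then show ?thesis using dir[OF e] near[OF _ _ e] ab by (auto simp: p_def)
  qed
  ultimately have "layout ?W p H" unfolding layout_def by blast
  moreover have "?W \<inter> verts H = ?W" by blast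
  ultimately show ?thesis unfolding laid_def using cW by metis
qed

lemma spectator_floor_witness:
  assumes "wf_graph G"
  shows "\<exists>H. wf_graph H \<and> is_minor G H \<and> sp H = spectator_floor G"
proof -
  have "is_minor G G" unfolding is_minor_def using graph_iso_refl by blast
  then have "\<exists>k H. wf_graph H \<and> is_minor G H \<and> sp H = k" using assms by blast
  then show ?thesis unfolding spectator_floor_def by (rule LeastI_ex)
qed

text \<open>An optimal host has a layout, which descends to its minor \<open>G\<close>. From here on
  the quantifier over hosts is gone.\<close>

lemma floor_le_1_iff:
  assumes "wf_graph G"
  shows "spectator_floor G \<le> 1 \<longleftrightarrow> laid 1 G"
proof
  assume "spectator_floor G \<le> 1"
  then show "laid 1 G"
    using spectator_floor_witness[OF assms] sp_le_1_imp_laid laid_minor assms by metis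
qed (rule laid_imp_floor_le[OF assms])

subsection \<open>Certificates for explicit graphs\<close>

text \<open>No listed graph has three parallel edges, so it is enough to distinguish at least one
  edge (\<open>adj\<close>) from at least two (\<open>dbl\<close>).\<close>

definition adj :: "mgraph \<Rightarrow> nat \<Rightarrow> nat \<Rightarrow> bool" where
  "adj G x y \<longleftrightarrow> (\<exists>e\<in>edges G. ends G e = {x, y})"

definition dbl :: "mgraph \<Rightarrow> nat \<Rightarrow> nat \<Rightarrow> bool" where
  "dbl G x y \<longleftrightarrow> (\<exists>e\<in>edges G. \<exists>f\<in>edges G. e \<noteq> f \<and> ends G e = {x, y} \<and> ends G f = {x, y})"

lemma adj_sym: "adj G x y \<Longrightarrow> adj G y x"
  by (simp add: adj_def insert_commute)

lemma dbl_sym: "dbl G x y \<Longrightarrow> dbl G y x"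
  by (simp add: dbl_def insert_commute)

lemma dbl_adj: "dbl G x y \<Longrightarrow> adj G x y"
  by (auto simp: dbl_def adj_def)

lemma adjD:
  assumes "wf_graph G" "adj G x y"
  shows "x \<in> verts G" "y \<in> verts G" "x \<noteq> y"
  using assms wf_endsD unfolding adj_def by blast+

lemma mk_graph_simps [simp]:
  "verts (mk_graph n l) = {0..<n}" "edges (mk_graph n l) = {0..<length l}"
  "ends (mk_graph n l) i = {fst (l ! i), snd (l ! i)}"
  by (auto simp: mk_graph_def)

lemma adj_mk_graph: "adj (mk_graph n l) x y \<longleftrightarrow> (x, y) \<in> set l \<or> (y, x) \<in> set l"
  unfolding adj_def by (auto simp: doubleton_eq_iff in_set_conv_nth prod_eq_iff Bex_def)

lemma dbl_mk_graph:
  assumes "2 \<le> length (filter (\<lambda>a. a = (x, y) \<or> a = (y, x)) l)"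
  shows "dbl (mk_graph n l) x y"
proof -
  let ?I = "{i. i < length l \<and> (l ! i = (x, y) \<or> l ! i = (y, x))}"
  have "2 \<le> card ?I" using assms by (simp add: length_filter_conv_card)
  then obtain i j where "i \<in> ?I" "j \<in> ?I" "i \<noteq> j"
    by (metis (no_types, lifting) card_le_Suc0_iff_eq card.infinite not_less_eq_eq numeral_2_eq_2
        zero_le not_numeral_le_zero)
  then show ?thesis unfolding dbl_def
    by (intro bexI[of _ i] bexI[of _ j]) (auto simp: doubleton_eq_iff)
qed

lemma wf_mk_graph:
  assumes "0 < n" "\<forall>(a, b)\<in>set l. a < n \<and> b < n \<and> a \<noteq> b"
  shows "wf_graph (mk_graph n l)"
proof -
  have "fst (l ! i) < n \<and> snd (l ! i) < n \<and> fst (l ! i) \<noteq> snd (l ! i)" if "i < length l" for i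
    using assms(2) nth_mem[OF that] by (auto simp: case_prod_unfold)
  then show ?thesis unfolding wf_graph_def using assms(1) by simp
qed

text \<open>The executable counterpart of \<open>layout\<close>. Each edge is listed with one
  arbitrary order of its ends, whereas \<open>layout\<close> quantifies over both orders, so both
  are tested.\<close>

definition height_ok :: "nat list \<Rightarrow> nat list \<Rightarrow> nat list \<Rightarrow> (nat \<times> nat \<times> nat) list \<Rightarrow> bool" where
  "height_ok ws ps V es \<longleftrightarrow> distinct (map (nth ps) (filter (\<lambda>v. v \<notin> set ws) V)) \<and>
     (\<forall>(e, u, v)\<in>set es.
        if u \<in> set ws \<and> v \<in> set ws then ps ! u \<le> Suc (ps ! v) \<and> ps ! v \<le> Suc (ps ! u)
        else if v \<in> set ws then ps ! u = ps ! v \<or> ps ! u = Suc (ps ! v)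
        else if u \<in> set ws then ps ! v = ps ! u \<or> ps ! v = Suc (ps ! u)
        else (ps ! v = Suc (ps ! u) \<or> ps ! u = Suc (ps ! v)) \<and>
          (\<forall>(d, a, b)\<in>set es. (a = u \<and> b = v \<or> a = v \<and> b = u) \<longrightarrow> d = e))"

definition laid_cert :: "nat \<Rightarrow> nat list \<times> nat list \<Rightarrow> nat list \<Rightarrow> (nat \<times> nat \<times> nat) list \<Rightarrow> bool" where
  "laid_cert k c V es \<longleftrightarrow> height_ok (fst c) (snd c) V es \<and> length (filter (\<lambda>v. v \<in> set (fst c)) V) \<le> k"

lemma laid_cert_sound:
  assumes c: "laid_cert k c V es" and G: "distinct V" "verts G = set V" "edges G \<subseteq> fst ` set es"
    and e: "\<And>e u v. (e, u, v) \<in> set es \<Longrightarrow> ends G e = {u, v}"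
    and E: "fst ` set es \<subseteq> edges G"
  shows "laid k G"
proof -
  obtain ws ps where cc: "c = (ws, ps)" by (cases c)
  have h: "height_ok ws ps V es" and k: "length (filter (\<lambda>v. v \<in> set ws) V) \<le> k"
    using c by (auto simp: laid_cert_def cc)
  let ?W = "set ws" and ?p = "nth ps"
  have "inj_on ?p (verts G - ?W)"
  proof -
    have "distinct (map ?p (filter (\<lambda>v. v \<notin> ?W) V))" using h by (simp add: height_ok_def)
    then have "inj_on ?p (set (filter (\<lambda>v. v \<notin> ?W) V))" by (simp only: distinct_map)
    then show ?thesis using G(2) by (simp add: set_diff_eq)
  qed
  moreover have "(u \<notin> ?W \<and> v \<notin> ?W \<longrightarrow> (?p v = Suc (?p u) \<or> ?p u = Suc (?p v)) \<and>
           (\<forall>d\<in>edges G. ends G d = {u, v} \<longrightarrow> d = i)) \<and>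
        (u \<notin> ?W \<and> v \<in> ?W \<longrightarrow> ?p u = ?p v \<or> ?p u = Suc (?p v)) \<and>
        (u \<in> ?W \<and> v \<in> ?W \<longrightarrow> ?p u \<le> Suc (?p v))" if i: "i \<in> edges G" "ends G i = {u, v}" for i u v
  proof -
    have "\<exists>a b. (d, a, b) \<in> set es \<and> {a, b} = ends G d" if "d \<in> edges G" for d
      using that G(3) e by force
    note ex = this
    obtain a b where ab: "(i, a, b) \<in> set es" "{a, b} = {u, v}" using ex[OF i(1)] i(2) by auto
    have H: "if a \<in> ?W \<and> b \<in> ?W then ps ! a \<le> Suc (ps ! b) \<and> ps ! b \<le> Suc (ps ! a)
        else if b \<in> ?W then ps ! a = ps ! b \<or> ps ! a = Suc (ps ! b)
        else if a \<in> ?W then ps ! b = ps ! a \<or> ps ! b = Suc (ps ! a)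
        else (ps ! b = Suc (ps ! a) \<or> ps ! a = Suc (ps ! b)) \<and>
          (\<forall>(d, a', b')\<in>set es. (a' = a \<and> b' = b \<or> a' = b \<and> b' = a) \<longrightarrow> d = i)"
      using h ab(1) unfolding height_ok_def by fast
    have "d = i" if uv: "u \<notin> ?W" "v \<notin> ?W" and dG: "d \<in> edges G" "ends G d = {u, v}" for d
    proof -
      obtain a' b' where d: "(d, a', b') \<in> set es" "{a', b'} = {u, v}" using ex[OF dG(1)] dG(2) by auto
      have "a \<notin> ?W" "b \<notin> ?W" using uv ab(2) by (auto simp: doubleton_eq_iff)
      then have "\<forall>(d, a', b')\<in>set es. (a' = a \<and> b' = b \<or> a' = b \<and> b' = a) \<longrightarrow> d = i"
        using H by simp
      moreover have "a' = a \<and> b' = b \<or> a' = b \<and> b' = a" using d(2) ab(2) by (auto simp: doubleton_eq_iff)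
      ultimately show ?thesis using d(1) by fast
    qed
    moreover have "a = u \<and> b = v \<or> a = v \<and> b = u" using ab(2) by (simp only: doubleton_eq_iff)
    ultimately show ?thesis using H by (elim disjE) (auto split: if_splits)
  qed
  ultimately have "layout ?W ?p G" unfolding layout_def by blast
  moreover have "card (?W \<inter> verts G) \<le> k"
  proof -
    have "card (set (filter (\<lambda>v. v \<in> ?W) V)) \<le> k" using k card_length le_trans by blast
    moreover have "set (filter (\<lambda>v. v \<in> ?W) V) = ?W \<inter> verts G" using G(2) by auto
    ultimately show ?thesis by simp
  qed
  ultimately show ?thesis unfolding laid_def by blast
qed

text \<open>Enumerating before filtering preserves the edge names, which minor steps do not
  renumber.\<close>

definition rest :: "(nat \<times> nat) list \<Rightarrow> nat \<Rightarrow> (nat \<times> nat \<times> nat) list" where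
  "rest l i = filter (\<lambda>t. fst t \<noteq> i) (enumerate 0 l)"

lemma in_rest: "(d, a, b) \<in> set (rest l i) \<longleftrightarrow> d < length l \<and> d \<noteq> i \<and> l ! d = (a, b)"
  by (auto simp: rest_def in_set_enumerate_eq)

definition contract_cert :: "nat \<Rightarrow> (nat \<times> nat) list \<Rightarrow> nat \<Rightarrow> nat list \<times> nat list \<Rightarrow> nat \<Rightarrow> nat \<Rightarrow> bool" where
  "contract_cert n l i c x y \<longleftrightarrow> laid_cert 1 c (filter (\<lambda>v. v \<noteq> y) [0..<n])
     (map (\<lambda>(d, a, b). (d, if a = y then x else a, if b = y then x else b)) (rest l i))"

text \<open>For every edge, \<open>D\<close> and \<open>C\<close> contain the off-path vertices and the list of heights of a layout
  after deletion and contraction. The ends of a contracted edge receive the same entries, so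
  that one certificate serves whichever of them survives; dummies \<open>([], [])\<close> stand for edges with
  a parallel edge, which may not be contracted.\<close>

definition steps_cert ::
  "nat \<Rightarrow> (nat \<times> nat) list \<Rightarrow> (nat list \<times> nat list) list \<Rightarrow> (nat list \<times> nat list) list \<Rightarrow> bool" where
  "steps_cert n l D C \<longleftrightarrow> list_all (\<lambda>v. list_ex (\<lambda>(a, b). v = a \<or> v = b) l) [0..<n] \<and>
     list_all (\<lambda>i. case l ! i of (x, y) \<Rightarrow> laid_cert 1 (D ! i) [0..<n] (rest l i) \<and>
        (list_ex (\<lambda>(d, a, b). a = x \<and> b = y \<or> a = y \<and> b = x) (rest l i) \<or>
         contract_cert n l i (C ! i) x y \<and> contract_cert n l i (C ! i) y x)) [0..<length l]"

lemma steps_cert_sound: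
  assumes "steps_cert n l D C" "minor_step (mk_graph n l) G"
  shows "laid 1 G"
  using assms(2)
proof (cases rule: minor_step_cases)
  case (del_vertex v)
  \<comment> \<open>By the first conjunct of the certificate every vertex lies on an edge, so no
    vertex deletion is possible.\<close>
  then have "\<exists>(a, b)\<in>set l. v = a \<or> v = b"
    using assms(1) by (fastforce simp: steps_cert_def list_all_iff list_ex_iff)
  then obtain i where "i < length l" "v = fst (l ! i) \<or> v = snd (l ! i)"
    unfolding in_set_conv_nth Bex_def case_prod_unfold by blast
  then show ?thesis using del_vertex(2)[of i] by auto
next
  case (del_edge i)
  then have "laid_cert 1 (D ! i) [0..<n] (rest l i)"
    using assms(1) by (auto simp: steps_cert_def list_all_iff split: prod.splits)
  then show ?thesis
    by (rule laid_cert_sound) (use del_edge in \<open>auto simp: in_rest image_iff Bex_def\<close>)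
next
  case (contract i x y)
  obtain a b where ab: "l ! i = (a, b)" by (cases "l ! i")
  have xy: "a = x \<and> b = y \<or> a = y \<and> b = x" using contract(2) ab by (simp add: doubleton_eq_iff)
  have i: "i < length l" using contract(1) by simp
  have "\<not> list_ex (\<lambda>(d, a', b'). a' = a \<and> b' = b \<or> a' = b \<and> b' = a) (rest l i)"
  proof
    assume "list_ex (\<lambda>(d, a', b'). a' = a \<and> b' = b \<or> a' = b \<and> b' = a) (rest l i)"
    then obtain d where "d < length l" "d \<noteq> i" "l ! d = (a, b) \<or> l ! d = (b, a)"
      by (auto simp: list_ex_iff in_rest)
    then show False using contract(4)[of d] xy by (auto simp: doubleton_eq_iff)
  qed
  moreover have "case l ! i of (x, y) \<Rightarrow> laid_cert 1 (D ! i) [0..<n] (rest l i) \<and>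
        (list_ex (\<lambda>(d, a, b). a = x \<and> b = y \<or> a = y \<and> b = x) (rest l i) \<or>
         contract_cert n l i (C ! i) x y \<and> contract_cert n l i (C ! i) y x)"
    using assms(1) i by (simp add: steps_cert_def list_all_iff)
  ultimately have "contract_cert n l i (C ! i) a b \<and> contract_cert n l i (C ! i) b a"
    unfolding ab by simp
  then have "contract_cert n l i (C ! i) x y" using xy by auto
  then show ?thesis unfolding contract_cert_def
  proof (rule laid_cert_sound)
    let ?es = "map (\<lambda>(d, a, b). (d, if a = y then x else a, if b = y then x else b)) (rest l i)"
    have fst: "fst ` set ?es = fst ` set (rest l i)" by force
    have "fst ` set (rest l i) = {0..<length l} - {i}"
      by (auto simp: in_rest image_iff Bex_def)
    then show "edges G \<subseteq> fst ` set ?es" "fst ` set ?es \<subseteq> edges G"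
      unfolding fst contract(5) by auto
    show "ends G e = {u, v}" if euv: "(e, u, v) \<in> set ?es" for e u v
    proof -
      obtain a b where "(e, a, b) \<in> set (rest l i)" "u = (if a = y then x else a)" "v = (if b = y then x else b)"
        using euv by auto
      then show ?thesis unfolding contract(5) contract_simps by (simp add: in_rest)
    qed
  qed (use contract(5) in auto)
qed

section \<open>Floor and minimality of the listed graphs\<close>

lemma laid_1E:
  assumes "laid 1 G" "wf_graph G"
  obtains w p where
    "\<And>x y. x \<in> verts G \<Longrightarrow> y \<in> verts G \<Longrightarrow> x \<noteq> w \<Longrightarrow> y \<noteq> w \<Longrightarrow> p x = p y \<Longrightarrow> x = (y::nat)"
    "\<And>x y. adj G x y \<Longrightarrow> x \<noteq> w \<Longrightarrow> y \<noteq> w \<Longrightarrow> p y = Suc (p x) \<or> p x = Suc (p y)"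
    "\<And>x. adj G x w \<Longrightarrow> p x = p w \<or> p x = Suc (p w)"
    "\<And>x y. dbl G x y \<Longrightarrow> x = w \<or> y = w"
proof -
  obtain W p where L: "layout W p G" and c: "card (W \<inter> verts G) \<le> 1"
    using assms(1) unfolding laid_def by blast
  have fin: "finite (W \<inter> verts G)" using assms(2) by (auto simp: wf_graph_def)
  obtain w where w: "W \<inter> verts G \<subseteq> {w}" "w \<in> verts G \<Longrightarrow> w \<in> W"
  proof (cases "W \<inter> verts G = {}")
    case True
    \<comment> \<open>If every vertex is on the path, a fresh name plays the role of
      \<open>w\<close> and the conditions on its neighbours hold vacuously.\<close>
    obtain w where "w \<notin> verts G" using assms(2) ex_new_if_finite[of "verts G"] by (auto simp: wf_graph_def)
    then show ?thesis using that True by blast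
  next
    case False
    then obtain w where w: "w \<in> W \<inter> verts G" by blast
    then have "W \<inter> verts G \<subseteq> {w}" using c card_le_Suc0_iff_eq[OF fin] by (auto simp: One_nat_def)
    then show ?thesis using that w by blast
  qed
  have nW: "x \<notin> W" if "x \<in> verts G" "x \<noteq> w" for x using w that by blast
  note aw = adjD[OF assms(2)]
  show thesis
  proof (rule that[of w p])
    show "x = y" if "x \<in> verts G" "y \<in> verts G" "x \<noteq> w" "y \<noteq> w" "p x = p y" for x y
      using layout_inj[OF L] that nW by (auto simp: inj_on_def)
    show "p y = Suc (p x) \<or> p x = Suc (p y)" if "adj G x y" "x \<noteq> w" "y \<noteq> w" for x y
    proof -
      have "x \<notin> W" "y \<notin> W" using nW aw[OF that(1)] that by auto
      then show ?thesis using that layoutD(1)[OF L] unfolding adj_def by metis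
    qed
    show "p x = p w \<or> p x = Suc (p w)" if "adj G x w" for x
    proof -
      have "x \<notin> W" "w \<in> W" using nW aw[OF that] w(2) by auto
      then show ?thesis using that layoutD(3)[OF L] unfolding adj_def by metis
    qed
    show "x = w \<or> y = w" if "dbl G x y" for x y
    proof (rule ccontr)
      assume "\<not> (x = w \<or> y = w)"
      then have "x \<notin> W" "y \<notin> W" using nW aw[OF dbl_adj[OF that]] by auto
      then show False using that layoutD(2)[OF L] unfolding dbl_def by metis
    qed
  qed
qed

lemma wf_list:
  "wf_graph C2_C2" "wf_graph C2_K13" "wf_graph K13_K13" "wf_graph C4" "wf_graph H1" "wf_graph H2"
  "wf_graph H3" "wf_graph H4" "wf_graph H5" "wf_graph K14" "wf_graph long_Y"
  unfolding C2_C2_def C2_K13_def K13_K13_def C4_def H1_def H2_def H3_def H4_def H5_def K14_def long_Y_def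
  by (rule wf_mk_graph; simp)+

text \<open>Being laid passes to minors, so checking single steps settles all proper minors of the
  listed graphs.\<close>

lemma laid_1_minor_step:
  "minor_step C2_C2 G \<Longrightarrow> laid 1 G"
  "minor_step C2_K13 G \<Longrightarrow> laid 1 G"
  "minor_step K13_K13 G \<Longrightarrow> laid 1 G"
  "minor_step C4 G \<Longrightarrow> laid 1 G"
  "minor_step H1 G \<Longrightarrow> laid 1 G"
  "minor_step H2 G \<Longrightarrow> laid 1 G"
  "minor_step H3 G \<Longrightarrow> laid 1 G"
  "minor_step H4 G \<Longrightarrow> laid 1 G"
  "minor_step H5 G \<Longrightarrow> laid 1 G"
  "minor_step K14 G \<Longrightarrow> laid 1 G"
  "minor_step long_Y G \<Longrightarrow> laid 1 G"
  subgoal unfolding C2_C2_def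
    by (erule steps_cert_sound[rotated, where
      D = "[([2], [0, 1, 1, 2]), ([2], [0, 1, 1, 2]), ([0], [0, 0, 1, 2]), ([0], [0, 0, 1, 2])]" and
      C = "[([], []), ([], []), ([], []), ([], [])]"]) code_simp
  subgoal unfolding C2_K13_def
    by (erule steps_cert_sound[rotated, where
      D = "[([3], [0, 1, 3, 2, 2, 4]), ([3], [0, 1, 3, 2, 2, 4]), ([0], [0, 0, 2, 4, 1, 3]), 
       ([0], [0, 0, 2, 1, 4, 3]), ([0], [0, 0, 2, 1, 3, 4])]" and
      C = "[([], []), ([], []), ([0], [0, 0, 2, 2, 1, 3]), ([0], [0, 0, 2, 1, 2, 3]), ([0], [0, 
       0, 2, 1, 3, 2])]"]) code_simp
  subgoal unfolding K13_K13_def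
    by (erule steps_cert_sound[rotated, where
      D = "[([5], [1, 3, 0, 2, 5, 4, 4, 6]), ([5], [1, 0, 3, 2, 5, 4, 4, 6]), ([5], [1, 0, 2, 3, 
       5, 4, 4, 6]), ([1], [1, 0, 0, 2, 4, 6, 3, 5]), ([1], [1, 0, 0, 2, 4, 3, 6, 5]), ([1], 
       [1, 0, 0, 2, 4, 3, 5, 6])]" and
      C = "[([5], [1, 1, 0, 2, 4, 3, 3, 5]), ([5], [1, 0, 1, 2, 4, 3, 3, 5]), ([5], [1, 0, 2, 1, 
       4, 3, 3, 5]), ([1], [1, 0, 0, 2, 4, 4, 3, 5]), ([1], [1, 0, 0, 2, 4, 3, 4, 5]), ([1], 
       [1, 0, 0, 2, 4, 3, 5, 4])]"]) code_simp
  subgoal unfolding C4_def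
    by (erule steps_cert_sound[rotated, where
      D = "[([0], [1, 0, 1, 2]), ([0], [0, 0, 2, 1]), ([0], [1, 1, 0, 2]), ([0], [0, 0, 1, 2])]" and
      C = "[([0, 1], [0, 0, 0, 1]), ([0], [0, 0, 0, 1]), ([0], [0, 0, 1, 1]), ([1], [1, 0, 0, 1])]"]) code_simp
  subgoal unfolding H1_def
    by (erule steps_cert_sound[rotated, where
      D = "[([2], [0, 1, 0]), ([2], [0, 1, 0]), ([0], [0, 0, 1]), ([0], [0, 0, 1]), ([1], [0, 0, 
       1]), ([1], [0, 0, 1])]" and
      C = "[([], []), ([], []), ([], []), ([], []), ([], []), ([], [])]"]) code_simp
  subgoal unfolding H2_def
    by (erule steps_cert_sound[rotated, where
      D = "[([2], [1, 0, 0, 2]), ([2], [1, 0, 0, 2]), ([1], [1, 0, 0, 2]), ([1], [1, 0, 0, 2]), 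
       ([0], [0, 0, 1, 2])]" and
      C = "[([], []), ([], []), ([], []), ([], []), ([0, 3], [0, 0, 1, 0])]"]) code_simp
  subgoal unfolding H3_def
    by (erule steps_cert_sound[rotated, where
      D = "[([0], [1, 0, 1, 2]), ([3], [1, 0, 2, 0]), ([0], [1, 1, 0, 2]), ([1], [1, 0, 0, 2]), 
       ([1], [1, 0, 0, 2])]" and
      C = "[([0, 1], [0, 0, 0, 1]), ([0], [0, 0, 0, 1]), ([0, 2], [0, 0, 0, 1]), ([], []), ([], 
       [])]"]) code_simp
  subgoal unfolding H4_def
    by (erule steps_cert_sound[rotated, where
      D = "[([2], [1, 2, 0, 0, 3]), ([2], [1, 2, 0, 0, 3]), ([0], [0, 1, 3, 0, 2]), ([0], [0, 1, 
       0, 3, 2]), ([1], [1, 0, 0, 2, 3])]" and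
      C = "[([], []), ([], []), ([0, 2], [0, 1, 0, 0, 2]), ([0, 3], [0, 1, 0, 0, 2]), ([1, 4], 
       [1, 0, 0, 2, 0])]"]) code_simp
  subgoal unfolding H5_def
    by (erule steps_cert_sound[rotated, where
      D = "[([3], [0, 1, 2, 2, 3]), ([3], [0, 3, 1, 1, 2]), ([3], [0, 2, 1, 2, 3]), ([0], [0, 0, 
       1, 2, 3]), ([0], [0, 0, 1, 2, 3])]" and
      C = "[([3], [1, 0, 1, 1, 2]), ([3], [0, 1, 1, 1, 2]), ([4], [0, 2, 1, 1, 0]), ([], []), 
       ([], [])]"]) code_simp
  subgoal unfolding K14_def
    by (erule steps_cert_sound[rotated, where
      D = "[([2], [1, 3, 0, 0, 2]), ([1], [1, 0, 3, 0, 2]), ([1], [1, 0, 0, 3, 2]), ([1], [1, 0, 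
       0, 2, 3])]" and
      C = "[([2], [1, 1, 0, 0, 2]), ([1], [1, 0, 1, 0, 2]), ([1], [1, 0, 0, 1, 2]), ([1], [1, 0, 
       0, 2, 1])]"]) code_simp
  subgoal unfolding long_Y_def
    by (erule steps_cert_sound[rotated, where
      D = "[([0], [3, 0, 1, 3, 2, 4, 5]), ([1], [2, 1, 5, 1, 0, 3, 4]), ([0], [1, 1, 0, 4, 5, 2, 
       3]), ([3], [2, 1, 0, 1, 5, 3, 4]), ([0], [1, 1, 0, 2, 3, 4, 5]), ([5], [2, 1, 0, 3, 4, 
       1, 5])]" and
      C = "[([2], [2, 2, 1, 1, 0, 3, 4]), ([1, 2], [2, 1, 1, 1, 0, 3, 4]), ([4], [2, 1, 0, 2, 1, 
       3, 4]), ([3, 4], [2, 1, 0, 1, 1, 3, 4]), ([6], [2, 1, 0, 3, 4, 2, 1]), ([5, 6], [2, 1, 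
       0, 3, 4, 1, 1])]"]) code_simp
  done

lemma laid_cert_mk_graph:
  assumes "laid_cert k c [0..<n] (enumerate 0 l)"
  shows "laid k (mk_graph n l)"
  by (rule laid_cert_sound[OF assms]) (auto simp: in_set_enumerate_eq image_iff Bex_def)

text \<open>Provides the upper bound on the floor. In the disjoint unions one vertex of each
  component leaves the path.\<close>

lemma laid_2:
  "laid 2 C2_C2" "laid 2 C2_K13" "laid 2 K13_K13" "laid 2 C4"
  "laid 2 H1" "laid 2 H2" "laid 2 H3" "laid 2 H4"
  "laid 2 H5" "laid 2 K14" "laid 2 long_Y"
  subgoal unfolding C2_C2_def by (rule laid_cert_mk_graph[of _ "([1, 3], [0, 0, 1, 1])"]) code_simp
  subgoal unfolding C2_K13_def by (rule laid_cert_mk_graph[of _ "([1, 5], [0, 0, 2, 1, 3, 2])"]) code_simp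
  subgoal unfolding K13_K13_def by (rule laid_cert_mk_graph[of _ "([3, 7], [1, 0, 2, 1, 4, 3, 5, 4])"]) code_simp
  subgoal unfolding C4_def by (rule laid_cert_mk_graph[of _ "([2, 3], [0, 1, 1, 0])"]) code_simp
  subgoal unfolding H1_def by (rule laid_cert_mk_graph[of _ "([1, 2], [0, 0, 0])"]) code_simp
  subgoal unfolding H2_def by (rule laid_cert_mk_graph[of _ "([1, 2], [0, 0, 0, 1])"]) code_simp
  subgoal unfolding H3_def by (rule laid_cert_mk_graph[of _ "([1, 3], [0, 0, 1, 0])"]) code_simp
  subgoal unfolding H4_def by (rule laid_cert_mk_graph[of _ "([1, 4], [1, 1, 0, 2, 1])"]) code_simp
  subgoal unfolding H5_def by (rule laid_cert_mk_graph[of _ "([3, 4], [0, 2, 1, 1, 1])"]) code_simp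
  subgoal unfolding K14_def by (rule laid_cert_mk_graph[of _ "([3, 4], [1, 0, 2, 1, 1])"]) code_simp
  subgoal unfolding long_Y_def by (rule laid_cert_mk_graph[of _ "([5, 6], [2, 1, 0, 3, 4, 2, 2])"]) code_simp
  done

text \<open>All clauses are position arithmetic: a path vertex has room for one neighbour on each
  side, the neighbours of \<open>w\<close> share two consecutive positions, and adjacent path
  vertices have positions of different parity.\<close>

lemma laid_1_center:
  assumes "laid 1 G" "wf_graph G"
  obtains w where
    "\<And>x y. dbl G x y \<Longrightarrow> w = x \<or> w = y"
    "\<And>c x y z. adj G c x \<Longrightarrow> adj G c y \<Longrightarrow> adj G c z \<Longrightarrow> distinct [x, y, z] \<Longrightarrow>
      w = c \<or> w = x \<or> w = y \<or> w = z"
    "\<And>x y z. adj G w x \<Longrightarrow> adj G w y \<Longrightarrow> adj G w z \<Longrightarrow> \<not> distinct [x, y, z]"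
    "\<And>a b c d. adj G w a \<Longrightarrow> adj G w b \<Longrightarrow> adj G a c \<Longrightarrow> adj G a d \<Longrightarrow> \<not> distinct [w, a, b, c, d]"
    "\<And>a b c. adj G a b \<Longrightarrow> adj G b c \<Longrightarrow> adj G a c \<Longrightarrow> w = a \<or> w = b \<or> w = c"
    "\<And>a b c. adj G w a \<Longrightarrow> adj G w b \<Longrightarrow> adj G c a \<Longrightarrow> adj G c b \<Longrightarrow> w = c \<or> a = b"
    "\<And>a b c d. adj G a b \<Longrightarrow> adj G b c \<Longrightarrow> adj G c d \<Longrightarrow> adj G d a \<Longrightarrow> distinct [a, b, c, d] \<Longrightarrow>
      w = a \<or> w = b \<or> w = c \<or> w = d"
proof -
  obtain w p where
    inj: "\<And>x y. x \<in> verts G \<Longrightarrow> y \<in> verts G \<Longrightarrow> x \<noteq> w \<Longrightarrow> y \<noteq> w \<Longrightarrow> p x = p y \<Longrightarrow> x = (y::nat)"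
    and path: "\<And>x y. adj G x y \<Longrightarrow> x \<noteq> w \<Longrightarrow> y \<noteq> w \<Longrightarrow> p y = Suc (p x) \<or> p x = Suc (p y)"
    and wn: "\<And>x. adj G x w \<Longrightarrow> p x = p w \<or> p x = Suc (p w)"
    and dbl: "\<And>x y. dbl G x y \<Longrightarrow> x = w \<or> y = w"
    using laid_1E[OF assms] by blast
  note V = adjD[OF assms(2)]
  have ne: "p x \<noteq> p y" if "adj G c x" "adj G d y" "x \<noteq> w" "y \<noteq> w" "x \<noteq> y" for c d x y
    using inj[of x y] V[OF that(1)] V[OF that(2)] that by blast
  have wn': "p x = p w \<or> p x = Suc (p w)" if "adj G w x" for x using wn adj_sym that by blast
  show thesis
  proof (rule that[of w])
    show "w = x \<or> w = y" if "dbl G x y" for x y using dbl that by blast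
    show "w = c \<or> w = x \<or> w = y \<or> w = z"
      if "adj G c x" "adj G c y" "adj G c z" "distinct [x, y, z]" for c x y z
    proof (rule ccontr)
      assume n: "\<not> ?thesis"
      have "p x \<noteq> p y" "p x \<noteq> p z" "p y \<noteq> p z" using ne that n by auto
      then show False using path[OF that(1)] path[OF that(2)] path[OF that(3)] n by linarith
    qed
    show "\<not> distinct [x, y, z]" if "adj G w x" "adj G w y" "adj G w z" for x y z
    proof
      assume d: "distinct [x, y, z]"
      have "x \<noteq> w" "y \<noteq> w" "z \<noteq> w" using V(3) that by blast+
      then have "p x \<noteq> p y" "p x \<noteq> p z" "p y \<noteq> p z" using ne that d by auto
      then show False using wn'[OF that(1)] wn'[OF that(2)] wn'[OF that(3)] by linarith
    qed
    show "\<not> distinct [w, a, b, c, d]" if "adj G w a" "adj G w b" "adj G a c" "adj G a d" for a b c d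
    proof
      assume d: "distinct [w, a, b, c, d]"
      \<comment> \<open>As a neighbour of \<open>w\<close>, \<open>b\<close> occupies one of the two
        positions beside \<open>a\<close>, and only one is left for \<open>c\<close> and
        \<open>d\<close>.\<close>
      have "p a \<noteq> p b" "p b \<noteq> p c" "p b \<noteq> p d" "p c \<noteq> p d" using ne that d by auto
      then show False
        using wn'[OF that(1)] wn'[OF that(2)] path[OF that(3)] path[OF that(4)] d by auto
    qed
    show "w = a \<or> w = b \<or> w = c" if "adj G a b" "adj G b c" "adj G a c" for a b c
      using path[OF that(1)] path[OF that(2)] path[OF that(3)] by linarith
    show "w = c \<or> a = b" if "adj G w a" "adj G w b" "adj G c a" "adj G c b" for a b c
    proof (rule ccontr)
      assume n: "\<not> ?thesis"
      have "a \<noteq> w" "b \<noteq> w" using V(3) that by blast+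
      then have "p a \<noteq> p b" using ne that n by auto
      then show False
        using wn'[OF that(1)] wn'[OF that(2)] path[OF that(3)] path[OF that(4)] n \<open>a \<noteq> w\<close> \<open>b \<noteq> w\<close>
        by linarith
    qed
    show "w = a \<or> w = b \<or> w = c \<or> w = d"
      if "adj G a b" "adj G b c" "adj G c d" "adj G d a" "distinct [a, b, c, d]" for a b c d
    proof (rule ccontr)
      assume n: "\<not> ?thesis"
      have "p a \<noteq> p c" "p b \<noteq> p d"
        using ne[OF that(4) that(2)] ne[OF that(1) that(3)] that(5) n by auto
      have nw: "a \<noteq> w" "b \<noteq> w" "c \<noteq> w" "d \<noteq> w" using n by auto
      \<comment> \<open>The vertices \<open>b\<close> and \<open>d\<close> lie on opposite sides of
        \<open>a\<close>, so their common neighbour \<open>c\<close> would share the position of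
        \<open>a\<close>.\<close>
      have "p b = Suc (p a) \<and> p a = Suc (p d) \<or> p d = Suc (p a) \<and> p a = Suc (p b)"
        using path[OF that(1) nw(1,2)] path[OF that(4) nw(4,1)] \<open>p b \<noteq> p d\<close> by linarith
      then show False
        using path[OF that(2) nw(2,3)] path[OF that(3) nw(3,4)] \<open>p a \<noteq> p c\<close> by linarith
    qed
  qed
qed

text \<open>In each graph a double edge, a claw or the 4-cycle leaves few candidates for
  \<open>w\<close>, and every candidate fails at another place.\<close>

lemma not_laid_1:
  "\<not> laid 1 C2_C2" "\<not> laid 1 C2_K13" "\<not> laid 1 K13_K13" "\<not> laid 1 C4"
  "\<not> laid 1 H1" "\<not> laid 1 H2" "\<not> laid 1 H3" "\<not> laid 1 H4"
  "\<not> laid 1 H5" "\<not> laid 1 K14" "\<not> laid 1 long_Y"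
  subgoal
  proof (rule notI, erule laid_1_center[OF _ wf_list(1)], goal_cases)
    case h: (1 w)
    have "w = 0 \<or> w = 1" using h(1)[of 0 1] by (simp add: C2_C2_def adj_mk_graph dbl_mk_graph)
    then show ?case
      by (elim disjE) (use h(1)[of 2 3] in \<open>simp_all add: C2_C2_def adj_mk_graph dbl_mk_graph\<close>)
  qed
  subgoal
  proof (rule notI, erule laid_1_center[OF _ wf_list(2)], goal_cases)
    case h: (1 w)
    have "w = 0 \<or> w = 1" using h(1)[of 0 1] by (simp add: C2_K13_def adj_mk_graph dbl_mk_graph)
    then show ?case
      by (elim disjE) (use h(2)[of 2 3 4 5] in \<open>simp_all add: C2_K13_def adj_mk_graph dbl_mk_graph\<close>)
  qed
  subgoal
  proof (rule notI, erule laid_1_center[OF _ wf_list(3)], goal_cases)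
    case h: (1 w)
    have "w = 0 \<or> w = 1 \<or> w = 2 \<or> w = 3" using h(2)[of 0 1 2 3] by (simp add: K13_K13_def adj_mk_graph dbl_mk_graph)
    then show ?case
      by (elim disjE) (use h(2)[of 4 5 6 7] in \<open>simp_all add: K13_K13_def adj_mk_graph dbl_mk_graph\<close>)
  qed
  subgoal
  proof (rule notI, erule laid_1_center[OF _ wf_list(4)], goal_cases)
    case h: (1 w)
    have "w = 0 \<or> w = 1 \<or> w = 2 \<or> w = 3" using h(7)[of 0 1 2 3] by (simp add: C4_def adj_mk_graph dbl_mk_graph)
    then show ?case
      by (elim disjE) (use h(6)[of 1 3 2] h(6)[of 0 2 3] h(6)[of 1 3 0] h(6)[of 0 2 1] in \<open>simp_all add: C4_def adj_mk_graph dbl_mk_graph\<close>)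
  qed
  subgoal
  proof (rule notI, erule laid_1_center[OF _ wf_list(5)], goal_cases)
    case h: (1 w)
    have "w = 0 \<or> w = 1" using h(1)[of 0 1] by (simp add: H1_def adj_mk_graph dbl_mk_graph)
    then show ?case
      by (elim disjE) (use h(1)[of 1 2] h(1)[of 0 2] in \<open>simp_all add: H1_def adj_mk_graph dbl_mk_graph\<close>)
  qed
  subgoal
  proof (rule notI, erule laid_1_center[OF _ wf_list(6)], goal_cases)
    case h: (1 w)
    have "w = 0 \<or> w = 1" using h(1)[of 0 1] by (simp add: H2_def adj_mk_graph dbl_mk_graph)
    then show ?case
      by (elim disjE) (use h(1)[of 0 2] h(3)[of 1 2 3] in \<open>simp_all add: H2_def adj_mk_graph dbl_mk_graph\<close>)
  qed
  subgoal
  proof (rule notI, erule laid_1_center[OF _ wf_list(7)], goal_cases)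
    case h: (1 w)
    have "w = 0 \<or> w = 3" using h(1)[of 0 3] by (simp add: H3_def adj_mk_graph dbl_mk_graph)
    then show ?case
      by (elim disjE) (use h(5)[of 0 1 2] h(3)[of 1 2 3] in \<open>simp_all add: H3_def adj_mk_graph dbl_mk_graph\<close>)
  qed
  subgoal
  proof (rule notI, erule laid_1_center[OF _ wf_list(8)], goal_cases)
    case h: (1 w)
    have "w = 0 \<or> w = 1" using h(1)[of 0 1] by (simp add: H4_def adj_mk_graph dbl_mk_graph)
    then show ?case
      by (elim disjE) (use h(3)[of 1 2 3] h(4)[of 0 4 2 3] in \<open>simp_all add: H4_def adj_mk_graph dbl_mk_graph\<close>)
  qed
  subgoal
  proof (rule notI, erule laid_1_center[OF _ wf_list(9)], goal_cases)
    case h: (1 w)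
    have "w = 3 \<or> w = 4" using h(1)[of 3 4] by (simp add: H5_def adj_mk_graph dbl_mk_graph)
    then show ?case
      by (elim disjE) (use h(2)[of 2 0 1 3] h(4)[of 2 4 0 1] in \<open>simp_all add: H5_def adj_mk_graph dbl_mk_graph\<close>)
  qed
  subgoal
  proof (rule notI, erule laid_1_center[OF _ wf_list(10)], goal_cases)
    case h: (1 w)
    have "w = 0 \<or> w = 1 \<or> w = 2 \<or> w = 3" using h(2)[of 0 1 2 3] by (simp add: K14_def adj_mk_graph dbl_mk_graph)
    then show ?case
      by (elim disjE) (use h(3)[of 1 2 3] h(2)[of 0 2 3 4] h(2)[of 0 1 2 4] h(2)[of 0 1 3 4] in \<open>simp_all add: K14_def adj_mk_graph dbl_mk_graph\<close>)
  qed
  subgoal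
  proof (rule notI, erule laid_1_center[OF _ wf_list(11)], goal_cases)
    case h: (1 w)
    have "w = 0 \<or> w = 1 \<or> w = 3 \<or> w = 5" using h(2)[of 0 1 3 5] by (simp add: long_Y_def adj_mk_graph dbl_mk_graph)
    then show ?case
      by (elim disjE) (use h(3)[of 1 3 5] h(4)[of 0 2 3 5] h(4)[of 0 4 1 5] h(4)[of 0 6 1 3] in \<open>simp_all add: long_Y_def adj_mk_graph dbl_mk_graph\<close>)
  qed
  done

subsection \<open>Merging adjacent vertices\<close>

lemma adj_commute: "adj G x y \<longleftrightarrow> adj G y x"
  using adj_sym by blast

lemma dbl_commute: "dbl G x y \<longleftrightarrow> dbl G y x"
  using dbl_sym by blast

text \<open>Contraction of the whole bundle of edges between \<open>x\<close> and \<open>y\<close>: since only edges without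
  parallel edges may be contracted, all but one are deleted first.\<close>

definition merge :: "mgraph \<Rightarrow> nat \<Rightarrow> nat \<Rightarrow> mgraph" where
  "merge G x y = \<lparr>verts = verts G - {y}, edges = {f \<in> edges G. ends G f \<noteq> {x, y}},
     ends = (\<lambda>f. if y \<in> ends G f then insert x (ends G f - {y}) else ends G f)\<rparr>"

lemma merge_steps:
  assumes "wf_graph G" "adj G x y"
  shows "minor_step\<^sup>*\<^sup>* G (merge G x y)"
proof -
  obtain e where e: "e \<in> edges G" "ends G e = {x, y}" using assms(2) by (auto simp: adj_def)
  let ?F = "{f \<in> edges G. ends G f = {x, y}} - {e}"
  let ?G = "G\<lparr>edges := edges G - ?F\<rparr>"
  have "minor_step\<^sup>*\<^sup>* G ?G"
    using assms(1) by (intro del_edges_minor) (auto simp: wf_graph_def)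
  moreover have "minor_step ?G (contract ?G e x y)"
  proof -
    have "\<forall>f\<in>edges ?G. f \<noteq> e \<longrightarrow> ends ?G f \<noteq> ends ?G e" using e by auto
    moreover have "e \<in> edges ?G" "ends ?G e = {x, y}" "x \<noteq> y"
      using e adjD(3)[OF assms] by auto
    ultimately show ?thesis unfolding minor_step_def by blast
  qed
  ultimately have "minor_step\<^sup>*\<^sup>* G (contract ?G e x y)"
    by (rule rtranclp.rtrancl_into_rtrancl)
  moreover have "contract ?G e x y = merge G x y"
  proof -
    have "edges G - ?F - {e} = {f \<in> edges G. ends G f \<noteq> {x, y}}" using e by auto
    then show ?thesis unfolding contract_def merge_def by (simp cong: if_cong)
  qed
  ultimately show ?thesis by simp
qed

lemma wf_merge: "wf_graph G \<Longrightarrow> adj G x y \<Longrightarrow> wf_graph (merge G x y)"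
  using merge_steps wf_minor_steps by blast

lemma minor_merge: "wf_graph G \<Longrightarrow> adj G x y \<Longrightarrow> is_minor M (merge G x y) \<Longrightarrow> is_minor M G"
  using merge_steps is_minor_step_trans by blast

lemma merge_edge:
  assumes "e \<in> edges G" "ends G e = {u, v}" "u \<noteq> y" "v \<noteq> y"
  shows "e \<in> edges (merge G x y)" "ends (merge G x y) e = {u, v}"
  using assms by (auto simp: merge_def)

lemma merge_edge_new:
  assumes "e \<in> edges G" "ends G e = {u, y}" "u \<noteq> x" "u \<noteq> y"
  shows "e \<in> edges (merge G x y)" "ends (merge G x y) e = {u, x}"
  using assms by (auto simp: merge_def doubleton_eq_iff)

lemma adj_merge: "adj G u v \<Longrightarrow> u \<noteq> y \<Longrightarrow> v \<noteq> y \<Longrightarrow> adj (merge G x y) u v"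
  unfolding adj_def by (elim bexE) (metis merge_edge)

lemma adj_merge_new: "adj G u y \<Longrightarrow> u \<noteq> x \<Longrightarrow> u \<noteq> y \<Longrightarrow> adj (merge G x y) u x"
  unfolding adj_def by (elim bexE) (metis merge_edge_new)

lemma dbl_merge: "dbl G u v \<Longrightarrow> u \<noteq> y \<Longrightarrow> v \<noteq> y \<Longrightarrow> dbl (merge G x y) u v"
  unfolding dbl_def by (elim bexE conjE) (metis merge_edge)

text \<open>The two edges from \<open>u\<close> become parallel. In this way a triangle acts as a
  double edge once one of its sides is merged.\<close>

lemma dbl_merge_new:
  assumes "adj G u x" "adj G u y" "u \<noteq> x" "u \<noteq> y" "x \<noteq> y"
  shows "dbl (merge G x y) u x"
proof -
  obtain e f where ef: "e \<in> edges G" "ends G e = {u, x}" "f \<in> edges G" "ends G f = {u, y}"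
    using assms(1,2) by (auto simp: adj_def)
  have "e \<noteq> f" using ef assms by (auto simp: doubleton_eq_iff)
  then show ?thesis unfolding dbl_def
    using merge_edge[OF ef(1,2) assms(4,5)] merge_edge_new[OF ef(3,4) assms(3,4)] by blast
qed

text \<open>Further edges among the chosen vertices do no harm, since passing to a subgraph deletes
  them. The pattern lemmas below therefore ask only for distinct vertices and the presence of
  edges.\<close>

lemma mk_graph_minor:
  assumes wf: "wf_graph G" and vs: "distinct vs" "set vs \<subseteq> verts G" "length vs = n" "0 < n"
    and es: "distinct es"
    and l: "list_all2 (\<lambda>e (i, j). i < n \<and> j < n \<and> i \<noteq> j \<and> e \<in> edges G \<and> ends G e = {vs ! i, vs ! j}) es l"
  shows "is_minor (mk_graph n l) G"
proof (rule subgraph_minor[of _ _ "nth vs" "nth es"])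
  have l': "fst (l ! k) < n \<and> snd (l ! k) < n \<and> fst (l ! k) \<noteq> snd (l ! k) \<and> es ! k \<in> edges G \<and>
      ends G (es ! k) = {vs ! fst (l ! k), vs ! snd (l ! k)}" if "k < length l" for k
    using l that by (auto simp: list_all2_conv_all_nth case_prod_unfold)
  have len: "length es = length l" using l by (rule list_all2_lengthD)
  show "wf_graph (mk_graph n l)"
    by (rule wf_mk_graph[OF vs(4)]) (use l' in \<open>fastforce simp: in_set_conv_nth\<close>)
  show "inj_on (nth vs) (verts (mk_graph n l))" using vs by (auto simp: inj_on_def nth_eq_iff_index_eq)
  show "nth vs ` verts (mk_graph n l) \<subseteq> verts G" using vs by auto
  show "inj_on (nth es) (edges (mk_graph n l))" using es len by (auto simp: inj_on_def nth_eq_iff_index_eq)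
  show "nth es ` edges (mk_graph n l) \<subseteq> edges G" using l' by auto
  show "ends G (es ! e) = nth vs ` ends (mk_graph n l) e" if "e \<in> edges (mk_graph n l)" for e
    using l' that by simp
qed (rule wf)

lemma adjE:
  assumes "adj G x y"
  obtains e where "e \<in> edges G" "ends G e = {x, y}"
  using assms by (auto simp: adj_def)

lemma dblE:
  assumes "dbl G x y"
  obtains e f where "e \<in> edges G" "ends G e = {x, y}" "f \<in> edges G" "ends G f = {x, y}" "e \<noteq> f"
  using assms by (auto simp: dbl_def)

lemma C2_C2_minor:
  assumes "wf_graph G" "distinct [a, b, c, d]"
    "dbl G a b" "dbl G c d"
  shows "is_minor C2_C2 G"
proof -
  obtain r0 r1 where rr0: "r0 \<in> edges G" "ends G r0 = {a, b}" "r1 \<in> edges G" "ends G r1 = {a, b}" "r0 \<noteq> r1"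
    using dblE[OF assms(3)] .
  obtain r2 r3 where rr2: "r2 \<in> edges G" "ends G r2 = {c, d}" "r3 \<in> edges G" "ends G r3 = {c, d}" "r2 \<noteq> r3"
    using dblE[OF assms(4)] .
  have "set [a, b, c, d] \<subseteq> verts G"
    using wf_endsD(2,3)[OF assms(1) rr0(1,2)]
      wf_endsD(2,3)[OF assms(1) rr2(1,2)] by simp
  then show ?thesis
    unfolding C2_C2_def
    by (intro mk_graph_minor[OF assms(1), of "[a, b, c, d]" _ "[r0, r1, r2, r3]"])
      (use assms(2) rr0 rr2 in \<open>auto simp: doubleton_eq_iff\<close>)
qed

lemma C2_K13_minor:
  assumes "wf_graph G" "distinct [a, b, c, d, e, f]"
    "dbl G a b" "adj G c d" "adj G c e" "adj G c f"
  shows "is_minor C2_K13 G"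
proof -
  obtain r0 r1 where rr0: "r0 \<in> edges G" "ends G r0 = {a, b}" "r1 \<in> edges G" "ends G r1 = {a, b}" "r0 \<noteq> r1"
    using dblE[OF assms(3)] .
  obtain r2 where rr2: "r2 \<in> edges G" "ends G r2 = {c, d}"
    using adjE[OF assms(4)] .
  obtain r3 where rr3: "r3 \<in> edges G" "ends G r3 = {c, e}"
    using adjE[OF assms(5)] .
  obtain r4 where rr4: "r4 \<in> edges G" "ends G r4 = {c, f}"
    using adjE[OF assms(6)] .
  have "set [a, b, c, d, e, f] \<subseteq> verts G"
    using wf_endsD(2,3)[OF assms(1) rr0(1,2)]
      wf_endsD(2,3)[OF assms(1) rr2(1,2)]
      wf_endsD(2,3)[OF assms(1) rr3(1,2)]
      wf_endsD(2,3)[OF assms(1) rr4(1,2)] by simp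
  then show ?thesis
    unfolding C2_K13_def
    by (intro mk_graph_minor[OF assms(1), of "[a, b, c, d, e, f]" _ "[r0, r1, r2, r3, r4]"])
      (use assms(2) rr0 rr2 rr3 rr4 in \<open>auto simp: doubleton_eq_iff\<close>)
qed

lemma K13_K13_minor:
  assumes "wf_graph G" "distinct [a, b, c, d, e, f, g, h]"
    "adj G a b" "adj G a c" "adj G a d" "adj G e f" "adj G e g" "adj G e h"
  shows "is_minor K13_K13 G"
proof -
  obtain r0 where rr0: "r0 \<in> edges G" "ends G r0 = {a, b}"
    using adjE[OF assms(3)] .
  obtain r1 where rr1: "r1 \<in> edges G" "ends G r1 = {a, c}"
    using adjE[OF assms(4)] .
  obtain r2 where rr2: "r2 \<in> edges G" "ends G r2 = {a, d}"
    using adjE[OF assms(5)] .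
  obtain r3 where rr3: "r3 \<in> edges G" "ends G r3 = {e, f}"
    using adjE[OF assms(6)] .
  obtain r4 where rr4: "r4 \<in> edges G" "ends G r4 = {e, g}"
    using adjE[OF assms(7)] .
  obtain r5 where rr5: "r5 \<in> edges G" "ends G r5 = {e, h}"
    using adjE[OF assms(8)] .
  have "set [a, b, c, d, e, f, g, h] \<subseteq> verts G"
    using wf_endsD(2,3)[OF assms(1) rr0(1,2)]
      wf_endsD(2,3)[OF assms(1) rr1(1,2)]
      wf_endsD(2,3)[OF assms(1) rr2(1,2)]
      wf_endsD(2,3)[OF assms(1) rr3(1,2)]
      wf_endsD(2,3)[OF assms(1) rr4(1,2)]
      wf_endsD(2,3)[OF assms(1) rr5(1,2)] by simp
  then show ?thesis
    unfolding K13_K13_def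
    by (intro mk_graph_minor[OF assms(1), of "[a, b, c, d, e, f, g, h]" _ "[r0, r1, r2, r3, r4, r5]"])
      (use assms(2) rr0 rr1 rr2 rr3 rr4 rr5 in \<open>auto simp: doubleton_eq_iff\<close>)
qed

lemma C4_minor:
  assumes "wf_graph G" "distinct [a, b, c, d]"
    "adj G a b" "adj G b c" "adj G c d" "adj G d a"
  shows "is_minor C4 G"
proof -
  obtain r0 where rr0: "r0 \<in> edges G" "ends G r0 = {a, b}"
    using adjE[OF assms(3)] .
  obtain r1 where rr1: "r1 \<in> edges G" "ends G r1 = {b, c}"
    using adjE[OF assms(4)] .
  obtain r2 where rr2: "r2 \<in> edges G" "ends G r2 = {c, d}"
    using adjE[OF assms(5)] .
  obtain r3 where rr3: "r3 \<in> edges G" "ends G r3 = {d, a}"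
    using adjE[OF assms(6)] .
  have "set [a, b, c, d] \<subseteq> verts G"
    using wf_endsD(2,3)[OF assms(1) rr0(1,2)]
      wf_endsD(2,3)[OF assms(1) rr1(1,2)]
      wf_endsD(2,3)[OF assms(1) rr2(1,2)]
      wf_endsD(2,3)[OF assms(1) rr3(1,2)] by simp
  then show ?thesis
    unfolding C4_def
    by (intro mk_graph_minor[OF assms(1), of "[a, b, c, d]" _ "[r0, r1, r2, r3]"])
      (use assms(2) rr0 rr1 rr2 rr3 in \<open>auto simp: doubleton_eq_iff\<close>)
qed

lemma H1_minor:
  assumes "wf_graph G" "distinct [a, b, c]"
    "dbl G a b" "dbl G b c" "dbl G a c"
  shows "is_minor H1 G"
proof -
  obtain r0 r1 where rr0: "r0 \<in> edges G" "ends G r0 = {a, b}" "r1 \<in> edges G" "ends G r1 = {a, b}" "r0 \<noteq> r1"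
    using dblE[OF assms(3)] .
  obtain r2 r3 where rr2: "r2 \<in> edges G" "ends G r2 = {b, c}" "r3 \<in> edges G" "ends G r3 = {b, c}" "r2 \<noteq> r3"
    using dblE[OF assms(4)] .
  obtain r4 r5 where rr4: "r4 \<in> edges G" "ends G r4 = {a, c}" "r5 \<in> edges G" "ends G r5 = {a, c}" "r4 \<noteq> r5"
    using dblE[OF assms(5)] .
  have "set [a, b, c] \<subseteq> verts G"
    using wf_endsD(2,3)[OF assms(1) rr0(1,2)]
      wf_endsD(2,3)[OF assms(1) rr2(1,2)]
      wf_endsD(2,3)[OF assms(1) rr4(1,2)] by simp
  then show ?thesis
    unfolding H1_def
    by (intro mk_graph_minor[OF assms(1), of "[a, b, c]" _ "[r0, r1, r2, r3, r4, r5]"])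
      (use assms(2) rr0 rr2 rr4 in \<open>auto simp: doubleton_eq_iff\<close>)
qed

lemma H2_minor:
  assumes "wf_graph G" "distinct [a, b, c, d]"
    "dbl G a b" "dbl G a c" "adj G a d"
  shows "is_minor H2 G"
proof -
  obtain r0 r1 where rr0: "r0 \<in> edges G" "ends G r0 = {a, b}" "r1 \<in> edges G" "ends G r1 = {a, b}" "r0 \<noteq> r1"
    using dblE[OF assms(3)] .
  obtain r2 r3 where rr2: "r2 \<in> edges G" "ends G r2 = {a, c}" "r3 \<in> edges G" "ends G r3 = {a, c}" "r2 \<noteq> r3"
    using dblE[OF assms(4)] .
  obtain r4 where rr4: "r4 \<in> edges G" "ends G r4 = {a, d}"
    using adjE[OF assms(5)] .
  have "set [a, b, c, d] \<subseteq> verts G"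
    using wf_endsD(2,3)[OF assms(1) rr0(1,2)]
      wf_endsD(2,3)[OF assms(1) rr2(1,2)]
      wf_endsD(2,3)[OF assms(1) rr4(1,2)] by simp
  then show ?thesis
    unfolding H2_def
    by (intro mk_graph_minor[OF assms(1), of "[a, b, c, d]" _ "[r0, r1, r2, r3, r4]"])
      (use assms(2) rr0 rr2 rr4 in \<open>auto simp: doubleton_eq_iff\<close>)
qed

lemma H3_minor:
  assumes "wf_graph G" "distinct [a, b, c, d]"
    "adj G a b" "adj G b c" "adj G a c" "dbl G a d"
  shows "is_minor H3 G"
proof -
  obtain r0 where rr0: "r0 \<in> edges G" "ends G r0 = {a, b}"
    using adjE[OF assms(3)] .
  obtain r1 where rr1: "r1 \<in> edges G" "ends G r1 = {b, c}"
    using adjE[OF assms(4)] .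
  obtain r2 where rr2: "r2 \<in> edges G" "ends G r2 = {a, c}"
    using adjE[OF assms(5)] .
  obtain r3 r4 where rr3: "r3 \<in> edges G" "ends G r3 = {a, d}" "r4 \<in> edges G" "ends G r4 = {a, d}" "r3 \<noteq> r4"
    using dblE[OF assms(6)] .
  have "set [a, b, c, d] \<subseteq> verts G"
    using wf_endsD(2,3)[OF assms(1) rr0(1,2)]
      wf_endsD(2,3)[OF assms(1) rr1(1,2)]
      wf_endsD(2,3)[OF assms(1) rr2(1,2)]
      wf_endsD(2,3)[OF assms(1) rr3(1,2)] by simp
  then show ?thesis
    unfolding H3_def
    by (intro mk_graph_minor[OF assms(1), of "[a, b, c, d]" _ "[r0, r1, r2, r3, r4]"])
      (use assms(2) rr0 rr1 rr2 rr3 in \<open>auto simp: doubleton_eq_iff\<close>)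
qed

lemma H4_minor:
  assumes "wf_graph G" "distinct [a, b, c, d, e]"
    "dbl G a b" "adj G a c" "adj G a d" "adj G b e"
  shows "is_minor H4 G"
proof -
  obtain r0 r1 where rr0: "r0 \<in> edges G" "ends G r0 = {a, b}" "r1 \<in> edges G" "ends G r1 = {a, b}" "r0 \<noteq> r1"
    using dblE[OF assms(3)] .
  obtain r2 where rr2: "r2 \<in> edges G" "ends G r2 = {a, c}"
    using adjE[OF assms(4)] .
  obtain r3 where rr3: "r3 \<in> edges G" "ends G r3 = {a, d}"
    using adjE[OF assms(5)] .
  obtain r4 where rr4: "r4 \<in> edges G" "ends G r4 = {b, e}"
    using adjE[OF assms(6)] .
  have "set [a, b, c, d, e] \<subseteq> verts G"
    using wf_endsD(2,3)[OF assms(1) rr0(1,2)]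
      wf_endsD(2,3)[OF assms(1) rr2(1,2)]
      wf_endsD(2,3)[OF assms(1) rr3(1,2)]
      wf_endsD(2,3)[OF assms(1) rr4(1,2)] by simp
  then show ?thesis
    unfolding H4_def
    by (intro mk_graph_minor[OF assms(1), of "[a, b, c, d, e]" _ "[r0, r1, r2, r3, r4]"])
      (use assms(2) rr0 rr2 rr3 rr4 in \<open>auto simp: doubleton_eq_iff\<close>)
qed

lemma H5_minor:
  assumes "wf_graph G" "distinct [a, b, c, d, e]"
    "adj G a c" "adj G b c" "adj G c d" "dbl G d e"
  shows "is_minor H5 G"
proof -
  obtain r0 where rr0: "r0 \<in> edges G" "ends G r0 = {a, c}"
    using adjE[OF assms(3)] .
  obtain r1 where rr1: "r1 \<in> edges G" "ends G r1 = {b, c}"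
    using adjE[OF assms(4)] .
  obtain r2 where rr2: "r2 \<in> edges G" "ends G r2 = {c, d}"
    using adjE[OF assms(5)] .
  obtain r3 r4 where rr3: "r3 \<in> edges G" "ends G r3 = {d, e}" "r4 \<in> edges G" "ends G r4 = {d, e}" "r3 \<noteq> r4"
    using dblE[OF assms(6)] .
  have "set [a, b, c, d, e] \<subseteq> verts G"
    using wf_endsD(2,3)[OF assms(1) rr0(1,2)]
      wf_endsD(2,3)[OF assms(1) rr1(1,2)]
      wf_endsD(2,3)[OF assms(1) rr2(1,2)]
      wf_endsD(2,3)[OF assms(1) rr3(1,2)] by simp
  then show ?thesis
    unfolding H5_def
    by (intro mk_graph_minor[OF assms(1), of "[a, b, c, d, e]" _ "[r0, r1, r2, r3, r4]"])
      (use assms(2) rr0 rr1 rr2 rr3 in \<open>auto simp: doubleton_eq_iff\<close>)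
qed

lemma K14_minor:
  assumes "wf_graph G" "distinct [a, b, c, d, e]"
    "adj G a b" "adj G a c" "adj G a d" "adj G a e"
  shows "is_minor K14 G"
proof -
  obtain r0 where rr0: "r0 \<in> edges G" "ends G r0 = {a, b}"
    using adjE[OF assms(3)] .
  obtain r1 where rr1: "r1 \<in> edges G" "ends G r1 = {a, c}"
    using adjE[OF assms(4)] .
  obtain r2 where rr2: "r2 \<in> edges G" "ends G r2 = {a, d}"
    using adjE[OF assms(5)] .
  obtain r3 where rr3: "r3 \<in> edges G" "ends G r3 = {a, e}"
    using adjE[OF assms(6)] .
  have "set [a, b, c, d, e] \<subseteq> verts G"
    using wf_endsD(2,3)[OF assms(1) rr0(1,2)]
      wf_endsD(2,3)[OF assms(1) rr1(1,2)]
      wf_endsD(2,3)[OF assms(1) rr2(1,2)]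
      wf_endsD(2,3)[OF assms(1) rr3(1,2)] by simp
  then show ?thesis
    unfolding K14_def
    by (intro mk_graph_minor[OF assms(1), of "[a, b, c, d, e]" _ "[r0, r1, r2, r3]"])
      (use assms(2) rr0 rr1 rr2 rr3 in \<open>auto simp: doubleton_eq_iff\<close>)
qed

lemma long_Y_minor:
  assumes "wf_graph G" "distinct [a, b, c, d, e, f, g]"
    "adj G a b" "adj G b c" "adj G a d" "adj G d e" "adj G a f" "adj G f g"
  shows "is_minor long_Y G"
proof -
  obtain r0 where rr0: "r0 \<in> edges G" "ends G r0 = {a, b}"
    using adjE[OF assms(3)] .
  obtain r1 where rr1: "r1 \<in> edges G" "ends G r1 = {b, c}"
    using adjE[OF assms(4)] .
  obtain r2 where rr2: "r2 \<in> edges G" "ends G r2 = {a, d}"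
    using adjE[OF assms(5)] .
  obtain r3 where rr3: "r3 \<in> edges G" "ends G r3 = {d, e}"
    using adjE[OF assms(6)] .
  obtain r4 where rr4: "r4 \<in> edges G" "ends G r4 = {a, f}"
    using adjE[OF assms(7)] .
  obtain r5 where rr5: "r5 \<in> edges G" "ends G r5 = {f, g}"
    using adjE[OF assms(8)] .
  have "set [a, b, c, d, e, f, g] \<subseteq> verts G"
    using wf_endsD(2,3)[OF assms(1) rr0(1,2)]
      wf_endsD(2,3)[OF assms(1) rr1(1,2)]
      wf_endsD(2,3)[OF assms(1) rr2(1,2)]
      wf_endsD(2,3)[OF assms(1) rr3(1,2)]
      wf_endsD(2,3)[OF assms(1) rr4(1,2)]
      wf_endsD(2,3)[OF assms(1) rr5(1,2)] by simp
  then show ?thesis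
    unfolding long_Y_def
    by (intro mk_graph_minor[OF assms(1), of "[a, b, c, d, e, f, g]" _ "[r0, r1, r2, r3, r4, r5]"])
      (use assms(2) rr0 rr1 rr2 rr3 rr4 rr5 in \<open>auto simp: doubleton_eq_iff\<close>)
qed

subsection \<open>Graphs without listed minors\<close>

text \<open>Merging the first two vertices shortens a cycle by one vertex, until four
  remain.\<close>

lemma cycle_minor:
  assumes "wf_graph G" "4 \<le> length vs" "distinct vs" "successively (adj G) vs" "adj G (last vs) (hd vs)"
  shows "is_minor C4 G"
  using assms
proof (induction "length vs" arbitrary: vs G)
  case 0
  then show ?case by simp
next
  case (Suc n)
  show ?case
  proof (cases "n = 3")
    case True
    then have "length vs = 4" using Suc(2) by simp
    then obtain a b c d where "vs = [a, b, c, d]" by (auto simp: length_Suc_conv numeral_eq_Suc)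
    then show ?thesis using Suc.prems C4_minor[of G a b c d] by simp
  next
    case False
    obtain y x us where vs: "vs = y # x # us" and us: "us \<noteq> []"
      using Suc.prems(2) by (cases vs; cases "tl vs"; cases "tl (tl vs)") auto
    let ?G = "merge G x y"
    have yx: "adj G x y" using Suc.prems(4) vs adj_sym by simp
    have "successively (adj G) (x # us)" using Suc.prems(4) vs by simp
    then have "successively (adj ?G) (x # us)"
    proof (rule successively_mono)
      fix a b assume "a \<in> set (x # us)" "b \<in> set (x # us)" "adj G a b"
      then show "adj ?G a b" using Suc.prems(3) vs by (intro adj_merge) auto
    qed
    moreover have "adj ?G (last us) x"
    proof (rule adj_merge_new)
      show "adj G (last us) y" using Suc.prems(5) vs us by simp
      show "last us \<noteq> x" "last us \<noteq> y" using Suc.prems(3) vs us last_in_set[OF us] by auto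
    qed
    ultimately have "is_minor C4 ?G"
      using Suc(1)[of "x # us" ?G] Suc(2) Suc.prems(1,2,3) vs us False wf_merge[OF Suc.prems(1) yx] by simp
    then show ?thesis using minor_merge[OF Suc.prems(1) yx] by blast
  qed
qed

text \<open>The last hypothesis states acyclicity as the absence of subsets of minimum degree 2, a
  form inherited by subsets. By induction a leaf is removed, the rest is laid out, and the leaf is
  inserted on the free side of its neighbour.\<close>

lemma linear_forest_positions:
  fixes R :: "nat \<Rightarrow> nat \<Rightarrow> bool"
  assumes "finite V" and sym: "\<And>x y. R x y \<Longrightarrow> R y x" and irr: "\<And>x. \<not> R x x"
    and deg: "\<And>v x y z. v \<in> V \<Longrightarrow> {x, y, z} \<subseteq> V \<Longrightarrow> R v x \<Longrightarrow> R v y \<Longrightarrow> R v z \<Longrightarrow> \<not> distinct [x, y, z]"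
    and leaf: "\<And>U. U \<subseteq> V \<Longrightarrow> U \<noteq> {} \<Longrightarrow> \<exists>v\<in>U. \<forall>x\<in>U. \<forall>y\<in>U. R v x \<longrightarrow> R v y \<longrightarrow> x = y"
  shows "\<exists>p :: nat \<Rightarrow> nat. inj_on p V \<and>
    (\<forall>x\<in>V. \<forall>y\<in>V. R x y \<longrightarrow> p y = Suc (p x) \<or> p x = Suc (p y))"
  using assms(1) deg leaf
proof (induction "card V" arbitrary: V)
  case 0
  then show ?case by simp
next
  case (Suc n)
  then have "V \<noteq> {}" by auto
  then obtain v where v: "v \<in> V" "\<And>x y. x \<in> V \<Longrightarrow> y \<in> V \<Longrightarrow> R v x \<Longrightarrow> R v y \<Longrightarrow> x = y"
    using Suc.prems(3)[of V] by blast
  let ?V = "V - {v}"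
  have "\<exists>p :: nat \<Rightarrow> nat. inj_on p ?V \<and> (\<forall>x\<in>?V. \<forall>y\<in>?V. R x y \<longrightarrow> p y = Suc (p x) \<or> p x = Suc (p y))"
  proof (rule Suc(1))
    show "n = card ?V" using Suc(2) v(1) Suc.prems(1) by simp
    show "finite ?V" using Suc.prems(1) by simp
    show "\<not> distinct [x, y, z]" if "u \<in> ?V" "{x, y, z} \<subseteq> ?V" "R u x" "R u y" "R u z" for u x y z
      using Suc.prems(2)[of u x y z] that by blast
    show "\<exists>v\<in>U. \<forall>x\<in>U. \<forall>y\<in>U. R v x \<longrightarrow> R v y \<longrightarrow> x = y" if "U \<subseteq> ?V" "U \<noteq> {}" for U
      using Suc.prems(3)[of U] that by blast
  qed
  then obtain p :: "nat \<Rightarrow> nat" where p: "inj_on p ?V"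
    "\<And>x y. x \<in> ?V \<Longrightarrow> y \<in> ?V \<Longrightarrow> R x y \<Longrightarrow> p y = Suc (p x) \<or> p x = Suc (p y)" by blast
  have pinj: "x = y" if "x \<in> ?V" "y \<in> ?V" "p x = p y" for x y
    using inj_onD[OF p(1) that(3) that(1,2)] .
  show ?case
  proof (cases "\<exists>u\<in>V. R v u")
    case False
    \<comment> \<open>An isolated vertex goes beyond all others; the sum is an upper bound for every
      position.\<close>
    let ?p = "p(v := Suc (\<Sum>x\<in>V. p x))"
    have "p x \<le> (\<Sum>x\<in>V. p x)" if "x \<in> V" for x
      using Suc.prems(1) that by (simp add: member_le_sum)
    then have pv: "?p x \<noteq> ?p v" if "x \<in> ?V" for x using that by fastforce
    have "inj_on ?p V"
    proof (rule inj_onI)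
      fix x y assume xy: "x \<in> V" "y \<in> V" "?p x = ?p y"
      show "x = y"
      proof (cases "x = v \<or> y = v")
        case True
        then show ?thesis using pv[of x] pv[of y] xy by (cases "x = v"; cases "y = v") simp_all
      next
        case False
        then show ?thesis using pinj[of x y] xy by simp
      qed
    qed
    moreover have "?p y = Suc (?p x) \<or> ?p x = Suc (?p y)" if "x \<in> V" "y \<in> V" "R x y" for x y
    proof -
      have "x \<noteq> v" "y \<noteq> v" using False that sym by blast+
      then show ?thesis using p(2)[of x y] that by simp
    qed
    ultimately show ?thesis by blast
  next
    case True
    then obtain u where u: "u \<in> ?V" "R v u" using irr by blast
    \<comment> \<open>The degree bound allows \<open>u\<close> two neighbours, and \<open>v\<close>
      is one of them.\<close>
    have other: "x = y" if "x \<in> ?V" "y \<in> ?V" "R u x" "R u y" for x y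
    proof -
      have "\<not> distinct [v, x, y]"
        using Suc.prems(2)[of u v x y] u that v(1) sym by blast
      then show ?thesis using that by auto
    qed
    \<comment> \<open>If the other neighbour of \<open>u\<close> is above \<open>u\<close>, then
      \<open>v\<close> takes the position of \<open>u\<close>, which moves up together with
      everything above; otherwise \<open>v\<close> goes directly above \<open>u\<close>.\<close>
    define q where "q = (if \<exists>t\<in>?V. R u t \<and> p t = Suc (p u) then p u else Suc (p u))"
    let ?p = "\<lambda>x. if x = v then q else if p x < q then p x else Suc (p x)"
    have ne: "?p x \<noteq> q" if "x \<in> ?V" for x using that by auto
    have inj: "inj_on ?p V"
    proof (rule inj_onI)
      fix x y assume xy: "x \<in> V" "y \<in> V" "?p x = ?p y"
      show "x = y"
      proof (cases "x = v \<or> y = v")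
        case True
        then show ?thesis using ne[of x] ne[of y] xy by (cases "x = v"; cases "y = v") simp_all
      next
        case False
        then have "p x = p y" using xy(3) by (auto split: if_splits)
        then show ?thesis using pinj xy False by blast
      qed
    qed
    have uq: "?p u = Suc q \<or> q = Suc (?p u)"
      using u by (auto simp: q_def)
    have gap: "?p y = Suc (?p x)" if xy: "x \<in> ?V" "y \<in> ?V" "R x y" "p y = Suc (p x)" for x y
    proof -
      \<comment> \<open>The shift could tear apart only an edge between \<open>q - 1\<close> and
        \<open>q\<close>. By the choice of \<open>q\<close> this is a side of \<open>u\<close> on
        which \<open>u\<close> has no neighbour.\<close>
      have "\<not> (p x < q \<and> \<not> p y < q)"
      proof
        assume "p x < q \<and> \<not> p y < q"
        then have q: "p y = q" "q = Suc (p x)" using xy(4) by auto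
        show False
        proof (cases "\<exists>t\<in>?V. R u t \<and> p t = Suc (p u)")
          case True
          then obtain t where t: "t \<in> ?V" "R u t" "p t = Suc (p u)" by blast
          have "q = p u" using True by (simp add: q_def)
          then have "y = u" using pinj[of y u] q u xy by simp
          then have "x = t" using other[of x t] xy t sym by blast
          then show False using t q \<open>q = p u\<close> by simp
        next
          case False
          then have "q = Suc (p u)" by (simp add: q_def)
          then have "x = u" using pinj[of x u] q u xy by simp
          then show False using False xy by blast
        qed
      qed
      then show ?thesis using xy by auto
    qed
    have "?p y = Suc (?p x) \<or> ?p x = Suc (?p y)" if xy: "x \<in> V" "y \<in> V" "R x y" for x y
    proof (cases "x = v \<or> y = v")
      case True
      then have "x = v \<and> y = u \<or> x = u \<and> y = v"
        using v(2) u xy sym irr by blast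
      then show ?thesis using uq by auto
    next
      case False
      then have V: "x \<in> ?V" "y \<in> ?V" using xy by auto
      have "p y = Suc (p x) \<or> p x = Suc (p y)" using p(2) V xy by blast
      then show ?thesis using gap[OF V xy(3)] gap[OF V(2,1) sym[OF xy(3)]] by blast
    qed
    then show ?thesis using inj by blast
  qed
qed

section \<open>Local structure of graphs without listed minors\<close>

locale obstruction_free =
  fixes G
  assumes wf: "wf_graph G"
    and free: "\<not> is_minor C2_C2 G" "\<not> is_minor C2_K13 G" "\<not> is_minor K13_K13 G" "\<not> is_minor C4 G"
      "\<not> is_minor H1 G" "\<not> is_minor H2 G" "\<not> is_minor H3 G" "\<not> is_minor H4 G" "\<not> is_minor H5 G"
      "\<not> is_minor K14 G" "\<not> is_minor long_Y G"
begin

abbreviation A where "A \<equiv> adj G"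
abbreviation D where "D \<equiv> dbl G"

lemma A_sym: "A x y \<Longrightarrow> A y x" by (rule adj_sym)
lemma A_irrefl: "\<not> A x x" using adjD[OF wf] by blast
lemma D_A: "D x y \<Longrightarrow> A x y" by (rule dbl_adj)
lemma D_sym: "D x y \<Longrightarrow> D y x" by (rule dbl_sym)

lemmas no_C2_C2 = notE[OF free(1) C2_C2_minor[OF wf]]
lemmas no_C2_K13 = notE[OF free(2) C2_K13_minor[OF wf]]
lemmas no_K13_K13 = notE[OF free(3) K13_K13_minor[OF wf]]
lemmas no_C4 = notE[OF free(4) C4_minor[OF wf]]
lemmas no_H1 = notE[OF free(5) H1_minor[OF wf]]
lemmas no_H2 = notE[OF free(6) H2_minor[OF wf]]
lemmas no_H3 = notE[OF free(7) H3_minor[OF wf]]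
lemmas no_H4 = notE[OF free(8) H4_minor[OF wf]]
lemmas no_H5 = notE[OF free(9) H5_minor[OF wf]]
lemmas no_K14 = notE[OF free(10) K14_minor[OF wf]]
lemmas no_long_Y = notE[OF free(11) long_Y_minor[OF wf]]

text \<open>In this and the following exclusions one or two edges are merged, either to turn a
  triangle into a double edge or to unite two branching vertices in one of degree four.\<close>

lemma no_dbl_triangle:
  assumes "distinct [a, b, c, d, e]" "D a b" "A c d" "A d e" "A c e"
  shows False
proof -
  have "is_minor C2_C2 (merge G d e)"
    by (rule C2_C2_minor[of _ a b c d])
      (use assms wf_merge[OF wf assms(4)] dbl_merge dbl_merge_new in auto)
  then show False using free minor_merge[OF wf assms(4)] by blast
qed

lemma no_triangle_claw:
  assumes "distinct [a, b, c, d, x, y, z]" "A a b" "A b c" "A a c" "A d x" "A d y" "A d z"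
  shows False
proof -
  have "is_minor C2_K13 (merge G b c)"
    by (rule C2_K13_minor[of _ a b d x y z])
      (use assms wf_merge[OF wf assms(3)] adj_merge dbl_merge_new in auto)
  then show False using free minor_merge[OF wf assms(3)] by blast
qed

lemma no_triangle_triangle:
  assumes "distinct [a, b, c, d, e, f]" "A a b" "A b c" "A a c" "A d e" "A e f" "A d f"
  shows False
proof -
  let ?G = "merge G b c"
  have wf': "wf_graph ?G" using wf_merge[OF wf assms(3)] .
  have ef: "adj ?G e f" using assms adj_merge by auto
  have "is_minor C2_C2 (merge ?G e f)"
  proof (rule C2_C2_minor[of _ a b d e])
    show "wf_graph (merge ?G e f)" using wf_merge[OF wf' ef] .
    have "dbl ?G a b" using assms dbl_merge_new by auto
    then show "dbl (merge ?G e f) a b" by (rule dbl_merge) (use assms(1) in auto)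
    have "adj ?G d e" "adj ?G d f" using assms adj_merge by auto
    then show "dbl (merge ?G e f) d e" by (rule dbl_merge_new) (use assms(1) in auto)
  qed (use assms(1) in auto)
  then show False using free minor_merge[OF wf' ef] minor_merge[OF wf assms(3)] by blast
qed

lemma no_bowtie:
  assumes "distinct [x, a, b, c, d]" "A x a" "A a b" "A x b" "A x c" "A c d" "A x d"
  shows False
proof -
  have "is_minor H3 (merge G c d)"
    by (rule H3_minor[of _ x a b c])
      (use assms wf_merge[OF wf assms(6)] adj_merge dbl_merge_new in auto)
  then show False using free minor_merge[OF wf assms(6)] by blast
qed

lemma no_3_sun:
  assumes "distinct [a, b, c, a', b', c']" "A a b" "A b c" "A a c" "A a a'" "A b b'" "A c c'"
  shows False
proof -
  have "is_minor H4 (merge G a b)"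
  proof (rule H4_minor[of _ a c a' b' c'])
    show "adj (merge G a b) a b'" using assms adj_merge_new[of G b' b a] adj_commute by auto
    show "dbl (merge G a b) a c" using assms dbl_merge_new[of G c a b] adj_commute dbl_commute by auto
  qed (use assms wf_merge[OF wf assms(2)] adj_merge in auto)
  then show False using free minor_merge[OF wf assms(2)] by blast
qed

lemma no_claw_triangle:
  assumes "distinct [c, u, v, d, a, b]" "A c u" "A c v" "A c d" "A d a" "A a b" "A d b"
  shows False
proof -
  have "is_minor H5 (merge G a b)"
    by (rule H5_minor[of _ u v c d a])
      (use assms wf_merge[OF wf assms(6)] adj_merge dbl_merge_new adj_commute in auto)
  then show False using free minor_merge[OF wf assms(6)] by blast
qed

lemma no_adjacent_branching:
  assumes "distinct [c, d, x, y, s, t]" "A c d" "A c x" "A c y" "A d s" "A d t"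
  shows False
proof -
  have "is_minor K14 (merge G c d)"
  proof (rule K14_minor[of _ c x y s t])
    show "adj (merge G c d) c s" "adj (merge G c d) c t"
      using assms adj_merge_new[of G s d c] adj_merge_new[of G t d c] adj_commute by auto
  qed (use assms wf_merge[OF wf assms(2)] adj_merge in auto)
  then show False using free minor_merge[OF wf assms(2)] by blast
qed

lemma no_branching_at_distance_2:
  assumes "distinct [c, l, d, x, y, s, t]" "A c l" "A l d" "A c x" "A c y" "A d s" "A d t"
  shows False
proof -
  let ?G = "merge G c l"
  have wf': "wf_graph ?G" using wf_merge[OF wf assms(2)] .
  have cd: "adj ?G c d" using assms adj_merge_new[of G d l c] adj_commute by auto
  have "adj ?G c x" "adj ?G c y" "adj ?G d s" "adj ?G d t" using assms adj_merge by auto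
  then have "adj (merge ?G c d) c x" "adj (merge ?G c d) c y"
    "adj (merge ?G c d) c s" "adj (merge ?G c d) c t"
    using assms(1) adj_merge[of ?G c x d c] adj_merge[of ?G c y d c]
      adj_merge_new[of ?G s d c] adj_merge_new[of ?G t d c] adj_commute by auto
  then have "is_minor K14 (merge ?G c d)"
    by (intro K14_minor[of _ c x y s t] wf_merge[OF wf' cd]) (use assms(1) in auto)
  then show False using free minor_merge[OF wf' cd] minor_merge[OF wf assms(2)] by blast
qed

text \<open>A longest path in \<open>U\<close> closes up to a cycle at its first vertex.\<close>

lemma triangle_if_min_degree_2:
  assumes U: "finite U" "U \<noteq> {}" and deg: "\<And>x. x \<in> U \<Longrightarrow> \<exists>a\<in>U. \<exists>b\<in>U. a \<noteq> b \<and> A x a \<and> A x b"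
  shows "\<exists>a\<in>U. \<exists>b\<in>U. \<exists>c\<in>U. A a b \<and> A b c \<and> A a c"
proof -
  let ?P = "\<lambda>vs. vs \<noteq> [] \<and> distinct vs \<and> set vs \<subseteq> U \<and> successively A vs"
  obtain u where u: "u \<in> U" using U by blast
  have "?P [u]" using u by simp
  moreover have "length vs \<le> card U" if "?P vs" for vs
    using that U(1) by (metis card_mono distinct_card)
  ultimately obtain vs where vs: "?P vs" and max: "\<And>us. ?P us \<Longrightarrow> length us \<le> length vs"
    using ex_has_greatest_nat[of ?P "[u]" length "Suc (card U)"] by (metis le_imp_less_Suc)
  obtain v tl where vt: "vs = v # tl" using vs by (cases vs) auto
  obtain a b where ab: "a \<in> U" "b \<in> U" "a \<noteq> b" "A v a" "A v b" using deg[of v] vs vt by auto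
  \<comment> \<open>A neighbour off the path could be put in front of it, against
    maximality.\<close>
  have on: "x \<in> set tl" if "x \<in> U" "A v x" for x
  proof (rule ccontr)
    assume "x \<notin> set tl"
    then have "?P (x # vs)" using vs vt that A_irrefl A_sym by auto
    then show False using max[of "x # vs"] by simp
  qed
  have "a \<in> set tl" "b \<in> set tl" using on ab by blast+
  then obtain t us where tl: "tl = t # us" by (cases tl) auto
  \<comment> \<open>Two distinct neighbours cannot both be the second vertex \<open>t\<close>. The
    initial segment up to \<open>c\<close> closes to a triangle if \<open>c\<close> follows
    \<open>t\<close> directly, and otherwise to a cycle on at least four vertices.\<close>
  obtain c where c: "c \<in> set us" "c \<in> U" "A v c"
    using \<open>a \<in> set tl\<close> \<open>b \<in> set tl\<close> ab tl by auto
  obtain us1 us2 where us: "us = us1 @ c # us2" using split_list[OF c(1)] by blast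
  have cyc: "distinct (v # t # us1 @ [c])" "successively A (v # t # us1 @ [c])"
    using vs vt tl us by (auto simp: successively_append_iff successively_Cons hd_append split: if_splits)
  show ?thesis
  proof (cases us1)
    case Nil
    then have "A v t" "A t c" "t \<in> U" "v \<in> U" using cyc vs vt tl by auto
    then show ?thesis using c A_sym by blast
  next
    case Cons
    then have "is_minor C4 G"
      using cycle_minor[OF wf, of "v # t # us1 @ [c]"] cyc c(3) A_sym by simp
    then show ?thesis using free by blast
  qed
qed


text \<open>Longer cycles are already excluded, so this makes \<open>G - w\<close> a linear forest
  without parallel edges. It does not control where the neighbours of \<open>w\<close> lie in that
  forest.\<close>

definition clean :: "nat \<Rightarrow> bool" where
  "clean w \<longleftrightarrow> (\<forall>x y. D x y \<longrightarrow> w = x \<or> w = y) \<and>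
     (\<forall>a b c. A a b \<longrightarrow> A b c \<longrightarrow> A a c \<longrightarrow> w \<in> {a, b, c}) \<and>
     (\<forall>c x y z. A c x \<longrightarrow> A c y \<longrightarrow> A c z \<longrightarrow> distinct [x, y, z] \<longrightarrow> w \<in> {c, x, y, z})"

lemma cleanI:
  assumes "\<And>x y. D x y \<Longrightarrow> w \<noteq> x \<Longrightarrow> w \<noteq> y \<Longrightarrow> False"
    and "\<And>a b c. A a b \<Longrightarrow> A b c \<Longrightarrow> A a c \<Longrightarrow> w \<notin> {a, b, c} \<Longrightarrow> False"
    and "\<And>c x y z. A c x \<Longrightarrow> A c y \<Longrightarrow> A c z \<Longrightarrow> distinct [x, y, z] \<Longrightarrow> w \<notin> {c, x, y, z} \<Longrightarrow> False"
  shows "clean w"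
  unfolding clean_def using assms by blast

lemma cleanD:
  assumes "clean w"
  shows "D x y \<Longrightarrow> w = x \<or> w = y"
    and "A a b \<Longrightarrow> A b c \<Longrightarrow> A a c \<Longrightarrow> w \<in> {a, b, c}"
    and "A c x \<Longrightarrow> A c y \<Longrightarrow> A c z \<Longrightarrow> distinct [x, y, z] \<Longrightarrow> w \<in> {c, x, y, z}"
  using assms unfolding clean_def by blast+

lemma A_ne: "A x y \<Longrightarrow> x \<noteq> y" using A_irrefl by blast

text \<open>With \<open>triangle_vertex\<close> below, this replaces threefold case distinctions by
  symmetry: a leaf is singled out and the other two are named.\<close>

lemma claw_leaf:
  assumes "A c x" "A c y" "A c z" "distinct [x, y, z]" "l \<in> {x, y, z}"
  obtains p q where "A c l" "A c p" "A c q" "distinct [l, p, q]" "p \<in> {x, y, z}" "q \<in> {x, y, z}"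
    "\<forall>s\<in>{x, y, z}. s = l \<or> s = p \<or> s = q"
proof -
  consider "l = x" | "l = y" | "l = z" using assms(5) by auto
  then show thesis
  proof cases
    case 1 then show thesis using that[of y z] assms by auto
  next
    case 2 then show thesis using that[of x z] assms by auto
  next
    case 3 then show thesis using that[of x y] assms by auto
  qed
qed

lemma triangle_vertex:
  assumes "A a b" "A b c" "A a c" "v \<in> {a, b, c}"
  obtains p q where "A v p" "A v q" "A p q" "p \<in> {a, b, c}" "q \<in> {a, b, c}"
    "\<forall>s\<in>{a, b, c}. s = v \<or> s = p \<or> s = q"
proof -
  consider "v = a" | "v = b" | "v = c" using assms(4) by auto
  then show thesis
  proof cases
    case 1 then show thesis using that[of b c] assms by auto
  next
    case 2 then show thesis using that[of a c] assms A_sym by auto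
  next
    case 3 then show thesis using that[of a b] assms A_sym by auto
  qed
qed

lemma meets_pair:
  assumes "{b, c} \<inter> S \<noteq> {}"
  obtains v u where "v \<in> S" "v = b \<and> u = c \<or> v = c \<and> u = b"
  using assms by blast

text \<open>Whatever avoids \<open>x\<close> has to meet both double edges, hence contains
  \<open>y\<close> and \<open>z\<close>. A double edge then completes \<open>H1\<close>; a triangle
  gives \<open>C4\<close>; a claw gives \<open>H4\<close> if \<open>y\<close> or \<open>z\<close> is
  its centre, and \<open>C4\<close> if both are leaves.\<close>

lemma clean_two_doubles:
  assumes y: "D x y" "D x z" "y \<noteq> z"
  shows "clean x"
proof (rule cleanI)
  note Axy = D_A[OF y(1)] and Axz = D_A[OF y(2)]
  note ne = A_ne[OF Axy] A_ne[OF Axz] y(3)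
  show False if d: "D u v" "x \<noteq> u" "x \<noteq> v" for u v
  proof -
    have uv: "u \<noteq> v" using A_ne[OF D_A[OF d(1)]] .
    have "u = y \<or> v = y" using no_C2_C2[of x y u v] y(1) d ne uv by auto
    moreover have "u = z \<or> v = z" using no_C2_C2[of x z u v] y(2) d ne uv by auto
    ultimately have "D y z" using d(1) y(3) D_sym by auto
    then show False using no_H1[of x y z] y ne by auto
  qed
  show False if t: "A a b" "A b c" "A a c" "x \<notin> {a, b, c}" for a b c
  proof -
    have d: "distinct [a, b, c]" using A_ne t by auto
    have "y \<in> {a, b, c}" using no_dbl_triangle[of x y a b c] y(1) t d ne by auto
    then obtain p q where p: "A y p" "A y q" "A p q" "p \<in> {a, b, c}" "q \<in> {a, b, c}"
      "\<forall>s\<in>{a, b, c}. s = y \<or> s = p \<or> s = q"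
      by (rule triangle_vertex[OF t(1-3)])
    have "z \<in> {a, b, c}" using no_dbl_triangle[of x z a b c] y(2) t d ne by auto
    then have "z = p \<or> z = q" using bspec[OF p(6)] y(3) by metis
    then obtain s where s: "A y s" "A s z" "s \<in> {a, b, c}" using p(1-5) A_sym by blast
    then show False
      using no_C4[of x y s z] Axy Axz A_sym ne A_ne[OF s(1)] A_ne[OF s(2)] t(4) by auto
  qed
  show False if c: "A c r" "A c s" "A c t" "distinct [r, s, t]" "x \<notin> {c, r, s, t}" for c r s t
  proof -
    have nc: "c \<noteq> r" "c \<noteq> s" "c \<noteq> t" using c A_ne by auto
    have hit: "u \<in> {c, r, s, t}" if "D x u" for u
      using no_C2_K13[of x u c r s t] that c nc A_ne[OF D_A[OF that]] by auto
    \<comment> \<open>The claw has its centre at one end of a double edge \<open>ux\<close>, while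
      its leaf \<open>v\<close> is also adjacent to \<open>x\<close>: taking \<open>v\<close> as the
      pendant of \<open>x\<close> gives \<open>H4\<close>.\<close>
    have centre: False if cu: "D x u" "D x v" "u \<noteq> v" "c = u" for u v
    proof -
      have "v \<in> {r, s, t}" using hit[OF cu(2)] cu by auto
      then obtain p q where p: "A c v" "A c p" "A c q" "distinct [v, p, q]"
        "p \<in> {r, s, t}" "q \<in> {r, s, t}" "\<forall>i\<in>{r, s, t}. i = v \<or> i = p \<or> i = q"
        by (rule claw_leaf[OF c(1-4)])
      have "x \<noteq> p" "x \<noteq> q" "x \<noteq> v" "c \<noteq> x" using p(5,6) c(5) \<open>v \<in> {r, s, t}\<close> by blast+
      then have "distinct [c, x, p, q, v]" using p(4) A_ne[OF p(1)] A_ne[OF p(2)] A_ne[OF p(3)] by auto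
      moreover have "D c x" "A x v" using D_sym[OF cu(1)] D_A[OF cu(2)] cu(4) by auto
      ultimately show False using no_H4[of c x p q v] p(2,3) by blast
    qed
    show False
    proof (cases "c = y \<or> c = z")
      case True
      then show False using centre[of y z] centre[of z y] y by auto
    next
      case False
      then have "A c y" "A c z" using hit[OF y(1)] hit[OF y(2)] c by auto
      then show False
        using no_C4[of x y c z] Axy Axz A_sym ne False c(5) by auto
    qed
  qed
qed

text \<open>Whatever avoids \<open>x\<close> has to contain \<open>y\<close>. A second double edge
  there is ruled out by \<open>only\<close>; a triangle gives \<open>H3\<close>; a claw centred at
  \<open>y\<close> gains \<open>x\<close> as fourth leaf, and one with leaf \<open>y\<close> gives
  \<open>H5\<close>.\<close>

lemma clean_one_double:
  assumes y: "D x y" and only: "\<And>u v. D x u \<Longrightarrow> D x v \<Longrightarrow> u = v" "\<And>u v. D y u \<Longrightarrow> D y v \<Longrightarrow> u = v"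
  shows "clean x"
proof (rule cleanI)
  note Axy = D_A[OF y]
  note ne = A_ne[OF Axy]
  show False if d: "D u v" "x \<noteq> u" "x \<noteq> v" for u v
  proof -
    have uv: "u \<noteq> v" using A_ne[OF D_A[OF d(1)]] .
    have "u = y \<or> v = y" using no_C2_C2[of x y u v] y d ne uv by auto
    then show False using only(2) d y D_sym by blast
  qed
  show False if t: "A a b" "A b c" "A a c" "x \<notin> {a, b, c}" for a b c
  proof -
    have d: "distinct [a, b, c]" using A_ne t by auto
    have "y \<in> {a, b, c}" using no_dbl_triangle[of x y a b c] y t d ne by auto
    then obtain p q where p: "A y p" "A y q" "A p q" "p \<in> {a, b, c}" "q \<in> {a, b, c}"
      "\<forall>s\<in>{a, b, c}. s = y \<or> s = p \<or> s = q"
      by (rule triangle_vertex[OF t(1-3)])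
    have "x \<noteq> p" "x \<noteq> q" using p(4,5) t(4) by blast+
    then have "distinct [y, p, q, x]" using A_ne[OF p(1)] A_ne[OF p(2)] A_ne[OF p(3)] ne by auto
    then show False using no_H3[of y p q x] p(1-3) D_sym[OF y] by blast
  qed
  show False if c: "A c r" "A c s" "A c t" "distinct [r, s, t]" "x \<notin> {c, r, s, t}" for c r s t
  proof -
    have nc: "c \<noteq> r" "c \<noteq> s" "c \<noteq> t" using c A_ne by auto
    have hit: "y \<in> {c, r, s, t}" using no_C2_K13[of x y c r s t] y c nc ne by auto
    show False
    proof (cases "c = y")
      case True
      then show False using no_K14[of c r s t x] c nc A_sym[OF Axy] ne by auto
    next
      case False
      then have "y \<in> {r, s, t}" using hit by auto
      then obtain p q where p: "A c y" "A c p" "A c q" "distinct [y, p, q]"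
        "p \<in> {r, s, t}" "q \<in> {r, s, t}" "\<forall>i\<in>{r, s, t}. i = y \<or> i = p \<or> i = q"
        by (rule claw_leaf[OF c(1-4)])
      have "x \<noteq> p" "x \<noteq> q" "x \<noteq> c" using p(5,6) c(5) by blast+
      then have "distinct [p, q, c, y, x]"
        using p(4) A_ne[OF p(1)] A_ne[OF p(2)] A_ne[OF p(3)] ne by auto
      then show False using no_H5[of p q c y x] p(1-3) A_sym D_sym[OF y] by blast
    qed
  qed
qed

text \<open>Whatever avoids \<open>a\<close> meets the opposite side \<open>bc\<close>. A second
  triangle shares both \<open>b\<close> and \<open>c\<close>, giving \<open>C4\<close>, or one of
  them, giving a bowtie. A claw can touch the side only in leaves: two leaves give
  \<open>C4\<close>, one gives \<open>H5\<close> after a merge.\<close>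

lemma clean_triangle:
  assumes D: "\<And>u v. \<not> D u v" and t: "A a b" "A b c" "A a c"
  shows "clean a"
proof (rule cleanI)
  have d: "distinct [a, b, c]" using A_ne t by auto
  show False if "D u v" for u v using D that by blast
  show False if t': "A p q" "A q r" "A p r" "a \<notin> {p, q, r}" for p q r
  proof -
    have d': "distinct [p, q, r]" using A_ne t' by auto
    have "{b, c} \<inter> {p, q, r} \<noteq> {}"
      using no_triangle_triangle[of a b c p q r] t t' d d' by auto
    then obtain v u where v: "v \<in> {p, q, r}" "v = b \<and> u = c \<or> v = c \<and> u = b"
      by (rule meets_pair)
    have vu: "A a v" "A a u" "A v u" "v \<noteq> u" "v \<noteq> a" "u \<noteq> a"
      using v(2) t d A_sym by auto
    obtain x y where xy: "A v x" "A v y" "A x y" "x \<in> {p, q, r}" "y \<in> {p, q, r}"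
      "\<forall>s\<in>{p, q, r}. s = v \<or> s = x \<or> s = y"
      by (rule triangle_vertex[OF t'(1-3) v(1)])
    have "a \<noteq> x" "a \<noteq> y" using xy(4,5) t'(4) by blast+
    then have dx: "distinct [v, x, y]" "a \<notin> {v, x, y}"
      using A_ne[OF xy(1)] A_ne[OF xy(2)] A_ne[OF xy(3)] vu(5) by auto
    show False
    proof (cases "u \<in> {x, y}")
      case True
      then obtain s where "A v s" "A s u" "s \<noteq> v" "s \<noteq> u" "s \<noteq> a"
        using xy(1-3) dx A_sym by auto
      then show False using no_C4[of a v s u] vu A_sym by auto
    next
      case False
      then show False using no_bowtie[of v a u x y] vu xy(1-3) dx A_sym by auto
    qed
  qed
  show False if c': "A e r" "A e s" "A e t" "distinct [r, s, t]" "a \<notin> {e, r, s, t}" for e r s t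
  proof -
    have nc: "e \<noteq> r" "e \<noteq> s" "e \<noteq> t" using c' A_ne by auto
    have "{b, c} \<inter> {e, r, s, t} \<noteq> {}"
      using no_triangle_claw[of a b c e r s t] t c' d nc by auto
    then obtain v u where v: "v \<in> {e, r, s, t}" "v = b \<and> u = c \<or> v = c \<and> u = b"
      by (rule meets_pair)
    have vu: "A a v" "A a u" "A v u" "v \<noteq> u" "v \<noteq> a" "u \<noteq> a"
      using v(2) t d A_sym by auto
    \<comment> \<open>A claw centred at a neighbour of \<open>a\<close> would have \<open>a\<close>
      as its fourth leaf.\<close>
    have centre: "e \<noteq> x" if "A a x" for x
      using no_K14[of e r s t a] c' nc A_sym[OF that] by auto
    then have "v \<noteq> e" "u \<noteq> e" using vu by auto
    then have "v \<in> {r, s, t}" using v(1) by auto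
    then obtain p q where p: "A e v" "A e p" "A e q" "distinct [v, p, q]"
      "p \<in> {r, s, t}" "q \<in> {r, s, t}" "\<forall>i\<in>{r, s, t}. i = v \<or> i = p \<or> i = q"
      by (rule claw_leaf[OF c'(1-4)])
    have ae: "a \<noteq> p" "a \<noteq> q" "a \<noteq> e" using p(5,6) c'(5) by blast+
    show False
    proof (cases "u \<in> {p, q}")
      case True
      then have "A e u" using p(2,3) by auto
      then show False using no_C4[of a v e u] vu p(1) A_sym \<open>v \<noteq> e\<close> \<open>u \<noteq> e\<close> c'(5) by auto
    next
      case False
      have "distinct [e, p, q, v, a, u]"
        using False p(4) ae vu A_ne[OF p(1)] A_ne[OF p(2)] A_ne[OF p(3)] \<open>u \<noteq> e\<close> by auto
      then show False using no_claw_triangle[of e p q v a u] p(1-3) vu A_sym by blast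
    qed
  qed
qed

text \<open>Two claws whose centres avoid each other must share a leaf \<open>l\<close>, by
  \<open>K13_K13\<close>. Their other leaves are distinct, and merging the path through
  \<open>l\<close> joins the centres to the centre of a \<open>K14\<close>.\<close>

lemma clean_claw:
  assumes D: "\<And>u v. \<not> D u v" and T: "\<And>a b c. A a b \<Longrightarrow> A b c \<Longrightarrow> \<not> A a c"
    and c: "A c x" "A c y" "A c z" "distinct [x, y, z]"
  shows "clean c"
proof (rule cleanI)
  show False if "D u v" for u v using D that by blast
  show False if "A a b" "A b d" "A a d" for a b d using T that by blast
  show False if d: "A d r" "A d s" "A d t" "distinct [r, s, t]" "c \<notin> {d, r, s, t}" for d r s t
  proof -
    have nd: "d \<noteq> r" "d \<noteq> s" "d \<noteq> t" "c \<noteq> x" "c \<noteq> y" "c \<noteq> z" using c d A_ne by auto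
    have ndc: "\<not> A d c"
    proof
      assume "A d c"
      then show False using no_K14[of d r s t c] d nd by auto
    qed
    then have dx: "d \<notin> {x, y, z}" using c A_sym by auto
    have "{x, y, z} \<inter> {r, s, t} \<noteq> {}"
      using no_K13_K13[of c x y z d r s t] c d nd dx by auto
    then obtain l where l: "l \<in> {x, y, z}" "l \<in> {r, s, t}" by blast
    obtain p q where p: "A c l" "A c p" "A c q" "distinct [l, p, q]"
      "p \<in> {x, y, z}" "q \<in> {x, y, z}" "\<forall>i\<in>{x, y, z}. i = l \<or> i = p \<or> i = q"
      by (rule claw_leaf[OF c l(1)])
    obtain u v where u: "A d l" "A d u" "A d v" "distinct [l, u, v]"
      "u \<in> {r, s, t}" "v \<in> {r, s, t}" "\<forall>i\<in>{r, s, t}. i = l \<or> i = u \<or> i = v"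
      by (rule claw_leaf[OF d(1-4) l(2)])
    have "c \<noteq> u" "c \<noteq> v" "c \<noteq> d" "d \<noteq> p" "d \<noteq> q" using p(5,6) u(5,6) d(5) dx by blast+
    then have ne: "c \<notin> {l, p, q, u, v, d}" "d \<notin> {l, p, q, u, v}"
      using A_ne[OF p(1)] A_ne[OF p(2)] A_ne[OF p(3)] A_ne[OF u(1)] A_ne[OF u(2)] A_ne[OF u(3)] by auto
    have apart: "i \<noteq> j" if "A c i" "A d j" "l \<noteq> i" for i j
    proof
      assume "i = j"
      then show False
        using no_C4[of c l d i] p(1) u(1) that A_sym ne A_ne[OF that(1)] A_ne[OF that(2)] by auto
    qed
    have "distinct [c, l, d, p, q, u, v]"
      using ne p(4) u(4) apart[OF p(2) u(2)] apart[OF p(2) u(3)] apart[OF p(3) u(2)] apart[OF p(3) u(3)]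
      by auto
    then show False using no_branching_at_distance_2[of c l d p q u v] p(1-3) u(1-3) A_sym by blast
  qed
qed

text \<open>The choice follows the order double edge, triangle, claw, because each of the lemmas
  above relies on the absence of the earlier kinds.\<close>

lemma clean_exists: "\<exists>w. clean w"
proof (cases "\<exists>x y. D x y")
  case True
  then obtain x y where xy: "D x y" by blast
  then show ?thesis
    using clean_two_doubles clean_one_double[OF xy] by blast
next
  case False
  then have D: "\<not> D u v" for u v by blast
  show ?thesis
  proof (cases "\<exists>a b c. A a b \<and> A b c \<and> A a c")
    case True
    then show ?thesis using clean_triangle[OF D] by blast
  next
    case False
    then have T: "A a b \<Longrightarrow> A b c \<Longrightarrow> \<not> A a c" for a b c by blast
    show ?thesis
    proof (cases "\<exists>c x y z. A c x \<and> A c y \<and> A c z \<and> distinct [x, y, z]")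
      case True
      then obtain c x y z where "A c x" "A c y" "A c z" "distinct [x, y, z]" by blast
      then have "clean c" using clean_claw[of c x y z] D T by blast
      then show ?thesis ..
    next
      case False
      \<comment> \<open>With nothing to meet, any name is clean, whether or not it is a
        vertex.\<close>
      have "clean 0"
      proof (rule cleanI)
        show False if "D x y" for x y using D that by blast
        show False if "A a b" "A b c" "A a c" for a b c using T that by blast
        show False if "A c x" "A c y" "A c z" "distinct [x, y, z]" for c x y z using False that by blast
      qed
      then show ?thesis ..
    qed
  qed
qed

text \<open>If the two neighbours of \<open>w\<close> are not adjacent, they are joined by an auxiliary edge:
  a cycle through it would give a cycle through \<open>w\<close>, and a layout of the linear forest
  obtained from \<open>G - w\<close> in this way puts them at consecutive positions.\<close>

lemma laid_if_clean:
  assumes w: "clean w" and N: "\<And>x. A w x \<Longrightarrow> x = a \<or> x = b"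
    and ab: "a = b \<or> A w a \<and> A w b \<and> (A a b \<or>
      (\<forall>s t. A a s \<longrightarrow> A a t \<longrightarrow> s \<noteq> w \<longrightarrow> t \<noteq> w \<longrightarrow> s = t) \<and>
      (\<forall>s t. A b s \<longrightarrow> A b t \<longrightarrow> s \<noteq> w \<longrightarrow> t \<noteq> w \<longrightarrow> s = t))"
  shows "laid 1 G"
proof -
  define joined where "joined x y \<longleftrightarrow> a \<noteq> b \<and> (x = a \<and> y = b \<or> x = b \<and> y = a)" for x y
  define R where "R x y \<longleftrightarrow> A x y \<or> joined x y" for x y
  let ?V = "verts G - {w}"
  have fin: "finite ?V" using wf by (simp add: wf_graph_def)
  have VA: "x \<in> verts G" "y \<in> verts G" if "A x y" for x y using adjD[OF wf that] by auto
  \<comment> \<open>An end of the auxiliary edge has at most one neighbour besides \<open>w\<close>,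
    so the auxiliary edge keeps its degree at most two.\<close>
  have one: "s = t" if "\<not> A a b" "joined x y" "A x s" "A x t" "s \<noteq> w" "t \<noteq> w" for x y s t
    using ab that unfolding joined_def by blast
  have "\<exists>p :: nat \<Rightarrow> nat. inj_on p ?V \<and> (\<forall>x\<in>?V. \<forall>y\<in>?V. R x y \<longrightarrow> p y = Suc (p x) \<or> p x = Suc (p y))"
  proof (rule linear_forest_positions[OF fin])
    show "R y x" if "R x y" for x y using that A_sym unfolding R_def joined_def by blast
    show "\<not> R x x" for x using A_irrefl unfolding R_def joined_def by blast
    show "\<not> distinct [x, y, z]"
      if v: "v \<in> ?V" and xyz: "{x, y, z} \<subseteq> ?V" and R: "R v x" "R v y" "R v z" for v x y z
    proof
      assume d: "distinct [x, y, z]"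
      have nw: "w \<notin> {v, x, y, z}" using v xyz by auto
      have "\<not> (A v x \<and> A v y \<and> A v z)" using cleanD(3)[OF w _ _ _ d] nw by blast
      then obtain u where u: "u \<in> {x, y, z}" "joined v u" "\<not> A v u" using R unfolding R_def by blast
      then have nab: "\<not> A a b" using A_sym unfolding joined_def by blast
      have uniq: "s = u" if "joined v s" for s using that u(2) unfolding joined_def by blast
      obtain s t where st: "s \<in> {x, y, z}" "t \<in> {x, y, z}" "s \<noteq> t" "s \<noteq> u" "t \<noteq> u"
        using u(1) d by (metis distinct_length_2_or_more insertCI)
      then have "A v s" "A v t" using R uniq unfolding R_def by blast+
      then show False using one[OF nab u(2)] st nw by blast
    qed
    show "\<exists>v\<in>U. \<forall>x\<in>U. \<forall>y\<in>U. R v x \<longrightarrow> R v y \<longrightarrow> x = y" if U: "U \<subseteq> ?V" "U \<noteq> {}" for U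
    proof (rule ccontr)
      assume "\<not> ?thesis"
      then have two: "\<exists>x\<in>U. \<exists>y\<in>U. x \<noteq> y \<and> R v x \<and> R v y" if "v \<in> U" for v using that by blast
      have finU: "finite U" using U fin finite_subset by blast
      have wU: "w \<notin> U" using U by blast
      show False
      proof (cases "\<not> A a b \<and> a \<noteq> b \<and> a \<in> U \<and> b \<in> U")
        case False
        \<comment> \<open>Here \<open>R\<close> agrees with adjacency inside \<open>U\<close>, so
          minimum degree two yields a triangle that misses \<open>w\<close>.\<close>
        have RA: "A v x" if "v \<in> U" "x \<in> U" "R v x" for v x
          using False that A_sym unfolding R_def joined_def by blast
        have "\<exists>a\<in>U. \<exists>b\<in>U. \<exists>c\<in>U. A a b \<and> A b c \<and> A a c"
        proof (rule triangle_if_min_degree_2[OF finU U(2)])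
          show "\<exists>a\<in>U. \<exists>b\<in>U. a \<noteq> b \<and> A x a \<and> A x b" if "x \<in> U" for x
            using two[OF that] RA[OF that] by blast
        qed
        then show False using cleanD(2)[OF w] wU by blast
      next
        case True
        then have Aw: "A w a" "A w b" using ab by auto
        \<comment> \<open>The auxiliary edge is replaced by the detour through \<open>w\<close>, so
          \<open>U\<close> together with \<open>w\<close> has minimum degree two in
          \<open>G\<close>. The resulting triangle contains \<open>w\<close>, hence also
          \<open>a\<close> and \<open>b\<close>, which are not adjacent.\<close>
        have "\<exists>a\<in>insert w U. \<exists>b\<in>insert w U. \<exists>c\<in>insert w U. A a b \<and> A b c \<and> A a c"
        proof (rule triangle_if_min_degree_2)
          show "\<exists>s\<in>insert w U. \<exists>t\<in>insert w U. s \<noteq> t \<and> A x s \<and> A x t" if x: "x \<in> insert w U" for x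
          proof (cases "x = w")
            case True
            then show ?thesis using Aw \<open>\<not> A a b \<and> a \<noteq> b \<and> a \<in> U \<and> b \<in> U\<close> by blast
          next
            case False
            then have xU: "x \<in> U" using x by blast
            obtain s t where st: "s \<in> U" "t \<in> U" "s \<noteq> t" "R x s" "R x t" using two[OF xU] by blast
            show ?thesis
            proof (cases "A x s \<and> A x t")
              case True
              then show ?thesis using st by blast
            next
              case False
              then have j: "joined x s \<or> joined x t" using st unfolding R_def by blast
              then have "A x w" using Aw A_sym unfolding joined_def by blast
              moreover have "A x s \<or> A x t" using st unfolding R_def joined_def by blast
              moreover have "s \<noteq> w" "t \<noteq> w" using st(1,2) wU by auto
              ultimately show ?thesis using st(1,2) by (metis insertCI)
            qed
          qed
        qed (use finU in auto)
        then obtain p q r where t: "A p q" "A q r" "A p r" by blast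
        then have "w \<in> {p, q, r}" using cleanD(2)[OF w] by blast
        then obtain s t where st: "A w s" "A w t" "A s t" "s \<in> {p, q, r}" "t \<in> {p, q, r}"
          "\<forall>i\<in>{p, q, r}. i = w \<or> i = s \<or> i = t"
          by (rule triangle_vertex[OF t])
        then have "A a b" using N[OF st(1)] N[OF st(2)] A_ne[OF st(3)] A_sym by blast
        then show False using True by blast
      qed
    qed
  qed
  then obtain p :: "nat \<Rightarrow> nat" where p: "inj_on p ?V"
    "\<And>x y. x \<in> ?V \<Longrightarrow> y \<in> ?V \<Longrightarrow> R x y \<Longrightarrow> p y = Suc (p x) \<or> p x = Suc (p y)" by blast
  \<comment> \<open>The height of \<open>w\<close> is the lower position among its neighbours, and
    for \<open>a = b\<close> just the one position.\<close>
  define q where "q x = (if x = w then min (p a) (p b) else p x)" for x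
  have near: "q x = q w \<or> q x = Suc (q w)" if "A x w" for x
  proof -
    have x: "x = a \<or> x = b" "x \<noteq> w" using N A_sym that A_ne[OF that] by auto
    show ?thesis
    proof (cases "a = b")
      case True
      then show ?thesis using x by (auto simp: q_def)
    next
      case False
      then have "A w a" "A w b" using ab by auto
      then have "a \<in> ?V" "b \<in> ?V" using VA A_ne by blast+
      then have "p b = Suc (p a) \<or> p a = Suc (p b)"
        using p(2)[of a b] False unfolding R_def joined_def by blast
      then show ?thesis using x by (auto simp: q_def)
    qed
  qed
  have "inj_on q (verts G - {w})" using p(1) by (auto simp: inj_on_def q_def)
  moreover have "(u \<notin> {w} \<and> v \<notin> {w} \<longrightarrow> (q v = Suc (q u) \<or> q u = Suc (q v)) \<and>
           (\<forall>d\<in>edges G. ends G d = {u, v} \<longrightarrow> d = e)) \<and>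
        (u \<notin> {w} \<and> v \<in> {w} \<longrightarrow> q u = q v \<or> q u = Suc (q v)) \<and>
        (u \<in> {w} \<and> v \<in> {w} \<longrightarrow> q u \<le> Suc (q v))" if e: "e \<in> edges G" "ends G e = {u, v}" for e u v
  proof -
    have uv: "A u v" using e unfolding adj_def by blast
    have 1: "q v = Suc (q u) \<or> q u = Suc (q v)" if "u \<noteq> w" "v \<noteq> w"
      using p(2)[of u v] that VA[OF uv] uv by (simp add: q_def R_def)
    have 2: "d = e" if "u \<noteq> w" "v \<noteq> w" "d \<in> edges G" "ends G d = {u, v}" for d
    proof (rule ccontr)
      assume "d \<noteq> e"
      then have "D u v" using that e unfolding dbl_def by blast
      then show False using cleanD(1)[OF w] that by blast
    qed
    have 3: "q u = q w \<or> q u = Suc (q w)" if "v = w" using near uv that by blast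
    show ?thesis using 1 2 3 by auto
  qed
  ultimately have "layout {w} q G" unfolding layout_def by blast
  moreover have "card ({w} \<inter> verts G) \<le> 1" using card_mono[of "{w}" "{w} \<inter> verts G"] by simp
  ultimately show ?thesis unfolding laid_def by blast
qed


text \<open>With \<open>w\<close> off the path, \<open>s\<close> and \<open>t\<close> would take
  both places beside \<open>a\<close> and leave none for \<open>b\<close>. Since \<open>H4\<close>
  and \<open>H5\<close> exclude double edges, a neighbour \<open>f\<close> of \<open>a\<close> that
  is adjacent to nothing else can replace \<open>w\<close>.\<close>

lemma laid_two_neighbours_aux:
  assumes w: "clean w" and N: "\<And>x. A w x \<Longrightarrow> x = a \<or> x = b"
    and ab: "A w a" "A w b" "a \<noteq> b" "\<not> A a b"
    and a: "A a s" "A a t" "s \<noteq> t" "s \<noteq> w" "t \<noteq> w"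
  shows "laid 1 G"
proof -
  note ne = A_ne[OF ab(1)] A_ne[OF ab(2)] ab(3) A_ne[OF a(1)] A_ne[OF a(2)] a(3-5)
  have sb: "s \<noteq> b" "t \<noteq> b" using a ab(4) by auto
  have Da: "\<not> D w a"
    using no_H4[of a w s t b] D_sym a ab ne sb by auto
  have Db: "\<not> D w b"
    using no_H5[of s t a w b] a ab ne sb A_sym by auto
  have D: "\<not> D u v" for u v
  proof
    assume d: "D u v"
    then have "w = u \<or> w = v" using cleanD(1)[OF w] by blast
    then obtain z where "D w z" using d D_sym by blast
    then show False using N[OF D_A] Da Db by blast
  qed
  \<comment> \<open>Otherwise \<open>a\<close> and \<open>b\<close> both branch at distance two, and
    merging along \<open>w\<close> gives \<open>K14\<close>.\<close>
  have b1: "x = y" if "A b x" "A b y" "x \<noteq> w" "y \<noteq> w" for x y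
  proof (rule ccontr)
    assume xy: "x \<noteq> y"
    have nb: "b \<noteq> x" "b \<noteq> y" using A_ne that by auto
    have na: "x \<noteq> a" "y \<noteq> a" using that ab(4) A_sym by auto
    have meet: "i \<noteq> j" if "A a i" "A b j" "i \<noteq> w" for i j
    proof
      assume "i = j"
      then show False
        using no_C4[of w a i b] that ab ne A_sym A_ne[OF that(1)] A_ne[OF that(2)] by auto
    qed
    have "distinct [a, w, b, s, t, x, y]"
      using ne sb nb na xy that(3,4) meet[OF a(1) that(1)] meet[OF a(1) that(2)]
        meet[OF a(2) that(1)] meet[OF a(2) that(2)] by auto
    then show False using no_branching_at_distance_2[of a w b s t x y] ab a that A_sym by blast
  qed
  \<comment> \<open>If both \<open>s\<close> and \<open>t\<close> continued, they would form a long
    Y at \<open>a\<close> with the third leg through \<open>w\<close> to \<open>b\<close>.\<close>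
  have leaf: "\<exists>f f'. A a f \<and> A a f' \<and> f \<noteq> f' \<and> f \<noteq> w \<and> f' \<noteq> w \<and> (\<forall>x. A f x \<longrightarrow> x = a)"
  proof (rule ccontr)
    assume no: "\<not> ?thesis"
    obtain s' where s': "A s s'" "s' \<noteq> a" using no a by blast
    obtain t' where t': "A t t'" "t' \<noteq> a" using no a(1,2) a(3)[symmetric] a(4,5) by blast
    have far: "x' \<noteq> w \<and> x' \<noteq> b" if "A a x" "x \<noteq> w" "x \<noteq> b" "A x x'" "x' \<noteq> a" for x x'
    proof
      show "x' \<noteq> w" using N[of x] that A_sym A_irrefl by blast
      show "x' \<noteq> b"
      proof
        assume "x' = b"
        then show False
          using no_C4[of a x b w] that ab ne A_sym A_ne[OF that(1)] by auto
      qed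
    qed
    have ns: "s' \<noteq> t" using cleanD(2)[OF w a(1), of t] s' a ne by auto
    have nt: "t' \<noteq> s" using cleanD(2)[OF w a(2), of s] t' a ne by auto
    have nst: "s' \<noteq> t'"
    proof
      assume "s' = t'"
      then show False
        using no_C4[of a s s' t] a s' t' ne A_sym A_ne[OF s'(1)] A_ne[OF t'(1)] by auto
    qed
    have "distinct [a, s, s', t, t', w, b]"
      using ne sb ns nt nst s'(2) t'(2) A_ne[OF s'(1)] A_ne[OF t'(1)]
        far[OF a(1) a(4) sb(1) s'] far[OF a(2) a(5) sb(2) t'] by auto
    then show False using no_long_Y[of a s s' t t' w b] a(1,2) s'(1) t'(1) ab(1,2) A_sym by blast
  qed
  then obtain f f' where f: "A a f" "A a f'" "f \<noteq> f'" "f \<noteq> w" "f' \<noteq> w" "\<And>x. A f x \<Longrightarrow> x = a" by blast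
  have "clean f"
  proof (rule cleanI)
    show False if "D u v" for u v using D that by blast
    show False if t: "A p q" "A q r" "A p r" for p q r
    proof -
      have "w \<in> {p, q, r}" using cleanD(2)[OF w] t by blast
      then obtain u v where uv: "A w u" "A w v" "A u v" "u \<in> {p, q, r}" "v \<in> {p, q, r}"
        "\<forall>i\<in>{p, q, r}. i = w \<or> i = u \<or> i = v" by (rule triangle_vertex[OF t])
      then show False using N[OF uv(1)] N[OF uv(2)] A_ne[OF uv(3)] ab(4) A_sym by blast
    qed
    show False if c: "A c x" "A c y" "A c z" "distinct [x, y, z]" "f \<notin> {c, x, y, z}" for c x y z
    proof -
      have hit: "w \<in> {c, x, y, z}" using cleanD(3)[OF w] c by blast
      have "c \<noteq> w" using N[of x] N[of y] N[of z] c by auto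
      then have "w \<in> {x, y, z}" using hit by auto
      then obtain p q where p: "A c w" "A c p" "A c q" "distinct [w, p, q]"
        "p \<in> {x, y, z}" "q \<in> {x, y, z}" "\<forall>i\<in>{x, y, z}. i = w \<or> i = p \<or> i = q"
        by (rule claw_leaf[OF c(1-4)])
      have "c = a \<or> c = b" using N A_sym[OF p(1)] by blast
      moreover have "c \<noteq> b" using b1[of p q] p by auto
      ultimately have "c = a" by blast
      moreover have "f \<noteq> p" "f \<noteq> q" using p(5,6) c(5) by blast+
      \<comment> \<open>Exchanging the leaf \<open>w\<close> for \<open>f\<close> gives a claw at
        \<open>a\<close> that misses \<open>w\<close>.\<close>
      ultimately show False
        using cleanD(3)[OF w, of a f p q] p f ne by auto
    qed
  qed
  then show ?thesis by (rule laid_if_clean[of f a a]) (use f(6) in auto)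
qed

lemma laid_two_neighbours:
  assumes w: "clean w" and N: "\<And>x. A w x \<Longrightarrow> x = a \<or> x = b" and ab: "A w a" "A w b" "a \<noteq> b"
  shows "laid 1 G"
proof (rule ccontr)
  assume nl: "\<not> laid 1 G"
  have nab: "\<not> A a b" using laid_if_clean[OF w N] ab nl by blast
  have "s = t" if "A a s" "A a t" "s \<noteq> w" "t \<noteq> w" for s t
    using laid_two_neighbours_aux[OF w N ab nab that(1,2) _ that(3,4)] nl by blast
  moreover have "s = t" if "A b s" "A b t" "s \<noteq> w" "t \<noteq> w" for s t
    using laid_two_neighbours_aux[OF w, of b a s t] N ab nab that nl A_sym by blast
  ultimately show False using laid_if_clean[OF w N] ab nl by blast
qed

text \<open>Three neighbours of \<open>w\<close> do not fit into two positions, so \<open>u\<close>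
  goes off the path instead. Its only neighbours \<open>w\<close> and \<open>v\<close> are adjacent
  and thus consecutive. A claw that avoids \<open>u\<close> would have \<open>w\<close> as a leaf:
  with centre \<open>v\<close> it could trade \<open>w\<close> for \<open>u\<close>, and with centre
  \<open>c\<close> it gives \<open>H5\<close> with the triangle.\<close>

lemma laid_triangle_neighbours_aux:
  assumes w: "clean w" and N: "\<And>x. A w x \<Longrightarrow> x = u \<or> x = v \<or> x = c"
    and nb: "A w u" "A w v" "A w c" "distinct [u, v, c]" "A u v" "\<not> A u c" "\<not> A v c"
    and D: "\<not> D w v" "\<not> D w c" and u: "\<And>x. A u x \<Longrightarrow> x = w \<or> x = v"
  shows "laid 1 G"
proof -
  have ne: "w \<noteq> u" "w \<noteq> v" "w \<noteq> c" using nb A_ne by auto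
  have "clean u"
  proof (rule cleanI)
    show False if d: "D x y" "u \<noteq> x" "u \<noteq> y" for x y
    proof -
      have "w = x \<or> w = y" using cleanD(1)[OF w d(1)] .
      then obtain z where "D w z" "z \<noteq> u" using d D_sym by blast
      then show False using N[OF D_A] D by blast
    qed
    show False if t: "A p q" "A q r" "A p r" "u \<notin> {p, q, r}" for p q r
    proof -
      have "w \<in> {p, q, r}" using cleanD(2)[OF w] t by blast
      then obtain i j where ij: "A w i" "A w j" "A i j" "i \<in> {p, q, r}" "j \<in> {p, q, r}"
        "\<forall>k\<in>{p, q, r}. k = w \<or> k = i \<or> k = j" by (rule triangle_vertex[OF t(1-3)])
      then have "i \<noteq> u" "j \<noteq> u" using t(4) by blast+
      then show False using N[OF ij(1)] N[OF ij(2)] A_ne[OF ij(3)] ij(3) nb(7) A_sym by blast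
    qed
    show False if e: "A e x" "A e y" "A e z" "distinct [x, y, z]" "u \<notin> {e, x, y, z}" for e x y z
    proof -
      have hit: "w \<in> {e, x, y, z}" using cleanD(3)[OF w] e by blast
      have "e \<noteq> w" using N[of x] N[of y] N[of z] e by auto
      then have "w \<in> {x, y, z}" using hit by auto
      then obtain p q where p: "A e w" "A e p" "A e q" "distinct [w, p, q]"
        "p \<in> {x, y, z}" "q \<in> {x, y, z}" "\<forall>i\<in>{x, y, z}. i = w \<or> i = p \<or> i = q"
        by (rule claw_leaf[OF e(1-4)])
      have pu: "p \<noteq> u" "q \<noteq> u" "e \<noteq> u" using p(5,6) e(5) by blast+
      then have "e = v \<or> e = c" using N A_sym[OF p(1)] by blast
      then show False
      proof
        assume "e = v"
        then show False using cleanD(3)[OF w, of v u p q] p pu nb ne A_sym by auto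
      next
        assume ec: "e = c"
        then have "p \<noteq> v" "q \<noteq> v" using p nb(7) A_sym by blast+
        then have "distinct [c, p, q, w, u, v]"
          using pu p(4) ne nb(4) ec A_ne[OF p(2)] A_ne[OF p(3)] by auto
        then show False using no_claw_triangle[of c p q w u v] p ec nb A_sym by blast
      qed
    qed
  qed
  then show ?thesis by (rule laid_if_clean[of u w v]) (use u nb A_sym in blast)+
qed

text \<open>Each of \<open>a\<close> and \<open>b\<close> is barred from leaving the path either by
  a double edge from \<open>w\<close> to the other or by a further neighbour. Two double edges give
  \<open>H2\<close>, a double edge whose far end has a further neighbour gives \<open>H4\<close>,
  and two further neighbours give a 3-sun.\<close>

lemma laid_triangle_neighbours:
  assumes w: "clean w" and N: "\<And>x. A w x \<Longrightarrow> x = a \<or> x = b \<or> x = c"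
    and nb: "A w a" "A w b" "A w c" "distinct [a, b, c]" "A a b"
  shows "laid 1 G"
proof (rule ccontr)
  assume nl: "\<not> laid 1 G"
  have ne: "w \<noteq> a" "w \<noteq> b" "w \<noteq> c" using nb A_ne by auto
  have nac: "\<not> A a c" using no_C4[of w b a c] nb ne A_sym by auto
  have nbc: "\<not> A b c" using no_C4[of w a b c] nb ne A_sym by auto
  have Dc: "\<not> D w c" using no_H3[of w a b c] nb ne by auto
  have Dab: "\<not> (D w a \<and> D w b)" using no_H2[of w a b c] nb ne by auto
  have 1: "D w b \<or> (\<exists>x. A a x \<and> x \<noteq> w \<and> x \<noteq> b)"
    using laid_triangle_neighbours_aux[OF w N nb nac nbc _ Dc] nl by blast
  have 2: "D w a \<or> (\<exists>x. A b x \<and> x \<noteq> w \<and> x \<noteq> a)"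
    using laid_triangle_neighbours_aux[OF w, of b a c] N nb nac nbc Dc nl A_sym by auto
  have pendant: False if "D w x" "A x x'" "x' \<noteq> w" "x' \<noteq> y" "A w y" "A w c" "distinct [x, y, c]"
    "\<not> A x c" "x \<noteq> w" "y \<noteq> w" for x x' y
    using no_H4[of w x y c x'] that ne A_ne[OF that(2)] by auto
  show False
  proof (cases "D w a")
    case True
    then obtain a' where "A a a'" "a' \<noteq> w" "a' \<noteq> b" using 1 Dab by blast
    then show False using pendant[of a a' b] True nb nac ne by auto
  next
    case Da: False
    then obtain b' where b': "A b b'" "b' \<noteq> w" "b' \<noteq> a" using 2 by blast
    show False
    proof (cases "D w b")
      case True
      then show False using pendant[of b b' a] b' nb nbc ne by auto
    next
      case False
      then obtain a' where a': "A a a'" "a' \<noteq> w" "a' \<noteq> b" using 1 by blast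
      have "a' \<noteq> b'"
      proof
        assume "a' = b'"
        then show False
          using no_C4[of w a a' b] a' b' nb ne A_sym A_ne[OF a'(1)] A_ne[OF b'(1)] by auto
      qed
      moreover have "a' \<noteq> c" "b' \<noteq> c" using a' b' nac nbc by auto
      ultimately have "distinct [a, b, w, a', b', c]"
        using nb(4) ne a' b' A_ne[OF a'(1)] A_ne[OF b'(1)] by auto
      then show False using no_3_sun[of a b w a' b' c] nb a' b' A_sym by blast
    qed
  qed
qed

text \<open>Taking \<open>u\<close> off the path leaves \<open>w\<close> with at most two
  neighbours, so \<open>w\<close> is no claw centre there, and \<open>deg\<close> keeps it from
  being a leaf of a claw.\<close>

lemma laid_pendant_neighbour:
  assumes w: "clean w" and N: "\<And>x. A w x \<Longrightarrow> x = u \<or> x = b \<or> x = c"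
    and bc: "\<not> A b c" and nb: "A w u" and D: "\<not> D w b" "\<not> D w c" and u: "\<And>x. A u x \<Longrightarrow> x = w"
    and deg: "\<And>x s t. A w x \<Longrightarrow> x \<noteq> u \<Longrightarrow> A x s \<Longrightarrow> A x t \<Longrightarrow> s \<noteq> w \<Longrightarrow> t \<noteq> w \<Longrightarrow> s = t"
  shows "laid 1 G"
proof -
  have "clean u"
  proof (rule cleanI)
    show False if d: "D x y" "u \<noteq> x" "u \<noteq> y" for x y
    proof -
      have "w = x \<or> w = y" using cleanD(1)[OF w d(1)] .
      then obtain z where "D w z" "z \<noteq> u" using d D_sym by blast
      then show False using N[OF D_A] D by blast
    qed
    show False if t: "A p q" "A q r" "A p r" "u \<notin> {p, q, r}" for p q r
    proof -
      have "w \<in> {p, q, r}" using cleanD(2)[OF w] t by blast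
      then obtain i j where ij: "A w i" "A w j" "A i j" "i \<in> {p, q, r}" "j \<in> {p, q, r}"
        "\<forall>k\<in>{p, q, r}. k = w \<or> k = i \<or> k = j" by (rule triangle_vertex[OF t(1-3)])
      then have "i \<noteq> u" "j \<noteq> u" using t(4) by blast+
      then show False using N[OF ij(1)] N[OF ij(2)] A_ne[OF ij(3)] ij(3) bc A_sym by blast
    qed
    show False if e: "A e x" "A e y" "A e z" "distinct [x, y, z]" "u \<notin> {e, x, y, z}" for e x y z
    proof -
      have hit: "w \<in> {e, x, y, z}" using cleanD(3)[OF w] e by blast
      have "e \<noteq> w" using N[of x] N[of y] N[of z] e by auto
      then have "w \<in> {x, y, z}" using hit by auto
      then obtain p q where p: "A e w" "A e p" "A e q" "distinct [w, p, q]"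
        "p \<in> {x, y, z}" "q \<in> {x, y, z}" "\<forall>i\<in>{x, y, z}. i = w \<or> i = p \<or> i = q"
        by (rule claw_leaf[OF e(1-4)])
      then show False using deg[OF A_sym[OF p(1)] _ p(2,3)] e(5) by auto
    qed
  qed
  then show ?thesis by (rule laid_if_clean[of u w w]) (use u in auto)
qed

text \<open>The end \<open>a\<close> of the double edge goes off the path: \<open>H2\<close>
  excludes other double edges at \<open>w\<close>, \<open>H4\<close> further neighbours of
  \<open>a\<close>, and \<open>H5\<close> branching at \<open>b\<close> or \<open>c\<close>.\<close>

lemma laid_independent_neighbours_double:
  assumes w: "clean w" and N: "\<And>x. A w x \<Longrightarrow> x = a \<or> x = b \<or> x = c"
    and nb: "A w a" "A w b" "A w c" "distinct [a, b, c]" "\<not> A a b" "\<not> A a c" "\<not> A b c"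
    and D: "D w a"
  shows "laid 1 G"
proof (rule laid_pendant_neighbour[OF w N nb(7,1)])
  have ne: "w \<noteq> a" "w \<noteq> b" "w \<noteq> c" using nb A_ne by auto
  show "\<not> D w b" using no_H2[of w a b c] D nb ne by auto
  show "\<not> D w c" using no_H2[of w a c b] D nb ne by auto
  show "x = w" if x: "A a x" for x
  proof (rule ccontr)
    assume "x \<noteq> w"
    moreover have "x \<noteq> b" "x \<noteq> c" using x nb by auto
    ultimately show False using no_H4[of w a b c x] D nb ne x A_ne[OF x] by auto
  qed
  show "s = t" if x: "A w x" "x \<noteq> a" "A x s" "A x t" "s \<noteq> w" "t \<noteq> w" for x s t
  proof (rule ccontr)
    assume st: "s \<noteq> t"
    have "x = b \<or> x = c" using N x by blast
    then have "\<not> A x a" using nb A_sym by blast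
    then have "s \<noteq> a" "t \<noteq> a" using x by auto
    then have "distinct [s, t, x, w, a]"
      using st x ne A_ne[OF x(1)] A_ne[OF x(3)] A_ne[OF x(4)] by auto
    then show False using no_H5[of s t x w a] x D A_sym by blast
  qed
qed

text \<open>A neighbour of \<open>w\<close> that branches again would give \<open>K14\<close> by
  merging it with \<open>w\<close>. So each of the three legs continues in at most one way: either
  one of them stops, and its vertex goes off the path, or all continue and form the long Y.\<close>

lemma laid_independent_neighbours:
  assumes w: "clean w" and N: "\<And>x. A w x \<Longrightarrow> x = a \<or> x = b \<or> x = c"
    and nb: "A w a" "A w b" "A w c" "distinct [a, b, c]" "\<not> A a b" "\<not> A a c" "\<not> A b c"
  shows "laid 1 G"
proof (rule ccontr)
  assume nl: "\<not> laid 1 G"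
  have ne: "w \<noteq> a" "w \<noteq> b" "w \<noteq> c" using nb A_ne by auto
  have nb': "\<not> A b a" "\<not> A c a" "\<not> A c b" using nb A_sym by blast+
  have Da: "\<not> D w a" using laid_independent_neighbours_double[OF w N nb] nl by blast
  have Db: "\<not> D w b"
    using laid_independent_neighbours_double[OF w, of b a c] N nb nb' nl by auto
  have Dc: "\<not> D w c"
    using laid_independent_neighbours_double[OF w, of c a b] N nb nb' nl by auto
  have branch: "s = t" if "A w x" "A w y" "A w z" "distinct [x, y, z]" "\<not> A x y" "\<not> A x z"
    "A x s" "A x t" "s \<noteq> w" "t \<noteq> w" for x y z s t
  proof (rule ccontr)
    assume st: "s \<noteq> t"
    have "s \<noteq> y" "s \<noteq> z" "t \<noteq> y" "t \<noteq> z" using that by auto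
    then have "distinct [w, x, y, z, s, t]"
      using st that(4,9,10) A_ne[OF that(1)] A_ne[OF that(2)] A_ne[OF that(3)]
        A_ne[OF that(7)] A_ne[OF that(8)] by auto
    then show False using no_adjacent_branching[of w x y z s t] that by blast
  qed
  have deg: "s = t" if "A w x" "A x s" "A x t" "s \<noteq> w" "t \<noteq> w" for x s t
    using N[OF that(1)]
  proof (elim disjE)
    assume "x = a" then show ?thesis using branch[of a b c s t] nb nb' that by auto
  next
    assume "x = b" then show ?thesis using branch[of b a c s t] nb nb' that by auto
  next
    assume "x = c" then show ?thesis using branch[of c a b s t] nb nb' that by auto
  qed
  obtain a' where a': "A a a'" "a' \<noteq> w"
    using laid_pendant_neighbour[OF w N nb(7,1) Db Dc] deg nl by blast
  obtain b' where b': "A b b'" "b' \<noteq> w"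
    using laid_pendant_neighbour[OF w, of b a c] N nb Da Dc deg nl by blast
  obtain c' where c': "A c c'" "c' \<noteq> w"
    using laid_pendant_neighbour[OF w, of c a b] N nb Da Db deg nl by blast
  have apart: "x' \<noteq> y'" if "A w x" "A w y" "x \<noteq> y" "A x x'" "A y y'" "x' \<noteq> w" for x y x' y'
  proof
    assume "x' = y'"
    then show False
      using no_C4[of w x x' y] that A_sym A_ne[OF that(1)] A_ne[OF that(2)] A_ne[OF that(4)]
        A_ne[OF that(5)] by auto
  qed
  have "a' \<noteq> b'" "a' \<noteq> c'" "b' \<noteq> c'"
    using apart[OF nb(1,2) _ a'(1) b'(1) a'(2)] apart[OF nb(1,3) _ a'(1) c'(1) a'(2)]
      apart[OF nb(2,3) _ b'(1) c'(1) b'(2)] nb(4) by auto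
  moreover have "a' \<notin> {b, c}" "b' \<notin> {a, c}" "c' \<notin> {a, b}" using a' b' c' nb nb' by auto
  ultimately have "distinct [w, a, a', b, b', c, c']"
    using nb(4) ne a'(2) b'(2) c'(2) A_ne[OF a'(1)] A_ne[OF b'(1)] A_ne[OF c'(1)] by auto
  then show False using no_long_Y[of w a a' b b' c c'] nb a'(1) b'(1) c'(1) by blast
qed

lemma laid_1: "laid 1 G"
proof -
  obtain w where w: "clean w" using clean_exists by blast
  show ?thesis
  proof (cases "\<exists>a. \<forall>x. A w x \<longrightarrow> x = a")
    case True
    then obtain a where "\<And>x. A w x \<Longrightarrow> x = a" by blast
    then show ?thesis using laid_if_clean[OF w, of a a] by blast
  next
    case False
    then obtain a b where ab: "A w a" "A w b" "a \<noteq> b" by metis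
    show ?thesis
    proof (cases "\<forall>x. A w x \<longrightarrow> x = a \<or> x = b")
      case True
      then show ?thesis using laid_two_neighbours[OF w _ ab] by blast
    next
      case False
      then obtain c where c: "A w c" "c \<noteq> a" "c \<noteq> b" by blast
      \<comment> \<open>A fourth neighbour would make \<open>w\<close> the centre of
        \<open>K14\<close>.\<close>
      have N: "x = a \<or> x = b \<or> x = c" if "A w x" for x
        using no_K14[of w a b c x] that ab c A_ne[OF that] A_ne[OF ab(1)] A_ne[OF ab(2)] A_ne[OF c(1)]
        by auto
      have d: "distinct [a, b, c]" using ab c by auto
      consider "A a b" | "A a c" | "A b c" | "\<not> A a b" "\<not> A a c" "\<not> A b c" by blast
      then show ?thesis
      proof cases
        case 1
        then show ?thesis using laid_triangle_neighbours[OF w N ab(1,2) c(1) d] by blast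
      next
        case 2
        then show ?thesis using laid_triangle_neighbours[OF w, of a c b] N ab c by auto
      next
        case 3
        then show ?thesis using laid_triangle_neighbours[OF w, of b c a] N ab c by auto
      next
        case 4
        then show ?thesis using laid_independent_neighbours[OF w N ab(1,2) c(1) d] by blast
      qed
    qed
  qed
qed

end

section \<open>Assembling the characterisation\<close>

definition obstructions :: "mgraph set" where
  "obstructions = {C2_C2, C2_K13, K13_K13, C4, H1, H2, H3, H4, H5, K14, long_Y}"

lemma obstruction_floor:
  assumes "M \<in> obstructions"
  shows "wf_graph M" "spectator_floor M = 2"
proof -
  show wf: "wf_graph M" using assms wf_list unfolding obstructions_def by blast
  have "laid 2 M" "\<not> laid 1 M"
    using assms laid_2 not_laid_1 unfolding obstructions_def by blast+
  then have "spectator_floor M \<le> 2" "\<not> spectator_floor M \<le> 1"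
    using laid_imp_floor_le[OF wf] floor_le_1_iff[OF wf] by blast+
  then show "spectator_floor M = 2" by simp
qed

lemma spectator_floor_iso:
  assumes "wf_graph G" "graph_iso G H"
  shows "spectator_floor G = spectator_floor H"
proof -
  have wfH: "wf_graph H" using wf_graph_iso[OF assms] .
  have "is_minor G K \<longleftrightarrow> is_minor H K" if "wf_graph K" for K
    unfolding is_minor_def
    using graph_iso_trans[OF wf_minor_steps[OF _ that] _ assms(2)]
      graph_iso_trans[OF wf_minor_steps[OF _ that] _ graph_iso_sym[OF assms]] by blast
  then have "(\<exists>K. wf_graph K \<and> is_minor G K \<and> sp K = k) = (\<exists>K. wf_graph K \<and> is_minor H K \<and> sp K = k)" for k
    by blast
  then show ?thesis unfolding spectator_floor_def by simp
qed

lemma obstruction_minor: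
  assumes "wf_graph G" "\<not> laid 1 G"
  shows "\<exists>M\<in>obstructions. is_minor M G"
proof (rule ccontr)
  assume "\<not> ?thesis"
  then have "obstruction_free G"
    using assms(1) unfolding obstruction_free_def obstructions_def by simp
  then show False using obstruction_free.laid_1 assms(2) by blast
qed

text \<open>A proper minor passes through the result of a single step, which is laid with one vertex
  off the path, and this property descends to minors.\<close>

lemma obstruction_minimal:
  assumes "M \<in> obstructions" "graph_iso G M" "wf_graph G" "is_proper_minor H G" "wf_graph H"
  shows "spectator_floor H \<noteq> 2"
proof -
  obtain G' where G': "minor_step\<^sup>+\<^sup>+ G G'" "graph_iso G' H"
    using assms(4) unfolding is_proper_minor_def by blast
  obtain G1 where G1: "minor_step G G1" "minor_step\<^sup>*\<^sup>* G1 G'"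
    using tranclpD[OF G'(1)] by blast
  obtain M1 where M1: "minor_step M M1" "graph_iso G1 M1"
    using minor_step_iso[OF assms(3,2) G1(1)] by blast
  have "laid 1 M1" using M1(1) laid_1_minor_step assms(1) unfolding obstructions_def by blast
  then have "laid 1 G1" using laid_iso[OF wf_minor_step[OF assms(3) G1(1)] M1(2)] by blast
  moreover have "is_minor H G1" using G1(2) G'(2) unfolding is_minor_def by blast
  ultimately have "laid 1 H" using laid_minor[OF _ assms(5) wf_minor_step[OF assms(3) G1(1)]] by blast
  then have "spectator_floor H \<le> 1" using laid_imp_floor_le[OF assms(5)] by blast
  then show ?thesis by simp
qed

lemma minor_minimal_floor_2_iff:
  assumes "wf_graph G"
  shows "minor_minimal_floor 2 G \<longleftrightarrow> (\<exists>M\<in>obstructions. graph_iso G M)"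
proof
  assume G: "minor_minimal_floor 2 G"
  then have "\<not> laid 1 G" using floor_le_1_iff[OF assms] by (simp add: minor_minimal_floor_def)
  then obtain M where M: "M \<in> obstructions" "is_minor M G" using obstruction_minor[OF assms] by blast
  obtain G' where G': "minor_step\<^sup>*\<^sup>* G G'" "graph_iso G' M" using M(2) unfolding is_minor_def by blast
  have "\<not> is_proper_minor M G"
    using G obstruction_floor[OF M(1)] unfolding minor_minimal_floor_def by blast
  then have "\<not> minor_step\<^sup>+\<^sup>+ G G'" using G'(2) unfolding is_proper_minor_def by blast
  \<comment> \<open>The listed minor also has floor 2, so minimality leaves only the empty sequence
    of steps.\<close>
  then have "G' = G" using G'(1) by (metis rtranclpD)
  then show "\<exists>M\<in>obstructions. graph_iso G M" using G'(2) M(1) by blast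
next
  assume "\<exists>M\<in>obstructions. graph_iso G M"
  then obtain M where M: "M \<in> obstructions" "graph_iso G M" by blast
  have "spectator_floor G = 2"
    using spectator_floor_iso[OF assms M(2)] obstruction_floor(2)[OF M(1)] by simp
  then show "minor_minimal_floor 2 G"
    unfolding minor_minimal_floor_def using obstruction_minimal[OF M assms] by blast
qed

theorem theorem6p10:
  assumes "wf_graph G"
  shows "minor_minimal_floor 2 G \<longleftrightarrow>
    (graph_iso G C2_C2 \<or> graph_iso G C2_K13 \<or> graph_iso G K13_K13 \<or> graph_iso G C4 \<or>
     graph_iso G H1 \<or> graph_iso G H2 \<or> graph_iso G H3 \<or> graph_iso G H4 \<or> graph_iso G H5 \<or>
     graph_iso G K14 \<or> graph_iso G long_Y)"
  unfolding minor_minimal_floor_2_iff[OF assms] obstructions_def by simp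

end
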